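(* Let $n\ge 1$ and let $a_1,\dots,a_{2n}$ be a sequence of nonzero integers. The local equivalence class of the standard complex $C(a_1,\dots,a_{2n})$ is algebraically realizable if and only if $C(a_1,\dots,a_{2n})$ is partially realizable. Whether $C(a_1,\dots,a_{2n})$ is partially realizable is decided by the Procedure described in the context, which terminates in at most $n^2+n$ steps (a step being the addition of one arrow): it ends with SUCCESS if $C(a_1,\dots,a_{2n})$ is partially realizable, and with FAILURE otherwise. As a special case, the local equivalence class of $C(a_1,\dots,a_{2n})$ is algebraically realizable if $|a_i|\ge 2$ for all $i$. (Here "algebraically realizable" is taken in the plain sense of the context for arbitrary sequences and, when $C(a_1,\dots,a_{2n})$ is symmetric, also in the symmetric sense.)
   Context: **Rings and gradings.** Let $\mathbb F=\mathbb Z/2\mathbb Z$. The ring $\mathbb F[U,V]$ is $\mathbb Z\oplus\mathbb Z$-graded by $\mathrm{gr}=(\mathrm{gr}_U,\mathrm{gr}_V)$ with $\mathrm{gr}(U)=(-2,0)$, $\mathrm{gr}(V)=(0,-2)$. For $i\in\mathbb N=\{1,2,\dots\}$ put $\mathcal R_i=\mathbb F[U,V]/(U^iV^i)$, and $\mathcal R_\infty=\mathbb F[U,V]$, with the induced gradings. All modules are $\mathbb Z\oplus\mathbb Z$-graded, distinguished bases consist of homogeneous elements, and every endomorphism denoted $\partial$ has degree $(-1,-1)$. For $i\in\mathbb N\cup\{\infty\}$, a *free $\mathcal R_i$-module with an endomorphism and a distinguished basis* is a triple $(C,\partial,B)$ with $C$ a free $\mathcal R_i$-module, $\partial:C\to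 C$ an $\mathcal R_i$-linear endomorphism, $B$ a basis of $C$; if $\partial^2=0$ it is a *free chain complex over $\mathcal R_i$ with a distinguished basis*. For $i\le j$, the *lift* of $(C,\partial,B)$ to $\mathcal R_j$ is the free $\mathcal R_j$-module on $B$ with the endomorphism defined on $B$ by the same formulas. For $x,y\in B$, $\langle \partial x,U^aV^by\rangle\in\mathbb F$ is the coefficient of $U^aV^by$ in $\partial x$ (similarly for $\partial^2$). If this coefficient of $\partial x$ is $1$, we say there is an *arrow* from $x$ to $y$ (with coefficient $U^aV^b$); it is *horizontal* (a $U$-arrow of length $a$) if $b=0$, *vertical* (a $V$-arrow of length $b$) if $a=0$, and *diagonal* if $a,b\ge1$. **Correct homology, symmetry, knot-like complexes.** A chain complex $C$ over $\mathcal R_i$ has the *correct homology* if $H_*(C/U)/(V\text{-torsion})\cong\mathbb F[V]$, generated by an element of $\mathrm{gr}_U=0$, and $H_*(C/V)/(U\text{-torsion})\cong\mathbb F[U]$, generated by an element of $\mathrm{gr}_V=0$ (here $C/U=C/UC$, $C/V=C/VC$). It is *symmetric* if $C$ is chain homotopy equivalent to $\overline C$, the complex obtained by interchanging the roles of $U$ and $V$ and of $\mathrm{gr}_U$ and $\mathrm{gr}_V$. A *knot-like complex* is a finitely generated free chain complex over $\mathcal R_1$ with the correct homology. **Standard complexes.** $C(a_1,\dots,a_{2n})$ is the free chain complex over $\mathcal R_1$ with distinguished basis $\{x_0,\dots,x_{2n}\}$ whose arrows are exactly the following: for each $1\le i\le 2n$, one arrow connecting $x_i$ and $x_{i-1}$,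 which is a $U$-arrow of length $|a_i|$ if $i$ is odd and a $V$-arrow of length $|a_i|$ if $i$ is even; it goes from $x_i$ to $x_{i-1}$ if $a_i>0$ and from $x_{i-1}$ to $x_i$ if $a_i<0$. The basis elements carry the unique $\mathbb Z\oplus\mathbb Z$-gradings making this a knot-like complex. **Local equivalence.** Knot-like complexes $C_1,C_2$ are locally equivalent if there are grading-preserving $\mathcal R_1$-linear chain maps $C_1\to C_2$ and $C_2\to C_1$ inducing isomorphisms on $H_*(C_i/U)/(V\text{-torsion})$ and on $H_*(C_i/V)/(U\text{-torsion})$. By a known theorem of Dai, Hom, Stoffregen and Truong, every knot-like complex $C$ splits as $C\cong C(a_1,\dots,a_{2n})\oplus A$ over $\mathcal R_1$ for a unique standard complex and some chain complex $A$; thus the knot-like complexes in the local equivalence class of $C(a_1,\dots,a_{2n})$ are exactly those isomorphic to $C(a_1,\dots,a_{2n})\oplus A$ for some $A$. **Realizability.** A free $\mathcal R_1$-module with an endomorphism and a distinguished basis $(C,\partial_C,B)$ is *partially realizable* if it is the mod $UV$ reduction of a free chain complex $(D,\partial_D,B)$ over $\mathcal R_2$ with distinguished basis $B$ (a *partial realization* ), and *fully realizable* if it is the mod $UV$ reduction of a free chain complex $(D,\partial_D,B)$ over $\mathcal R_\infty$ with distinguished basis $B$ (a *full realization* ). A knot-like complex is *algebraically realizable* (plain sense) if, with some distinguished basis, it has a full realization with the correct homology. A symmetric knot-like complex is *algebraically realizable* in the symmetric sense if it has a full realization that is symmetric and has the correct homology. A local equivalence class of knot-like complexes is *algebraically realizable*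 (in either sense) if one of its representatives (a symmetric one, for the symmetric sense) is. **Procedure.** Start with the lift $(C,\partial,\{x_0,\dots,x_{2n}\})$ of $C(a_1,\dots,a_{2n})$ to $\mathcal R_2$. Repeat the following, updating $\partial$. If $\langle\partial^2x_i,U^aV^bx_j\rangle=0$ for all $i,j$ and all $a,b\ge1$ with $1\in\{a,b\}$, stop with SUCCESS; the current $(C,\partial,\{x_0,\dots,x_{2n}\})$ is output as a partial realization. Otherwise choose $i,j,a,b$ with $1\in\{a,b\}$ and $\langle\partial^2x_i,U^aV^bx_j\rangle=1$. - Case $b=1$: one of the two arrows composing from $x_i$ to $x_j$ is horizontal. (1a) If the first arrow is horizontal (from $x_i$ to $x_{i\pm1}$, followed by a vertical or diagonal arrow to $x_j$): if there is a horizontal arrow adjacent to $x_j$ (it is then unique, joining $x_j$ to some $x_{j\pm1}$), it points into $x_j$, and its length $d$ satisfies $d<a$, add a diagonal arrow from $x_i$ to that $x_{j\pm1}$ with coefficient $U^{a-d}V$; otherwise stop with FAILURE. (1b) If the second arrow is horizontal (a vertical or diagonal arrow from $x_i$ to $x_{j\pm1}$, then a horizontal arrow to $x_j$): if there is a horizontal arrow adjacent to $x_i$ (unique, joining $x_i$ to some $x_{i\pm1}$), it points out of $x_i$, and its length $d$ satisfies $d<a$, add a diagonal arrow from that $x_{i\pm1}$ to $x_j$ with coefficient $U^{a-d}V$; otherwise stop with FAILURE. - Case $a=1$: the same with the roles of $U$ and $V$, of $a$ and $b$, and of horizontal and vertical exchanged. The choices of $i,j,a,b$ may be made in any order. *)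

theory Defs
  imports
    "HOL-Library.Z2"
    "HOL-Library.Poly_Mapping"
    "HOL-Library.Product_Plus"
    "HOL-Library.Function_Algebras"
    "HOL-Library.Extended_Nat"
begin

text \<open>
  The ring \<open>F[U,V]\<close> over the two-element field: the exponent \<open>(a, b)\<close> stands for the
  monomial \<open>U^a V^b\<close>, and \<open>*\<close> on the type is the product of polynomials.
\<close>

type_synonym FUV = "(nat \<times> nat) \<Rightarrow>\<^sub>0 bit"

definition UV_mono :: "nat \<times> nat \<Rightarrow> FUV" where
  "UV_mono m = Poly_Mapping.single m 1"

definition swap_UV :: "FUV \<Rightarrow> FUV" where
  "swap_UV p = Poly_Mapping.map_key prod.swap p"

fun wt :: "nat \<times> nat \<Rightarrow> int \<times> int" where
  "wt (a, b) = (- 2 * int a, - 2 * int b)"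

text \<open>
  Every quotient ring used below is \<open>F[U,V]/I\<close> for an ideal \<open>I\<close> spanned by monomials.  Such a
  ring is given by the set \<open>S\<close> of the monomials outside \<open>I\<close>: each residue class has exactly one
  representative with all its monomials in \<open>S\<close> (an element of \<open>qring S\<close>), \<open>normal_form S\<close>
  computes it, and the product in the quotient is \<open>normal_form S (p * q)\<close>.
  \<open>mons i\<close> gives the ring \<open>R_i = F[U,V]/(U^i V^i)\<close> for \<open>i \<ge> 1\<close>, and \<open>mons \<infinity>\<close> gives
  \<open>F[U,V]\<close>; \<open>mons_V\<close> gives \<open>F[V] = R_i/(U)\<close> and \<open>mons_U\<close> gives \<open>F[U] = R_i/(V)\<close>.
\<close>

definition mons :: "enat \<Rightarrow> (nat \<times> nat) set" where
  "mons i = {(a, b). enat (min a b) < i}"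

definition mons_V :: "(nat \<times> nat) set" where
  "mons_V = {(a, b). a = 0}"

definition mons_U :: "(nat \<times> nat) set" where
  "mons_U = {(a, b). b = 0}"

definition qring :: "(nat \<times> nat) set \<Rightarrow> FUV set" where
  "qring S = {p. Poly_Mapping.keys p \<subseteq> S}"

definition normal_form :: "(nat \<times> nat) set \<Rightarrow> FUV \<Rightarrow> FUV" where
  "normal_form S p = Poly_Mapping.mapp (\<lambda>m c. if m \<in> S then c else 0) p"


text \<open>
  A finitely generated free graded module with distinguished homogeneous basis and an
  endomorphism: \<open>del C x y\<close> is the coefficient of \<open>y\<close> in \<open>\<partial> x\<close>.  The values of \<open>gr\<close> and \<open>del\<close>
  outside \<open>basis\<close> are irrelevant.  The ground ring is not part of the record: since ring elements
  are polynomials in normal form, the lift of a based module from \<open>R_i\<close> to \<open>R_j\<close>, \<open>i \<le> j\<close>, is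
  the same record read over \<open>R_j\<close>, and \<open>C/U\<close> and \<open>C/V\<close> are \<open>C\<close> read over \<open>mons_V\<close> and
  \<open>mons_U\<close>.
\<close>

record 'b based =
  basis :: "'b set"
  gr :: "'b \<Rightarrow> int \<times> int"
  del :: "'b \<Rightarrow> 'b \<Rightarrow> FUV"

type_synonym 'b elt = "'b \<Rightarrow> FUV"

definition elts :: "(nat \<times> nat) set \<Rightarrow> 'b based \<Rightarrow> 'b elt set" where
  "elts S C = {w. (\<forall>x\<in>basis C. w x \<in> qring S) \<and> (\<forall>x. x \<notin> basis C \<longrightarrow> w x = 0)}"

definition reduce_elt :: "(nat \<times> nat) set \<Rightarrow> 'b elt \<Rightarrow> 'b elt" where
  "reduce_elt S w = (\<lambda>x. normal_form S (w x))"

definition smult :: "(nat \<times> nat) set \<Rightarrow> FUV \<Rightarrow> 'b elt \<Rightarrow> 'b elt" where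
  "smult S p w = (\<lambda>x. normal_form S (p * w x))"

definition gen :: "'b \<Rightarrow> 'b elt" where
  "gen x = (\<lambda>y. if y = x then 1 else 0)"

definition bd :: "(nat \<times> nat) set \<Rightarrow> 'b based \<Rightarrow> 'b elt \<Rightarrow> 'b elt" where
  "bd S C w =
     (\<lambda>y. if y \<in> basis C then normal_form S (\<Sum>x\<in>basis C. w x * del C x y) else 0)"

definition homogeneous :: "'b based \<Rightarrow> int \<times> int \<Rightarrow> 'b elt \<Rightarrow> bool" where
  "homogeneous C g w \<longleftrightarrow>
     (\<forall>x\<in>basis C. \<forall>m\<in>Poly_Mapping.keys (w x). gr C x + wt m = g)"

definition based_module :: "enat \<Rightarrow> 'b based \<Rightarrow> bool" where
  "based_module i C \<longleftrightarrow>
     finite (basis C) \<and>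
     (\<forall>x\<in>basis C. \<forall>y\<in>basis C. del C x y \<in> qring (mons i)) \<and>
     (\<forall>x\<in>basis C. homogeneous C (gr C x - (1, 1)) (del C x))"

definition chain_complex :: "enat \<Rightarrow> 'b based \<Rightarrow> bool" where
  "chain_complex i C \<longleftrightarrow>
     based_module i C \<and> (\<forall>w\<in>elts (mons i) C. bd (mons i) C (bd (mons i) C w) = 0)"

definition conj_complex :: "'b based \<Rightarrow> 'b based" where
  "conj_complex C =
     \<lparr>basis = basis C, gr = (\<lambda>x. prod.swap (gr C x)), del = (\<lambda>x y. swap_UV (del C x y))\<rparr>"


definition linear_map ::
    "(nat \<times> nat) set \<Rightarrow> 'b based \<Rightarrow> 'c based \<Rightarrow> ('b elt \<Rightarrow> 'c elt) \<Rightarrow> bool" where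
  "linear_map S C D f \<longleftrightarrow>
     f ` elts S C \<subseteq> elts S D \<and>
     (\<forall>v\<in>elts S C. \<forall>w\<in>elts S C. f (v + w) = f v + f w) \<and>
     (\<forall>p\<in>qring S. \<forall>w\<in>elts S C. f (smult S p w) = smult S p (f w))"

definition has_degree ::
    "(nat \<times> nat) set \<Rightarrow> 'b based \<Rightarrow> 'c based \<Rightarrow> int \<times> int \<Rightarrow> ('b elt \<Rightarrow> 'c elt) \<Rightarrow> bool" where
  "has_degree S C D k f \<longleftrightarrow>
     (\<forall>g. \<forall>w\<in>elts S C. homogeneous C g w \<longrightarrow> homogeneous D (g + k) (f w))"

definition chain_map ::
    "(nat \<times> nat) set \<Rightarrow> 'b based \<Rightarrow> 'c based \<Rightarrow> ('b elt \<Rightarrow> 'c elt) \<Rightarrow> bool" where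
  "chain_map S C D f \<longleftrightarrow>
     linear_map S C D f \<and> has_degree S C D (0, 0) f \<and>
     (\<forall>w\<in>elts S C. f (bd S C w) = bd S D (f w))"

definition isomorphic :: "enat \<Rightarrow> 'b based \<Rightarrow> 'c based \<Rightarrow> bool" where
  "isomorphic i C D \<longleftrightarrow>
     (\<exists>f. chain_map (mons i) C D f \<and> bij_betw f (elts (mons i) C) (elts (mons i) D))"

text \<open>A homotopy from \<open>f\<close> to the identity has degree \<open>(1, 1)\<close>, as \<open>\<partial>\<close> has degree \<open>(-1, -1)\<close>.\<close>

definition homotopic_to_id :: "(nat \<times> nat) set \<Rightarrow> 'b based \<Rightarrow> ('b elt \<Rightarrow> 'b elt) \<Rightarrow> bool" where
  "homotopic_to_id S C f \<longleftrightarrow>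
     (\<exists>h. linear_map S C C h \<and> has_degree S C C (1, 1) h \<and>
          (\<forall>w\<in>elts S C. f w - w = bd S C (h w) + h (bd S C w)))"

definition homotopy_equivalent :: "enat \<Rightarrow> 'b based \<Rightarrow> 'c based \<Rightarrow> bool" where
  "homotopy_equivalent i C D \<longleftrightarrow>
     (\<exists>f g. chain_map (mons i) C D f \<and> chain_map (mons i) D C g \<and>
            homotopic_to_id (mons i) C (g \<circ> f) \<and> homotopic_to_id (mons i) D (f \<circ> g))"

definition symmetric_complex :: "enat \<Rightarrow> 'b based \<Rightarrow> bool" where
  "symmetric_complex i C \<longleftrightarrow> homotopy_equivalent i C (conj_complex C)"


definition cycles :: "(nat \<times> nat) set \<Rightarrow> 'b based \<Rightarrow> 'b elt set" where
  "cycles S C = {w \<in> elts S C. bd S C w = 0}"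

definition boundaries :: "(nat \<times> nat) set \<Rightarrow> 'b based \<Rightarrow> 'b elt set" where
  "boundaries S C = bd S C ` elts S C"

text \<open>
  Homology modulo torsion, where \<open>X\<close> is the monomial \<open>V\<close> or \<open>U\<close>: two cycles define the same class
  in \<open>H/(X-torsion)\<close> iff some power of \<open>X\<close> takes their difference to a boundary.
\<close>

definition tors_rel :: "(nat \<times> nat) set \<Rightarrow> FUV \<Rightarrow> 'b based \<Rightarrow> ('b elt \<times> 'b elt) set" where
  "tors_rel S X C =
     {(v, w). v \<in> cycles S C \<and> w \<in> cycles S C \<and>
              (\<exists>k. smult S (X ^ k) (v - w) \<in> boundaries S C)}"

definition hom_mod_tors :: "(nat \<times> nat) set \<Rightarrow> FUV \<Rightarrow> 'b based \<Rightarrow> 'b elt set set" where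
  "hom_mod_tors S X C = cycles S C // tors_rel S X C"

abbreviation U_var :: FUV where "U_var \<equiv> UV_mono (1, 0)"
abbreviation V_var :: FUV where "V_var \<equiv> UV_mono (0, 1)"

text \<open>
  \<open>H/(X-torsion)\<close> is free of rank one over \<open>qring S\<close>, and the class of \<open>z\<close> generates it: the
  module map sending \<open>p\<close> to \<open>p\<close> times the class of \<open>z\<close> is an isomorphism.
\<close>

definition free_generator :: "(nat \<times> nat) set \<Rightarrow> FUV \<Rightarrow> 'b based \<Rightarrow> 'b elt \<Rightarrow> bool" where
  "free_generator S X C z \<longleftrightarrow>
     z \<in> cycles S C \<and>
     bij_betw (\<lambda>p. tors_rel S X C `` {smult S p z}) (qring S) (hom_mod_tors S X C)"

definition correct_homology :: "'b based \<Rightarrow> bool" where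
  "correct_homology C \<longleftrightarrow>
     (\<exists>z g. homogeneous C (0, g) z \<and> free_generator mons_V V_var C z) \<and>
     (\<exists>z g. homogeneous C (g, 0) z \<and> free_generator mons_U U_var C z)"

definition knot_like :: "'b based \<Rightarrow> bool" where
  "knot_like C \<longleftrightarrow> chain_complex 1 C \<and> correct_homology C"


text \<open>
  For a chain map \<open>f\<close> over \<open>R_1\<close>, the induced map \<open>C/U \<rightarrow> D/U\<close> (or \<open>C/V \<rightarrow> D/V\<close>) is
  \<open>reduce_elt S \<circ> f\<close>; it takes a class to the class of the image of any of its members.
\<close>

definition induced_map ::
    "(nat \<times> nat) set \<Rightarrow> FUV \<Rightarrow> 'c based \<Rightarrow> ('b elt \<Rightarrow> 'c elt) \<Rightarrow> 'b elt set \<Rightarrow> 'c elt set" where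
  "induced_map S X D f K = tors_rel S X D `` ((reduce_elt S \<circ> f) ` K)"

definition local_map :: "'b based \<Rightarrow> 'c based \<Rightarrow> ('b elt \<Rightarrow> 'c elt) \<Rightarrow> bool" where
  "local_map C D f \<longleftrightarrow>
     chain_map (mons 1) C D f \<and>
     bij_betw (induced_map mons_V V_var D f)
       (hom_mod_tors mons_V V_var C) (hom_mod_tors mons_V V_var D) \<and>
     bij_betw (induced_map mons_U U_var D f)
       (hom_mod_tors mons_U U_var C) (hom_mod_tors mons_U U_var D)"

definition locally_equivalent :: "'b based \<Rightarrow> 'c based \<Rightarrow> bool" where
  "locally_equivalent C D \<longleftrightarrow> (\<exists>f. local_map C D f) \<and> (\<exists>f. local_map D C f)"

text \<open>Representatives have finite bases, so it is no restriction to index bases by naturals.\<close>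

definition local_class :: "nat based \<Rightarrow> nat based set" where
  "local_class C = {D. knot_like D \<and> locally_equivalent C D}"


text \<open>\<open>C\<close> is the mod \<open>UV\<close> reduction of \<open>D\<close>, with the same distinguished basis.\<close>

definition is_reduction :: "'b based \<Rightarrow> 'b based \<Rightarrow> bool" where
  "is_reduction D C \<longleftrightarrow>
     basis D = basis C \<and> (\<forall>x\<in>basis C. gr D x = gr C x) \<and>
     (\<forall>x\<in>basis C. \<forall>y\<in>basis C. del C x y = normal_form (mons 1) (del D x y))"

definition partial_realization :: "'b based \<Rightarrow> 'b based \<Rightarrow> bool" where
  "partial_realization D C \<longleftrightarrow> chain_complex 2 D \<and> is_reduction D C"

definition full_realization :: "'b based \<Rightarrow> 'b based \<Rightarrow> bool" where
  "full_realization D C \<longleftrightarrow> chain_complex \<infinity> D \<and> is_reduction D C"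

definition partially_realizable :: "'b based \<Rightarrow> bool" where
  "partially_realizable C \<longleftrightarrow> (\<exists>D. partial_realization D C)"

text \<open>The isomorphic copy \<open>C'\<close> amounts to the choice of another distinguished basis of \<open>C\<close>.\<close>

definition alg_realizable :: "'b based \<Rightarrow> bool" where
  "alg_realizable C \<longleftrightarrow>
     (\<exists>C' :: 'b based. isomorphic 1 C C' \<and> (\<exists>D. full_realization D C' \<and> correct_homology D))"

definition alg_realizable_sym :: "'b based \<Rightarrow> bool" where
  "alg_realizable_sym C \<longleftrightarrow>
     (\<exists>C' :: 'b based. isomorphic 1 C C' \<and>
        (\<exists>D. full_realization D C' \<and> symmetric_complex \<infinity> D \<and> correct_homology D))"

definition class_realizable :: "nat based set \<Rightarrow> bool" where
  "class_realizable K \<longleftrightarrow> (\<exists>C\<in>K. alg_realizable C)"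

definition class_realizable_sym :: "nat based set \<Rightarrow> bool" where
  "class_realizable_sym K \<longleftrightarrow> (\<exists>C\<in>K. symmetric_complex 1 C \<and> alg_realizable_sym C)"


definition std_coeff :: "(nat \<Rightarrow> int) \<Rightarrow> nat \<Rightarrow> FUV" where
  "std_coeff a i =
     (if odd i then UV_mono (nat \<bar>a i\<bar>, 0) else UV_mono (0, nat \<bar>a i\<bar>))"

definition std_del :: "(nat \<Rightarrow> int) \<Rightarrow> nat \<Rightarrow> nat \<Rightarrow> FUV" where
  "std_del a x y =
     (if x = Suc y \<and> a x > 0 then std_coeff a x
      else if y = Suc x \<and> a y < 0 then std_coeff a y
      else 0)"

text \<open>
  The grading of the standard complex is the unique one making it knot-like; the value outside
  the basis is fixed only to make the function unique.
\<close>

definition std_gr :: "nat \<Rightarrow> (nat \<Rightarrow> int) \<Rightarrow> nat \<Rightarrow> int \<times> int" where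
  "std_gr n a =
     (THE g. (\<forall>x. x \<notin> {0..2 * n} \<longrightarrow> g x = (0, 0)) \<and>
             knot_like \<lparr>basis = {0..2 * n}, gr = g, del = std_del a\<rparr>)"

definition standard_complex :: "nat \<Rightarrow> (nat \<Rightarrow> int) \<Rightarrow> nat based" where
  "standard_complex n a = \<lparr>basis = {0..2 * n}, gr = std_gr n a, del = std_del a\<rparr>"


text \<open>The Procedure; its current object is a based module over \<open>R_2\<close>.\<close>

definition arrow :: "'b based \<Rightarrow> 'b \<Rightarrow> 'b \<Rightarrow> nat \<Rightarrow> nat \<Rightarrow> bool" where
  "arrow C x y a b \<longleftrightarrow>
     x \<in> basis C \<and> y \<in> basis C \<and> Poly_Mapping.lookup (del C x y) (a, b) = 1"

definition sq_coeff :: "'b based \<Rightarrow> 'b \<Rightarrow> 'b \<Rightarrow> nat \<Rightarrow> nat \<Rightarrow> bit" where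
  "sq_coeff C x y a b =
     Poly_Mapping.lookup (bd (mons 2) C (bd (mons 2) C (gen x)) y) (a, b)"

definition defect :: "'b based \<Rightarrow> 'b \<Rightarrow> 'b \<Rightarrow> nat \<Rightarrow> nat \<Rightarrow> bool" where
  "defect C x y a b \<longleftrightarrow>
     x \<in> basis C \<and> y \<in> basis C \<and> a \<ge> 1 \<and> b \<ge> 1 \<and> 1 \<in> {a, b} \<and> sq_coeff C x y a b = 1"

definition add_arrow :: "'b based \<Rightarrow> 'b \<Rightarrow> 'b \<Rightarrow> nat \<Rightarrow> nat \<Rightarrow> 'b based" where
  "add_arrow C x y a b =
     C\<lparr>del := (del C)(x := (del C x)(y := del C x y + UV_mono (a, b)))\<rparr>"

text \<open>
  Case \<open>b = 1\<close>: the horizontal arrow of length \<open>l\<close> comes first (\<open>_a\<close>) or second (\<open>_b\<close>) in the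
  composition from \<open>x\<close> to \<open>y\<close> through \<open>u\<close>; the other arrow, with coefficient \<open>U^c V\<close>, is vertical
  or diagonal.  Only diagonal arrows are ever added, so the horizontal arrows stay those of the
  standard complex: each basis element is adjacent to at most one of them, and "the adjacent
  horizontal arrow exists, points into \<open>y\<close> and has length \<open>d < a\<close>" says that there is an arrow
  from some \<open>z\<close> to \<open>y\<close> with coefficient \<open>U^d\<close>, \<open>d < a\<close>.
\<close>

inductive add_b1 :: "'b based \<Rightarrow> 'b based \<Rightarrow> bool" where
  add_b1_a: "\<lbrakk>defect C x y a 1; arrow C x u l 0; arrow C u y c 1; l + c = a;
    arrow C z y d 0; d < a\<rbrakk> \<Longrightarrow> add_b1 C (add_arrow C x z (a - d) 1)"
| add_b1_b: "\<lbrakk>defect C x y a 1; arrow C x u c 1; arrow C u y l 0; l + c = a;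
    arrow C x z d 0; d < a\<rbrakk> \<Longrightarrow> add_b1 C (add_arrow C z y (a - d) 1)"

inductive fail_b1 :: "'b based \<Rightarrow> bool" where
  fail_b1_a: "\<lbrakk>defect C x y a 1; arrow C x u l 0; arrow C u y c 1; l + c = a;
    \<not> (\<exists>z d. arrow C z y d 0 \<and> d < a)\<rbrakk> \<Longrightarrow> fail_b1 C"
| fail_b1_b: "\<lbrakk>defect C x y a 1; arrow C x u c 1; arrow C u y l 0; l + c = a;
    \<not> (\<exists>z d. arrow C x z d 0 \<and> d < a)\<rbrakk> \<Longrightarrow> fail_b1 C"

datatype 'b proc_state = Running "'b based" | Success "'b based" | Failure

text \<open>
  Case \<open>a = 1\<close> is case \<open>b = 1\<close> for the conjugate, which exchanges \<open>U\<close> and \<open>V\<close>.  All choices of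
  the defect to be treated are allowed, so the relation is nondeterministic.
\<close>

inductive proc_step :: "'b proc_state \<Rightarrow> 'b proc_state \<Rightarrow> bool" where
  add_horizontal: "add_b1 C C' \<Longrightarrow> proc_step (Running C) (Running C')"
| add_vertical:
    "add_b1 (conj_complex C) (conj_complex C') \<Longrightarrow> proc_step (Running C) (Running C')"
| fail_horizontal: "fail_b1 C \<Longrightarrow> proc_step (Running C) Failure"
| fail_vertical: "fail_b1 (conj_complex C) \<Longrightarrow> proc_step (Running C) Failure"
| succeed: "\<not> (\<exists>x y a b. defect C x y a b) \<Longrightarrow> proc_step (Running C) (Success C)"

definition proc_adds :: "'b based \<Rightarrow> 'b based \<Rightarrow> bool" where
  "proc_adds C C' \<longleftrightarrow> proc_step (Running C) (Running C')"

definition proc_ends :: "'b based \<Rightarrow> 'b proc_state \<Rightarrow> bool" where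
  "proc_ends C s \<longleftrightarrow> proc_step\<^sup>*\<^sup>* (Running C) s \<and> \<not> (\<exists>s'. proc_step s s')"

end

theory Submission
  imports Defs
begin

text \<open>
  The gradings leave room for at most one monomial in each matrix entry, so a graded matrix is a
  matrix over the two-element field whose nonzero entries are constrained by the gradings.  Modulo
  \<open>U\<close> or \<open>V\<close> the differential of a standard complex is a matching of the basis elements, with one
  element left over (\<open>pairing\<close>).  These two observations carry all parts of the proof.

  The Procedure.  As the horizontal arrows form a matching, at most two compositions contribute to
  a coefficient of \<open>\<partial>\<^sup>2\<close> at \<open>U^aV\<close> (\<open>sq_coeff_V1\<close>), so \<open>\<partial>\<^sup>2 = 0\<close> over \<open>R_2\<close> is a system of equations
  between at most two unknown entries each.  If one of the two compositions is present, every
  realization with at least the present arrows must contain the other one (\<open>forced_a\<close>,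
  \<open>forced_b\<close>).  Hence the Procedure only adds arrows that all partial realizations share, and it
  can fail only if there is none.  It never adds an arrow twice, and parity and the gradings
  leave at most \<open>n(n+1)\<close> places for arrows (\<open>card_arrows\<close>).

  Realizable implies partially realizable.  Let \<open>C\<close> be the standard complex and let \<open>f\<close> and \<open>g\<close> be
  local maps from \<open>C\<close> to a representative and back.  Comparing how basis elements sit in the two
  matchings (\<open>letter_step\<close>) shows that \<open>g \<circ> f\<close> is the identity up to a nilpotent map
  (\<open>std_self_map_invertible\<close>), so \<open>C\<close> is a retract of the representative, by matrices \<open>F\<close> and \<open>G\<close>.  If
  \<open>\<partial>\<close> is the differential of a full realization, then \<open>F \<partial> G\<close> squares to zero modulo \<open>U\<^sup>2V\<^sup>2\<close>
  (\<open>retract_square_zero\<close>).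

  Partially realizable implies realizable.  Lift the differential of a partial realization to
  \<open>F[U,V]\<close>; then \<open>\<partial>\<^sup>2 = U\<^sup>2V\<^sup>2 \<omega>\<close>, and on two copies of \<open>C\<close> the matrix with blocks \<open>\<partial>\<close>, \<open>UV\<close>, \<open>UV \<omega>\<close>,
  \<open>\<partial>\<close> squares to zero.  It is a free resolution over \<open>F[U,V]\<close> of the standard complex over \<open>R_1\<close>,
  and modulo \<open>UV\<close> it falls apart into the two copies.  To remove the free part of the homology of
  the second copy, take the cone of a map to it from a complex \<open>T\<close> with three generators and
  \<open>\<partial> t_1 = U^N t_0 + V^N t_2\<close>, which sends \<open>t_0\<close> and \<open>t_2\<close> to high multiples of the unmatched elements at the ends
  of \<open>C\<close>.  Over \<open>R_1\<close> there is such a chain map; that it lifts to a chain map \<open>\<Phi>\<close> over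
  \<open>R_2\<close>, which is what makes the cone split modulo \<open>UV\<close>, is \<open>tower_row_boundary\<close>.
  The resulting complex is \<open>cone_complex\<close>; modulo \<open>UV\<close> it is the sum of \<open>C\<close> and a complex with torsion
  homology.

  Symmetry.  If the standard complex is symmetric, it is its own mirror image
  (\<open>symmetric_sequence\<close>), and so the mirror image of the cone is a cone for another lift of the
  same standard complex.  Up to isomorphism the cone does not depend on the lift
  (\<open>cone_shear\<close>), hence it is symmetric.
\<close>

section \<open>Polynomials over the two-element field and truncation\<close>

abbreviation lk :: "FUV \<Rightarrow> nat \<times> nat \<Rightarrow> bit" where
  "lk \<equiv> Poly_Mapping.lookup"

lemma bit_add_self [simp]: "(c::bit) + c = 0"
  by (cases c) simp_all

lemma FUV_add_self [simp]: "(p::FUV) + p = 0"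
  by (rule poly_mapping_eqI) (simp only: lookup_add lookup_zero bit_add_self)

lemma FUV_minus [simp]: "(p::FUV) - q = p + q"
  by (rule poly_mapping_eqI) (simp add: lookup_add lookup_minus)

lemma lookup_nf [simp]: "lk (normal_form S p) m = (if m \<in> S then lk p m else 0)"
  by (auto simp: normal_form_def lookup_mapp when_def in_keys_iff)

lemma nf_0 [simp]: "normal_form S 0 = 0"
  by (rule poly_mapping_eqI) simp

lemma nf_add: "normal_form S (p + q) = normal_form S p + normal_form S q"
  by (rule poly_mapping_eqI) (simp add: lookup_add)

lemma nf_sum: "normal_form S (sum f A) = (\<Sum>x\<in>A. normal_form S (f x))"
  by (rule poly_mapping_eqI) (simp add: lookup_sum)

lemma nf_nf: "normal_form S (normal_form T p) = normal_form (S \<inter> T) p"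
  by (rule poly_mapping_eqI) simp

lemma nf_idem [simp]: "normal_form S (normal_form S p) = normal_form S p"
  by (rule poly_mapping_eqI) simp

lemma nf_subset: "S \<subseteq> T \<Longrightarrow> normal_form S (normal_form T p) = normal_form S p"
  by (simp add: nf_nf Int_absorb2)

lemma qring_iff: "p \<in> qring S \<longleftrightarrow> normal_form S p = p"
proof
  assume "p \<in> qring S"
  then have "lk p m = 0" if "m \<notin> S" for m
    using that by (auto simp: qring_def in_keys_iff simp del: bit_not_zero_iff)
  then show "normal_form S p = p" by (intro poly_mapping_eqI) simp
next
  assume "normal_form S p = p"
  then have "lk p m = 0" if "m \<notin> S" for m
    using that by (metis lookup_nf)
  then show "p \<in> qring S" by (auto simp: qring_def in_keys_iff)
qed

lemma nf_qring [simp]: "normal_form S p \<in> qring S"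
  by (simp add: qring_iff)

lemma qring_add: "p \<in> qring S \<Longrightarrow> q \<in> qring S \<Longrightarrow> p + q \<in> qring S"
  by (simp add: qring_iff nf_add)

lemma qring_0 [simp]: "0 \<in> qring S"
  by (simp add: qring_iff)

lemma qring_mono: "S \<subseteq> T \<Longrightarrow> p \<in> qring S \<Longrightarrow> p \<in> qring T"
  by (auto simp: qring_def)

lemma lookup_mono: "lk (UV_mono m) k = (if k = m then 1 else 0)"
  by (auto simp: UV_mono_def lookup_single when_def)

lemma UV_mono_mult: "UV_mono m * UV_mono k = UV_mono (m + k)"
  by (simp add: UV_mono_def mult_single)

lemma UV_mono_0: "UV_mono 0 = 1"
  by (simp add: UV_mono_def)

lemma nf_mono: "normal_form S (UV_mono m) = (if m \<in> S then UV_mono m else 0)"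
  by (rule poly_mapping_eqI) (auto simp: lookup_mono)

lemma UV_mono_neq_0 [simp]: "UV_mono m \<noteq> 0"
proof
  assume "UV_mono m = 0"
  then have "lk (UV_mono m) m = 0" by simp
  then show False by (simp add: lookup_mono)
qed

lemma keys_UV_mono [simp]: "Poly_Mapping.keys (UV_mono m) = {m}"
  by (auto simp: in_keys_iff lookup_mono split: if_splits)

lemma lookup_mono_mult: "lk (UV_mono m * p) (m + k) = lk p k"
proof -
  have "(\<Sum>q. (lk p q when m + k = m + q)) = (\<Sum>q. (lk p q when q = k))"
    by (rule arg_cong[where f=Sum_any], rule ext) (auto simp: when_def)
  then have *: "(\<Sum>q. (lk p q when m + k = m + q)) = lk p k"
    by simp
  have "lk (UV_mono m * p) (m + k)
      = (\<Sum>l. lk (UV_mono m) l * (\<Sum>q. (lk p q when m + k = l + q)))"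
    by (simp add: times_poly_mapping.rep_eq prod_fun_def)
  also have "\<dots> = (\<Sum>l. ((\<Sum>q. (lk p q when m + k = l + q)) when l = m))"
    by (rule arg_cong[where f=Sum_any], rule ext) (auto simp: lookup_mono when_def)
  also have "\<dots> = lk p k" by (simp add: *)
  finally show ?thesis .
qed

lemma UV_mono_cancel: "UV_mono m * p = UV_mono m * q \<longleftrightarrow> p = q"
  by (metis lookup_mono_mult poly_mapping_eqI)

lemma keys_mono_mult: "k \<in> Poly_Mapping.keys (UV_mono m * p) \<Longrightarrow> \<exists>j. k = m + j \<and> j \<in> Poly_Mapping.keys p"
  using keys_mult[of "UV_mono m" p] by auto

text \<open>
  Truncation is multiplicative as soon as the discarded monomials span an ideal.
\<close>

definition order_ideal :: "(nat \<times> nat) set \<Rightarrow> bool" where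
  "order_ideal S \<longleftrightarrow> 0 \<in> S \<and> (\<forall>m k. m + k \<in> S \<longrightarrow> m \<in> S)"

lemma nf_mult_zero:
  assumes "order_ideal S" "normal_form S p = 0"
  shows "normal_form S (p * q) = 0"
proof (rule poly_mapping_eqI, simp, intro impI)
  fix m assume "m \<in> S"
  have "m \<notin> Poly_Mapping.keys (p * q)"
  proof
    assume "m \<in> Poly_Mapping.keys (p * q)"
    then obtain a b where ab: "m = a + b" "a \<in> Poly_Mapping.keys p"
      using keys_mult[of p q] by auto
    then have "a \<in> S" using assms(1) \<open>m \<in> S\<close> unfolding order_ideal_def by blast
    then have "lk p a = 0" using assms(2) by (metis lookup_nf lookup_zero)
    then show False using ab by (simp add: in_keys_iff)
  qed
  then show "lk (p * q) m = 0" by (simp add: in_keys_iff)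
qed

lemma nf_mult_left:
  assumes "order_ideal S"
  shows "normal_form S (normal_form S p * q) = normal_form S (p * q)"
proof -
  have "normal_form S ((p + normal_form S p) * q) = 0"
    by (rule nf_mult_zero[OF assms]) (simp add: nf_add)
  then have "normal_form S (p * q) + normal_form S (normal_form S p * q) = 0"
    by (simp add: distrib_right nf_add)
  then show ?thesis by (metis FUV_add_self add_left_imp_eq add.commute)
qed

lemma nf_mult_right:
  "order_ideal S \<Longrightarrow> normal_form S (p * normal_form S q) = normal_form S (p * q)"
  using nf_mult_left[of S q p] by (simp add: mult.commute)

lemma order_ideal_mons:
  assumes "1 \<le> i"
  shows "order_ideal (mons i)"
  unfolding order_ideal_def
proof (intro conjI allI impI)
  have "(0::enat) < i" using assms by (rule less_le_trans[rotated]) simp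
  then show "0 \<in> mons i"
    by (simp add: mons_def zero_prod_def zero_enat_def)
  fix m k :: "nat \<times> nat" assume "m + k \<in> mons i"
  moreover have "enat (min (fst m) (snd m)) \<le> enat (min (fst (m + k)) (snd (m + k)))"
    by (auto simp: min_def)
  ultimately show "m \<in> mons i"
    unfolding mons_def case_prod_beta mem_Collect_eq by (rule le_less_trans[rotated])
qed

lemma order_ideal_1 [simp]: "order_ideal (mons 1)"
  and order_ideal_2 [simp]: "order_ideal (mons 2)"
  by (auto intro!: order_ideal_mons)

lemma in_mons_1 [simp]: "(c, d) \<in> mons 1 \<longleftrightarrow> c = 0 \<or> d = 0"
  by (auto simp: mons_def one_enat_def)

lemma in_mons_2 [simp]: "(c, d) \<in> mons 2 \<longleftrightarrow> c \<le> 1 \<or> d \<le> 1"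
  by (auto simp: mons_def numeral_eq_enat)

lemma mons_inf [simp]: "mons \<infinity> = UNIV"
  by (auto simp: mons_def)

lemma nf_UNIV [simp]: "normal_form UNIV p = p"
  by (rule poly_mapping_eqI) simp

lemma qring_UNIV [simp]: "qring UNIV = UNIV"
  by (auto simp: qring_def)

lemma mons_1_2: "mons 1 \<subseteq> mons 2" by auto

text \<open>
  Errors modulo \<open>UV\<close> become harmless modulo \<open>U\<^sup>2V\<^sup>2\<close> when they occur twice in a product.
\<close>

lemma UV_mult_nf_2:
  assumes "normal_form (mons 1) p = 0" "normal_form (mons 1) q = 0"
  shows "normal_form (mons 2) (p * q) = 0"
proof (rule poly_mapping_eqI, simp, intro impI)
  fix m assume m: "m \<in> mons 2"
  have *: "lk r (c, d) \<noteq> 0 \<Longrightarrow> normal_form (mons 1) r = 0 \<Longrightarrow> 1 \<le> c \<and> 1 \<le> d" for r c d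
    by (metis in_mons_1 lookup_nf lookup_zero less_one not_less)
  have "m \<notin> Poly_Mapping.keys (p * q)"
  proof
    assume "m \<in> Poly_Mapping.keys (p * q)"
    then obtain a b where ab: "m = a + b" "a \<in> Poly_Mapping.keys p" "b \<in> Poly_Mapping.keys q"
      using keys_mult[of p q] by auto
    then show False using m *[of p "fst a" "snd a"] *[of q "fst b" "snd b"] assms
      by (cases a; cases b) (auto simp: in_keys_iff)
  qed
  then show "lk (p * q) m = 0" by (simp add: in_keys_iff)
qed


section \<open>Homogeneous polynomials\<close>

text \<open>
  In a fixed bidegree \<open>F[U,V]\<close> has at most one monomial.  Hence a homogeneous matrix is the same
  thing as a matrix over the two-element field that vanishes wherever the bidegree excludes a
  monomial, and products of homogeneous matrices can be computed on these bits; \<open>mk d c\<close> is the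
  polynomial of weight \<open>d\<close> with coefficient \<open>c\<close>, and 0 if no monomial has weight \<open>d\<close>.
\<close>

definition valid :: "int \<times> int \<Rightarrow> bool" where
  "valid d \<longleftrightarrow> even (fst d) \<and> even (snd d) \<and> fst d \<le> 0 \<and> snd d \<le> 0"

definition expo :: "int \<times> int \<Rightarrow> nat \<times> nat" where
  "expo d = (nat (- fst d div 2), nat (- snd d div 2))"

definition mk :: "int \<times> int \<Rightarrow> bit \<Rightarrow> FUV" where
  "mk d c = (if valid d then Poly_Mapping.single (expo d) c else 0)"

lemma wt_add: "wt (m + k) = wt m + wt k"
  by (cases m; cases k) auto

lemma wt_0 [simp]: "wt 0 = 0"
  by (auto simp: zero_prod_def)

lemma wt_fst_snd: "fst (wt m) = - 2 * int (fst m)" "snd (wt m) = - 2 * int (snd m)"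
  by (cases m; simp)+

lemma wt_inj: "wt m = wt k \<longleftrightarrow> m = k"
  by (cases m; cases k) auto

lemma expo_wt [simp]: "expo (wt m) = m"
  by (cases m) (auto simp: expo_def)

lemma valid_wt [simp]: "valid (wt m)"
  by (cases m) (auto simp: valid_def)

lemma wt_expo: "valid d \<Longrightarrow> wt (expo d) = d"
  by (cases d) (auto simp: valid_def expo_def)

lemma valid_iff: "valid d \<longleftrightarrow> (\<exists>m. d = wt m)"
  by (metis valid_wt wt_expo)

lemma valid_add: "valid d \<Longrightarrow> valid e \<Longrightarrow> valid (d + e)"
  by (auto simp: valid_def)

lemma expo_add: "valid d \<Longrightarrow> valid e \<Longrightarrow> expo (d + e) = expo d + expo e"
  by (metis expo_wt wt_add wt_expo)

lemma valid_0 [simp]: "valid 0" by (simp add: valid_def)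
lemma expo_0 [simp]: "expo 0 = 0" by (simp add: expo_def zero_prod_def)

lemma mk_0 [simp]: "mk d 0 = 0" by (simp add: mk_def)

lemma mk_0_1 [simp]: "mk 0 1 = 1"
  by (simp add: mk_def)

lemma mk_add: "mk d (c + c') = mk d c + mk d c'"
  unfolding mk_def by (simp only: single_add split: if_split) simp

lemma mk_sum: "mk d (sum f A) = (\<Sum>x\<in>A. mk d (f x))"
  by (induction A rule: infinite_finite_induct) (auto simp: mk_add)

lemma mk_mult:
  "(c \<noteq> 0 \<Longrightarrow> valid d) \<Longrightarrow> (c' \<noteq> 0 \<Longrightarrow> valid e) \<Longrightarrow> mk d c * mk e c' = mk (d + e) (c * c')"
  by (cases c; cases c') (auto simp: mk_def mult_single expo_add valid_add)

lemma lookup_mk: "lk (mk d c) m = (if wt m = d then c else 0)"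
  by (cases "valid d") (auto simp: mk_def lookup_single when_def wt_expo)

lemma nf_mk: "normal_form S (mk d c) = (if expo d \<in> S then mk d c else 0)"
  by (rule poly_mapping_eqI) (auto simp del: wt.simps simp: lookup_mk)

lemma mk_eq_0: "mk d c = 0 \<longleftrightarrow> c = 0 \<or> \<not> valid d"
  by (cases "valid d"; cases c) (simp_all add: mk_def flip: UV_mono_def)

lemma hom_mk:
  assumes "\<And>m. m \<in> Poly_Mapping.keys p \<Longrightarrow> wt m = d"
  shows "p = mk d (lk p (expo d))"
proof (rule poly_mapping_eqI)
  fix m
  show "lk p m = lk (mk d (lk p (expo d))) m"
    using assms[of m] by (cases "m \<in> Poly_Mapping.keys p") (auto simp: lookup_mk in_keys_iff)
qed

lemma keys_mk: "m \<in> Poly_Mapping.keys (mk d c) \<Longrightarrow> wt m = d"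
  by (auto simp: in_keys_iff lookup_mk split: if_splits)

declare wt.simps [simp del]

section \<open>Maps given by matrices\<close>

text \<open>
  Elements are row vectors, so that \<open>mm B F G\<close> is the matrix of first \<open>F\<close>, then \<open>G\<close>, and the rows of
  \<open>del C\<close> are the boundaries of the basis elements.  Sources and targets are explicit sets, as
  truncation to the ring and to the basis happens only when a matrix is applied.
\<close>

definition matmap ::
    "(nat \<times> nat) set \<Rightarrow> 'b set \<Rightarrow> 'c set \<Rightarrow> ('b \<Rightarrow> 'c \<Rightarrow> FUV) \<Rightarrow> 'b elt \<Rightarrow> 'c elt" where
  "matmap S B B' F w =
     (\<lambda>y. if y \<in> B' then normal_form S (\<Sum>x\<in>B. w x * F x y) else 0)"

definition mm :: "'c set \<Rightarrow> ('b \<Rightarrow> 'c \<Rightarrow> 'r) \<Rightarrow> ('c \<Rightarrow> 'd \<Rightarrow> 'r) \<Rightarrow> 'b \<Rightarrow> 'd \<Rightarrow> 'r::comm_ring_1" where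
  "mm B F G = (\<lambda>x z. \<Sum>y\<in>B. F x y * G y z)"

definition unit_matrix :: "'b \<Rightarrow> 'b \<Rightarrow> 'r::comm_ring_1" where
  "unit_matrix x y = (if x = y then 1 else 0)"

lemma bd_matmap: "bd S C = matmap S (basis C) (basis C) (del C)"
  by (simp add: fun_eq_iff bd_def matmap_def)

lemma mm_assoc:
  "finite B \<Longrightarrow> finite B' \<Longrightarrow> mm B' (mm B F G) H = mm B F (mm B' G H)"
  unfolding mm_def
  by (intro ext) (simp add: sum_distrib_left sum_distrib_right mult.assoc sum.swap[of _ B' B])

lemma mm_unit_left: "finite B \<Longrightarrow> x \<in> B \<Longrightarrow> mm B unit_matrix F x y = F x y"
  by (simp add: mm_def unit_matrix_def if_distrib[where f="\<lambda>c. c * _"] cong: if_cong)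

lemma mm_unit_right: "finite B \<Longrightarrow> y \<in> B \<Longrightarrow> mm B F unit_matrix x y = F x y"
  by (simp add: mm_def unit_matrix_def if_distrib cong: if_cong)

lemma mm_add_left: "mm B (F + F') G = mm B F G + mm B F' G"
  by (simp add: mm_def fun_eq_iff distrib_right sum.distrib)

lemma mm_add_right: "mm B F (G + G') = mm B F G + mm B F G'"
  by (simp add: mm_def fun_eq_iff distrib_left sum.distrib)

lemma mm_cong:
  "(\<And>y. y \<in> B \<Longrightarrow> F x y = F' x y) \<Longrightarrow> (\<And>y. y \<in> B \<Longrightarrow> G y z = G' y z) \<Longrightarrow> mm B F G x z = mm B F' G' x z"
  by (simp add: mm_def)

lemma nf_mm_cong:
  assumes "order_ideal S"
    and "\<And>y. y \<in> B \<Longrightarrow> normal_form S (F x y) = normal_form S (F' x y)"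
    and "\<And>y. y \<in> B \<Longrightarrow> normal_form S (G y z) = normal_form S (G' y z)"
  shows "normal_form S (mm B F G x z) = normal_form S (mm B F' G' x z)"
proof -
  have "normal_form S (F x y * G y z) = normal_form S (F' x y * G' y z)" if "y \<in> B" for y
    using assms(2)[OF that] assms(3)[OF that]
    by (metis nf_mult_left[OF assms(1)] nf_mult_right[OF assms(1)])
  then show ?thesis by (simp add: mm_def nf_sum)
qed

lemma eltsD: "w \<in> elts S C \<Longrightarrow> normal_form S (w x) = w x"
  by (cases "x \<in> basis C") (auto simp: elts_def qring_iff)

lemma elts_outside: "w \<in> elts S C \<Longrightarrow> x \<notin> basis C \<Longrightarrow> w x = 0"
  by (simp add: elts_def)

lemma elts_add: "v \<in> elts S C \<Longrightarrow> w \<in> elts S C \<Longrightarrow> v + w \<in> elts S C"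
  by (auto simp: elts_def qring_add)

lemma elts_0 [simp]: "0 \<in> elts S C"
  by (auto simp: elts_def)

lemma elt_minus [simp]: "(v::'b elt) - w = v + w"
  by (rule ext) simp

lemma elt_add_self [simp]: "(v::'b elt) + v = 0"
  by (rule ext) (simp only: plus_fun_apply zero_fun_apply FUV_add_self)

lemma smult_elts: "w \<in> elts S C \<Longrightarrow> smult S p w \<in> elts S C"
  by (auto simp: elts_def smult_def)

lemma gen_elts: "order_ideal S \<Longrightarrow> x \<in> basis C \<Longrightarrow> gen x \<in> elts S C"
  by (auto simp: elts_def gen_def qring_def order_ideal_def)

lemma smult_0 [simp]: "smult S 0 w = 0" "smult S p 0 = 0"
  by (auto simp: smult_def fun_eq_iff)

lemma smult_smult: "order_ideal S \<Longrightarrow> smult S p (smult S q w) = smult S (p * q) w"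
  by (simp add: smult_def fun_eq_iff nf_mult_right mult.assoc)

lemma smult_add: "smult S p (v + w) = smult S p v + smult S p w"
  by (simp add: smult_def fun_eq_iff distrib_left nf_add)

lemma smult_1: "w \<in> elts S C \<Longrightarrow> smult S 1 w = w"
  by (simp add: smult_def fun_eq_iff eltsD)

lemma matmap_elts [simp]: "matmap S B (basis D) F w \<in> elts S D"
  by (simp add: elts_def matmap_def)

lemma matmap_add: "matmap S B B' F (v + w) = matmap S B B' F v + matmap S B B' F w"
  by (simp add: matmap_def fun_eq_iff distrib_right sum.distrib nf_add)

lemma matmap_0 [simp]: "matmap S B B' F 0 = 0"
  by (simp add: matmap_def fun_eq_iff)

lemma matmap_smult:
  assumes "order_ideal S"
  shows "matmap S B B' F (smult S p w) = smult S p (matmap S B B' F w)"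
  by (auto simp: matmap_def smult_def fun_eq_iff nf_sum nf_mult_left[OF assms] nf_mult_right[OF assms]
      sum_distrib_left mult.assoc)

lemma matmap_comp:
  assumes "order_ideal S" "finite B" "finite B'"
  shows "matmap S B' B'' G (matmap S B B' F w) = matmap S B B'' (mm B' F G) w"
proof (rule ext)
  fix z
  have "(\<Sum>y\<in>B'. normal_form S ((if y \<in> B' then normal_form S (\<Sum>x\<in>B. w x * F x y) else 0) * G y z))
      = (\<Sum>y\<in>B'. normal_form S ((\<Sum>x\<in>B. w x * F x y) * G y z))"
    by (rule sum.cong) (simp_all add: nf_mult_left[OF assms(1)])
  also have "\<dots> = normal_form S (\<Sum>x\<in>B. w x * mm B' F G x z)"
    by (simp add: mm_def sum_distrib_left sum_distrib_right sum.swap[of _ B' B] mult.assoc flip: nf_sum)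
  finally show "matmap S B' B'' G (matmap S B B' F w) z = matmap S B B'' (mm B' F G) w z"
    by (simp add: matmap_def nf_sum)
qed

lemma matmap_cong:
  assumes "order_ideal S"
    and "\<And>x y. x \<in> B \<Longrightarrow> y \<in> B' \<Longrightarrow> normal_form S (F x y) = normal_form S (G x y)"
  shows "matmap S B B' F w = matmap S B B' G w"
proof -
  have "normal_form S (w x * F x y) = normal_form S (w x * G x y)" if "x \<in> B" "y \<in> B'" for x y
    using assms(2)[OF that] by (metis nf_mult_right[OF assms(1)])
  then show ?thesis by (auto simp: matmap_def fun_eq_iff nf_sum)
qed

lemma matmap_gen:
  "finite B \<Longrightarrow> x \<in> B \<Longrightarrow> y \<in> B' \<Longrightarrow> matmap S B B' F (gen x) y = normal_form S (F x y)"
  by (simp add: matmap_def gen_def if_distrib[where f="\<lambda>c. c * _"] cong: if_cong)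

lemma matmap_unit:
  assumes "w \<in> elts S C" "finite (basis C)"
  shows "matmap S (basis C) (basis C) unit_matrix w = w"
proof (rule ext)
  fix y
  show "matmap S (basis C) (basis C) unit_matrix w y = w y"
    using assms elts_outside[OF assms(1), of y] eltsD[OF assms(1), of y]
    by (auto simp: matmap_def unit_matrix_def if_distrib cong: if_cong)
qed

lemma linear_matmap: "order_ideal S \<Longrightarrow> linear_map S C D (matmap S (basis C) (basis D) F)"
  by (auto simp: linear_map_def matmap_add matmap_smult)

lemma linear_map_0: "linear_map S C D f \<Longrightarrow> f 0 = 0"
proof -
  assume "linear_map S C D f"
  then have "f (0 + 0) = f 0 + f 0" unfolding linear_map_def using elts_0 by blast
  then show ?thesis by simp
qed

lemma linear_map_matrix:
  assumes "linear_map S C D f" "order_ideal S" "finite (basis C)" "w \<in> elts S C"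
  shows "f w = matmap S (basis C) (basis D) (\<lambda>x. f (gen x)) w"
proof -
  let ?part = "\<lambda>A. (\<lambda>x. if x \<in> A then w x else 0)"
  have part: "?part A \<in> elts S C" for A
    using assms(4) by (auto simp: elts_def)
  have *: "f (?part A) = (\<lambda>y. normal_form S (\<Sum>x\<in>A. w x * f (gen x) y))"
    if "A \<subseteq> basis C" "finite A" for A
    using that(2,1)
  proof (induction A rule: finite_induct)
    case empty
    have "(\<lambda>x. if x \<in> {} then w x else 0) = (0::'a elt)" by auto
    then show ?case using linear_map_0[OF assms(1)] by (simp add: fun_eq_iff zero_fun_def)
  next
    case (insert x A)
    have x: "gen x \<in> elts S C" using insert by (auto intro: gen_elts assms)
    have s: "?part (insert x A) = smult S (w x) (gen x) + ?part A"
      using insert eltsD[OF assms(4), of x] by (auto simp: fun_eq_iff smult_def gen_def)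
    have "f (?part (insert x A)) = f (smult S (w x) (gen x)) + f (?part A)"
      unfolding s using assms(1) part[of A] smult_elts[OF x] unfolding linear_map_def by blast
    also have "f (smult S (w x) (gen x)) = smult S (w x) (f (gen x))"
    proof -
      have "w x \<in> qring S" by (metis eltsD[OF assms(4)] nf_qring)
      then show ?thesis using assms(1) x unfolding linear_map_def by blast
    qed
    also have "smult S (w x) (f (gen x)) + f (?part A)
        = (\<lambda>y. normal_form S (\<Sum>x\<in>insert x A. w x * f (gen x) y))"
      using insert by (simp add: insert.IH smult_def fun_eq_iff nf_add)
    finally show ?case .
  qed
  have w: "?part (basis C) = w" using assms(4) by (auto simp: elts_def fun_eq_iff)
  have fw: "f w \<in> elts S D" using assms unfolding linear_map_def by auto
  show ?thesis
  proof (rule ext)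
    fix y
    show "f w y = matmap S (basis C) (basis D) (\<lambda>x. f (gen x)) w y"
      using fun_cong[OF *[OF order_refl assms(3)], of y] elts_outside[OF fw, of y]
      unfolding w by (simp add: matmap_def)
  qed
qed

definition hmat :: "'b based \<Rightarrow> 'c based \<Rightarrow> int \<times> int \<Rightarrow> ('b \<Rightarrow> 'c \<Rightarrow> FUV) \<Rightarrow> bool" where
  "hmat C D k F \<longleftrightarrow>
     (\<forall>x\<in>basis C. \<forall>y\<in>basis D. \<forall>m\<in>Poly_Mapping.keys (F x y). gr D y + wt m = gr C x + k)"

lemma hmatD:
  "hmat C D k F \<Longrightarrow> x \<in> basis C \<Longrightarrow> y \<in> basis D \<Longrightarrow>
    F x y = mk (gr C x + k - gr D y) (lk (F x y) (expo (gr C x + k - gr D y)))"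
  by (rule hom_mk) (auto simp: hmat_def algebra_simps)

lemma hmat_mm:
  assumes "hmat C D k F" "hmat D E l G"
  shows "hmat C E (k + l) (mm (basis D) F G)"
  unfolding hmat_def mm_def
proof (intro ballI)
  fix x z m assume x: "x \<in> basis C" and z: "z \<in> basis E"
    and m: "m \<in> Poly_Mapping.keys (\<Sum>y\<in>basis D. F x y * G y z)"
  obtain y where y: "y \<in> basis D" "m \<in> Poly_Mapping.keys (F x y * G y z)"
    using subsetD[OF keys_sum m] by auto
  then obtain a b where ab: "m = a + b" "a \<in> Poly_Mapping.keys (F x y)" "b \<in> Poly_Mapping.keys (G y z)"
    using keys_mult[of "F x y" "G y z"] by auto
  have "gr D y + wt a = gr C x + k" "gr E z + wt b = gr D y + l"
    using assms x y z ab by (auto simp: hmat_def)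
  then show "gr E z + wt m = gr C x + (k + l)"
    by (simp add: ab wt_add) (metis (no_types, lifting) add.assoc add.commute)
qed

lemma hmat_nf: "hmat C D k F \<Longrightarrow> hmat C D k (\<lambda>x y. normal_form S (F x y))"
  by (auto simp: hmat_def in_keys_iff simp del: bit_not_zero_iff split: if_splits)

lemma hmat_add:
  assumes "hmat C D k F" "hmat C D k G"
  shows "hmat C D k (F + G)"
proof -
  have "m \<in> Poly_Mapping.keys (F x y) \<or> m \<in> Poly_Mapping.keys (G x y)"
    if "m \<in> Poly_Mapping.keys (F x y + G x y)" for m x y
    using subsetD[OF keys_add that] by auto
  then show ?thesis using assms unfolding hmat_def by (metis plus_fun_apply)
qed

lemma hmat_unit: "hmat C C 0 unit_matrix"
  by (auto simp: hmat_def unit_matrix_def)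

lemma homogeneous_0 [simp]: "homogeneous C g 0"
  by (simp add: homogeneous_def)

lemma has_degree_matmap:
  assumes "hmat C D k F"
  shows "has_degree S C D k (matmap S (basis C) (basis D) F)"
  unfolding has_degree_def
proof (intro allI ballI impI)
  fix g w assume w: "w \<in> elts S C" "homogeneous C g w"
  show "homogeneous D (g + k) (matmap S (basis C) (basis D) F w)"
    unfolding homogeneous_def
  proof (intro ballI)
    fix y m assume y: "y \<in> basis D"
      and m: "m \<in> Poly_Mapping.keys (matmap S (basis C) (basis D) F w y)"
    then have "m \<in> Poly_Mapping.keys (\<Sum>x\<in>basis C. w x * F x y)"
      by (auto simp: matmap_def in_keys_iff simp del: bit_not_zero_iff split: if_splits)
    then obtain x where x: "x \<in> basis C" "m \<in> Poly_Mapping.keys (w x * F x y)"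
      using subsetD[OF keys_sum, of m] by blast
    then obtain a b where ab: "m = a + b" "a \<in> Poly_Mapping.keys (w x)" "b \<in> Poly_Mapping.keys (F x y)"
      using keys_mult[of "w x" "F x y"] by auto
    have "gr C x + wt a = g" "gr D y + wt b = gr C x + k"
      using assms x y w ab by (auto simp: hmat_def homogeneous_def)
    then show "gr D y + wt m = g + k"
      by (simp add: ab wt_add) (metis (no_types, lifting) add.assoc add.commute)
  qed
qed

lemma chain_map_matmap:
  assumes S: "order_ideal S" and fin: "finite (basis C)" "finite (basis D)" and h: "hmat C D 0 F"
    and comm: "\<And>x z. x \<in> basis C \<Longrightarrow> z \<in> basis D \<Longrightarrow>
      normal_form S (mm (basis C) (del C) F x z) = normal_form S (mm (basis D) F (del D) x z)"
  shows "chain_map S C D (matmap S (basis C) (basis D) F)"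
  unfolding chain_map_def
proof (intro conjI ballI)
  show "linear_map S C D (matmap S (basis C) (basis D) F)" by (rule linear_matmap[OF S])
  show "has_degree S C D (0, 0) (matmap S (basis C) (basis D) F)"
    using has_degree_matmap[OF h] by (simp add: zero_prod_def)
  fix w
  show "matmap S (basis C) (basis D) F (bd S C w) = bd S D (matmap S (basis C) (basis D) F w)"
    unfolding bd_matmap matmap_comp[OF S fin(1) fin(1)] matmap_comp[OF S fin]
    by (rule matmap_cong[OF S comm])
qed

text \<open>
  Together with \<open>chain_map_matmap\<close> this turns all questions on chain maps into questions on
  homogeneous matrices.
\<close>

lemma chain_map_matrix:
  assumes f: "chain_map S C D f" and S: "order_ideal S" and fin: "finite (basis C)" "finite (basis D)"
  defines "F \<equiv> \<lambda>x. f (gen x)"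
  shows "\<And>w. w \<in> elts S C \<Longrightarrow> f w = matmap S (basis C) (basis D) F w"
    and "hmat C D 0 F"
    and "\<And>x z. x \<in> basis C \<Longrightarrow> z \<in> basis D \<Longrightarrow>
      normal_form S (mm (basis C) (del C) F x z) = normal_form S (mm (basis D) F (del D) x z)"
proof -
  have lin: "linear_map S C D f" using f by (simp add: chain_map_def)
  show 1: "f w = matmap S (basis C) (basis D) F w" if "w \<in> elts S C" for w
    unfolding F_def by (rule linear_map_matrix[OF lin S fin(1) that])
  show "hmat C D 0 F"
    unfolding hmat_def
  proof (intro ballI)
    fix x y m assume x: "x \<in> basis C" and y: "y \<in> basis D" and m: "m \<in> Poly_Mapping.keys (F x y)"
    have "homogeneous C (gr C x) (gen x)"
      by (auto simp: homogeneous_def gen_def)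
    then have "homogeneous D (gr C x + (0, 0)) (F x)"
      using f gen_elts[OF S x] unfolding chain_map_def has_degree_def F_def by blast
    then show "gr D y + wt m = gr C x + 0"
      using y m unfolding homogeneous_def by (simp add: zero_prod_def)
  qed
  fix x z assume x: "x \<in> basis C" and z: "z \<in> basis D"
  have g: "gen x \<in> elts S C" by (rule gen_elts[OF S x])
  have "f (bd S C (gen x)) = bd S D (f (gen x))"
    using f g by (simp add: chain_map_def)
  then have "matmap S (basis C) (basis D) F (bd S C (gen x)) = bd S D (matmap S (basis C) (basis D) F (gen x))"
    using 1[OF g] 1[of "bd S C (gen x)"] by (simp add: bd_matmap)
  then have "matmap S (basis C) (basis D) (mm (basis C) (del C) F) (gen x) z
      = matmap S (basis C) (basis D) (mm (basis D) F (del D)) (gen x) z"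
    unfolding bd_matmap matmap_comp[OF S fin(1) fin(1)] matmap_comp[OF S fin] by simp
  then show "normal_form S (mm (basis C) (del C) F x z) = normal_form S (mm (basis D) F (del D) x z)"
    using matmap_gen[OF fin(1) x z] by metis
qed

lemma based_module_hmat:
  "based_module i C \<longleftrightarrow> finite (basis C) \<and>
     (\<forall>x\<in>basis C. \<forall>y\<in>basis C. del C x y \<in> qring (mons i)) \<and> hmat C C (- (1, 1)) (del C)"
  by (auto simp: based_module_def hmat_def homogeneous_def uminus_prod_def[symmetric] simp del: uminus_Pair)

lemma chain_complex_iff:
  assumes "1 \<le> i"
  shows "chain_complex i C \<longleftrightarrow> based_module i C \<and>
    (\<forall>x\<in>basis C. \<forall>z\<in>basis C. normal_form (mons i) (mm (basis C) (del C) (del C) x z) = 0)"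
proof (cases "based_module i C")
  case True
  then have fin: "finite (basis C)" by (simp add: based_module_def)
  note S = order_ideal_mons[OF assms]
  have "(\<forall>w\<in>elts (mons i) C. bd (mons i) C (bd (mons i) C w) = 0) \<longleftrightarrow>
    (\<forall>x\<in>basis C. \<forall>z\<in>basis C. normal_form (mons i) (mm (basis C) (del C) (del C) x z) = 0)"
  proof safe
    fix x z assume *: "\<forall>w\<in>elts (mons i) C. bd (mons i) C (bd (mons i) C w) = 0"
      and x: "x \<in> basis C" and z: "z \<in> basis C"
    have "bd (mons i) C (bd (mons i) C (gen x)) z = 0"
      using * gen_elts[OF S x] by (metis zero_fun_apply)
    then show "normal_form (mons i) (mm (basis C) (del C) (del C) x z) = 0"
      unfolding bd_matmap matmap_comp[OF S fin fin] using matmap_gen[OF fin x z] by metis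
  next
    fix w assume *: "\<forall>x\<in>basis C. \<forall>z\<in>basis C. normal_form (mons i) (mm (basis C) (del C) (del C) x z) = 0"
    have "matmap (mons i) (basis C) (basis C) (mm (basis C) (del C) (del C)) w
        = matmap (mons i) (basis C) (basis C) (\<lambda>_ _. 0) w"
      by (rule matmap_cong[OF S]) (use * in simp)
    then show "bd (mons i) C (bd (mons i) C w) = 0"
      unfolding bd_matmap matmap_comp[OF S fin fin] by (simp add: matmap_def fun_eq_iff)
  qed
  then show ?thesis by (simp add: chain_complex_def)
qed (simp add: chain_complex_def)

lemma homotopic_to_id_refl:
  assumes "\<And>w. w \<in> elts S C \<Longrightarrow> f w = w"
  shows "homotopic_to_id S C f"
  unfolding homotopic_to_id_def
  by (rule exI[of _ "\<lambda>_. 0"])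
    (auto simp: linear_map_def has_degree_def assms bd_matmap)

text \<open>
  The symmetries constructed below are isomorphisms, so the homotopies can be taken to be zero.
\<close>

lemma homotopy_equivalent_matrix:
  assumes i: "1 \<le> i" and fin: "finite (basis C)" "finite (basis D)"
    and h: "hmat C D 0 F" "hmat D C 0 G"
    and comm: "\<And>x z. x \<in> basis C \<Longrightarrow> z \<in> basis D \<Longrightarrow>
      normal_form (mons i) (mm (basis C) (del C) F x z) = normal_form (mons i) (mm (basis D) F (del D) x z)"
     "\<And>x z. x \<in> basis D \<Longrightarrow> z \<in> basis C \<Longrightarrow>
      normal_form (mons i) (mm (basis D) (del D) G x z) = normal_form (mons i) (mm (basis C) G (del C) x z)"
    and inv: "\<And>x z. x \<in> basis C \<Longrightarrow> z \<in> basis C \<Longrightarrow> mm (basis D) F G x z = unit_matrix x z"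
     "\<And>x z. x \<in> basis D \<Longrightarrow> z \<in> basis D \<Longrightarrow> mm (basis C) G F x z = unit_matrix x z"
  shows "homotopy_equivalent i C D"
proof -
  note S = order_ideal_mons[OF i]
  have FG: "matmap (mons i) (basis D) (basis C) G (matmap (mons i) (basis C) (basis D) F w) = w"
    if "w \<in> elts (mons i) C" for w
    unfolding matmap_comp[OF S fin]
    by (subst matmap_cong[OF S, where G=unit_matrix]) (use inv matmap_unit[OF that fin(1)] in auto)
  have GF: "matmap (mons i) (basis C) (basis D) F (matmap (mons i) (basis D) (basis C) G w) = w"
    if "w \<in> elts (mons i) D" for w
    unfolding matmap_comp[OF S fin(2,1)]
    by (subst matmap_cong[OF S, where G=unit_matrix]) (use inv matmap_unit[OF that fin(2)] in auto)
  show ?thesis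
    unfolding homotopy_equivalent_def
    by (rule exI[of _ "matmap (mons i) (basis C) (basis D) F"],
        rule exI[of _ "matmap (mons i) (basis D) (basis C) G"])
      (auto intro!: chain_map_matmap S fin h comm homotopic_to_id_refl simp: FG GF)
qed

lemma isomorphic_refl:
  assumes "finite (basis C)" "1 \<le> i"
  shows "isomorphic i C C"
  unfolding isomorphic_def
proof (intro exI conjI)
  show "chain_map (mons i) C C id"
    by (auto simp: chain_map_def linear_map_def has_degree_def zero_prod_def[symmetric])
  show "bij_betw id (elts (mons i) C) (elts (mons i) C)" by simp
qed

declare One_nat_def [simp del]

section \<open>Complexes that are matchings modulo one variable\<close>

text \<open>
  The exponents of the powers of one variable.  Keeping the variable as a parameter treats
  \<open>C/U\<close> over \<open>F[V]\<close> and \<open>C/V\<close> over \<open>F[U]\<close> at the same time.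
\<close>

definition axis :: "(nat \<Rightarrow> nat \<times> nat) \<Rightarrow> bool" where
  "axis xe \<longleftrightarrow> xe = (\<lambda>k. (0, k)) \<or> xe = (\<lambda>k. (k, 0))"

abbreviation Vax :: "nat \<Rightarrow> nat \<times> nat" where "Vax \<equiv> \<lambda>k. (0, k)"
abbreviation Uax :: "nat \<Rightarrow> nat \<times> nat" where "Uax \<equiv> \<lambda>k. (k, 0)"

lemma axis_V [simp]: "axis Vax" and axis_U [simp]: "axis Uax"
  by (auto simp: axis_def)

lemma mons_V_range: "mons_V = range Vax" and mons_U_range: "mons_U = range Uax"
  by (auto simp: mons_V_def mons_U_def)

lemma axis_add: "axis xe \<Longrightarrow> xe (i + j) = xe i + xe j"
  by (auto simp: axis_def)

lemma axis_0: "axis xe \<Longrightarrow> xe 0 = 0"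
  by (auto simp: axis_def zero_prod_def)

lemma axis_ideal: "axis xe \<Longrightarrow> order_ideal (range xe)"
  by (auto simp: axis_def order_ideal_def zero_prod_def)

lemma axis_in_1: "axis xe \<Longrightarrow> range xe \<subseteq> mons 1"
  by (auto simp: axis_def)

lemma axis_diff: "axis xe \<Longrightarrow> xe k = xe i + m \<Longrightarrow> i \<le> k"
  by (cases m) (auto simp: axis_def)

lemma axis_power:
  assumes "axis xe"
  shows "UV_mono (xe 1) ^ k = UV_mono (xe k)"
proof (induction k)
  case 0
  then show ?case using assms by (simp add: axis_0 UV_mono_0)
next
  case (Suc k)
  have "xe (Suc k) = xe 1 + xe k" using axis_add[OF assms, of 1 k] by (metis plus_1_eq_Suc)
  then show ?case using Suc by (simp add: UV_mono_mult)
qed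

lemma mono_mult_qring:
  assumes "axis xe" "p \<in> qring (range xe)"
  shows "UV_mono (xe k) * p \<in> qring (range xe)"
proof -
  have "m \<in> range xe" if m: "m \<in> Poly_Mapping.keys (UV_mono (xe k) * p)" for m
  proof -
    obtain j where j: "m = xe k + j" "j \<in> Poly_Mapping.keys p" using keys_mono_mult[OF m] by blast
    then obtain i where "j = xe i" using assms(2) by (auto simp: qring_def)
    then show ?thesis using j axis_add[OF assms(1), of k i] by (metis rangeI)
  qed
  then show ?thesis by (auto simp: qring_def)
qed

text \<open>
  Modulo \<open>U\<close> or \<open>V\<close> the differential of all complexes of interest is a partial matching: \<open>p\<close>
  exchanges the two ends of every arrow and fixes the unmatched elements, and \<open>\<bar>s x\<bar>\<close> is the
  length of the arrow at \<open>x\<close>, counted positively if it leaves \<open>x\<close> and negatively if it enters.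
\<close>

definition pairing ::
    "(nat \<Rightarrow> nat \<times> nat) \<Rightarrow> 'b based \<Rightarrow> ('b \<Rightarrow> 'b) \<Rightarrow> ('b \<Rightarrow> int) \<Rightarrow> bool" where
  "pairing xe C p s \<longleftrightarrow>
     (\<forall>x\<in>basis C. p x \<in> basis C \<and> p (p x) = x \<and> s (p x) = - s x \<and> (s x = 0 \<longrightarrow> p x = x)) \<and>
     (\<forall>x\<in>basis C. \<forall>y\<in>basis C. normal_form (range xe) (del C x y) =
        (if 0 < s x \<and> y = p x then UV_mono (xe (nat (s x))) else 0))"

lemma pairing_left:
  assumes ax: "axis xe" and pr: "pairing xe C p s" and fin: "finite (basis C)" and x: "x \<in> basis C"
  shows "normal_form (range xe) (mm (basis C) (del C) F x z) =
    (if 0 < s x then normal_form (range xe) (UV_mono (xe (nat (s x))) * F (p x) z) else 0)"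
proof -
  have "normal_form (range xe) (del C x u * F u z) =
      (if u = p x then (if 0 < s x then normal_form (range xe) (UV_mono (xe (nat (s x))) * F (p x) z) else 0) else 0)"
    if "u \<in> basis C" for u
    using pr x that by (subst nf_mult_left[OF axis_ideal[OF ax], symmetric]) (auto simp: pairing_def)
  then show ?thesis
    using pr x by (auto simp: mm_def nf_sum fin pairing_def cong: if_cong sum.cong)
qed

lemma pairing_right:
  assumes ax: "axis xe" and pr: "pairing xe C p s" and fin: "finite (basis C)" and z: "z \<in> basis C"
  shows "normal_form (range xe) (mm (basis C) F (del C) x z) =
    (if s z < 0 then normal_form (range xe) (UV_mono (xe (nat (- s z))) * F x (p z)) else 0)"
proof -
  have eq: "0 < s u \<and> z = p u \<longleftrightarrow> u = p z \<and> s z < 0" if "u \<in> basis C" for u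
    using pr z that unfolding pairing_def by (metis minus_minus neg_less_0_iff_less)
  have "normal_form (range xe) (F x u * del C u z) =
      (if u = p z then (if s z < 0 then normal_form (range xe) (UV_mono (xe (nat (- s z))) * F x (p z)) else 0) else 0)"
    if u: "u \<in> basis C" for u
  proof -
    have "normal_form (range xe) (del C u z) = (if u = p z \<and> s z < 0 then UV_mono (xe (nat (- s z))) else 0)"
      using pr z u eq[OF u] by (auto simp: pairing_def)
    then show ?thesis
      by (subst nf_mult_right[OF axis_ideal[OF ax], symmetric]) (auto simp: mult.commute)
  qed
  then show ?thesis
    using pr z by (auto simp: mm_def nf_sum fin pairing_def cong: if_cong sum.cong)
qed

lemma pairing_bd:
  assumes ax: "axis xe" and pr: "pairing xe C p s" and fin: "finite (basis C)"
    and w: "w \<in> elts (range xe) C" and z: "z \<in> basis C"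
  shows "bd (range xe) C w z = (if s z < 0 then UV_mono (xe (nat (- s z))) * w (p z) else 0)"
proof -
  have "w (p z) \<in> qring (range xe)" using w pr z by (auto simp: elts_def pairing_def)
  then have "UV_mono (xe (nat (- s z))) * w (p z) \<in> qring (range xe)" by (rule mono_mult_qring[OF ax])
  then show ?thesis
    using pairing_right[OF ax pr fin z, of "\<lambda>_. w" undefined] z
    by (simp add: bd_matmap matmap_def mm_def qring_iff)
qed

lemma pairing_cycles:
  assumes ax: "axis xe" and pr: "pairing xe C p s" and fin: "finite (basis C)"
  shows "cycles (range xe) C = {w \<in> elts (range xe) C. \<forall>x\<in>basis C. 0 < s x \<longrightarrow> w x = 0}"
proof -
  have "bd (range xe) C w = 0 \<longleftrightarrow> (\<forall>x\<in>basis C. 0 < s x \<longrightarrow> w x = 0)" if w: "w \<in> elts (range xe) C" for w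
  proof
    assume b: "bd (range xe) C w = 0"
    show "\<forall>x\<in>basis C. 0 < s x \<longrightarrow> w x = 0"
    proof (intro ballI impI)
      fix x assume x: "x \<in> basis C" "0 < s x"
      have px: "p x \<in> basis C" "p (p x) = x" "s (p x) = - s x" using pr x by (auto simp: pairing_def)
      have "UV_mono (xe (nat (s x))) * w x = 0"
        using pairing_bd[OF ax pr fin w px(1)] px x by (simp add: b)
      then show "w x = 0" using UV_mono_cancel[of _ "w x" 0] by simp
    qed
  next
    assume h: "\<forall>x\<in>basis C. 0 < s x \<longrightarrow> w x = 0"
    show "bd (range xe) C w = 0"
    proof (rule ext)
      fix z
      show "bd (range xe) C w z = 0 z"
      proof (cases "z \<in> basis C")
        case True
        then have "p z \<in> basis C" "s (p z) = - s z" using pr by (auto simp: pairing_def)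
        then show ?thesis using pairing_bd[OF ax pr fin w True] h by auto
      qed (simp add: bd_def)
    qed
  qed
  then show ?thesis by (auto simp: cycles_def)
qed

text \<open>
  If \<open>z0\<close> is the only unmatched element, a cycle is a multiple of \<open>z0\<close> plus targets of arrows,
  and a high power of the variable makes the latter boundaries; boundaries never involve \<open>z0\<close>.
\<close>

lemma pairing_tors_rel:
  assumes ax: "axis xe" and pr: "pairing xe C p s" and fin: "finite (basis C)"
    and z0: "z0 \<in> basis C" "s z0 = 0" "\<forall>x\<in>basis C. s x = 0 \<longrightarrow> x = z0"
  shows "tors_rel (range xe) (UV_mono (xe 1)) C =
    {(v, w). v \<in> cycles (range xe) C \<and> w \<in> cycles (range xe) C \<and> v z0 = w z0}"
proof -
  let ?S = "range xe"
  note cyc = pairing_cycles[OF ax pr fin]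
  have "(\<exists>k. smult ?S (UV_mono (xe 1) ^ k) (v + w) \<in> boundaries ?S C) \<longleftrightarrow> v z0 = w z0"
    if v: "v \<in> cycles ?S C" and w: "w \<in> cycles ?S C" for v w
  proof -
    have el: "v + w \<in> elts ?S C" using v w by (auto simp: cycles_def elts_add)
    have sm: "smult ?S (UV_mono (xe 1) ^ k) (v + w) x = UV_mono (xe k) * (v x + w x)" for k x
    proof -
      have "v x + w x \<in> qring ?S" using el by (metis eltsD nf_qring plus_fun_apply)
      then have "UV_mono (xe k) * (v x + w x) \<in> qring ?S" by (rule mono_mult_qring[OF ax])
      then show ?thesis by (simp add: smult_def axis_power[OF ax] qring_iff)
    qed
    show ?thesis
    proof
      assume "\<exists>k. smult ?S (UV_mono (xe 1) ^ k) (v + w) \<in> boundaries ?S C"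
      then obtain k u where u: "u \<in> elts ?S C" "smult ?S (UV_mono (xe 1) ^ k) (v + w) = bd ?S C u"
        by (auto simp: boundaries_def)
      have "UV_mono (xe k) * (v z0 + w z0) = 0"
        using fun_cong[OF u(2), of z0] pairing_bd[OF ax pr fin u(1) z0(1)] z0(2) by (simp only: sm) simp
      then have "v z0 + w z0 = 0" using UV_mono_cancel[of "xe k" "v z0 + w z0" 0] by simp
      then show "v z0 = w z0" by (metis FUV_add_self add_left_imp_eq)
    next
      assume eq: "v z0 = w z0"
      define k where "k = (\<Sum>x\<in>basis C. nat \<bar>s x\<bar>)"
      have k: "nat \<bar>s x\<bar> \<le> k" if "x \<in> basis C" for x
        unfolding k_def using that fin by (intro member_le_sum) auto
      define u where "u x = (if x \<in> basis C \<and> 0 < s x then UV_mono (xe (k - nat (s x))) * (v (p x) + w (p x)) else 0)" for x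
      have u: "u \<in> elts ?S C"
      proof -
        have "v y + w y \<in> qring ?S" for y using el by (metis eltsD nf_qring plus_fun_apply)
        then show ?thesis by (auto simp: elts_def u_def intro: mono_mult_qring[OF ax])
      qed
      have "smult ?S (UV_mono (xe 1) ^ k) (v + w) = bd ?S C u"
      proof (rule ext)
        fix y
        show "smult ?S (UV_mono (xe 1) ^ k) (v + w) y = bd ?S C u y"
        proof (cases "y \<in> basis C")
          case True
          have py: "p y \<in> basis C" "p (p y) = y" "s (p y) = - s y" using pr True by (auto simp: pairing_def)
          show ?thesis
          proof (cases "s y < 0")
            case neg: True
            have "xe (nat (- s y)) + xe (k - nat (- s y)) = xe k"
              using k[OF True] neg by (simp flip: axis_add[OF ax])
            then show ?thesis
              using neg py unfolding sm pairing_bd[OF ax pr fin u True]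
              by (simp add: u_def UV_mono_mult mult.assoc[symmetric])
          next
            case False
            then have "v y + w y = 0"
              using v w True eq z0(3) by (cases "s y = 0") (auto simp: cyc)
            then show ?thesis using False unfolding sm pairing_bd[OF ax pr fin u True] by simp
          qed
        next
          case False
          then have "v y + w y = 0" using elts_outside[OF el False] by simp
          then show ?thesis using False by (simp only: sm) (simp add: bd_def)
        qed
      qed
      then show "\<exists>k. smult ?S (UV_mono (xe 1) ^ k) (v + w) \<in> boundaries ?S C"
        using u by (auto simp: boundaries_def)
    qed
  qed
  then show ?thesis unfolding tors_rel_def by (simp only: elt_minus) blast
qed

lemma pairing_gen_cycle:
  assumes ax: "axis xe" and pr: "pairing xe C p s" and fin: "finite (basis C)"
    and z0: "z0 \<in> basis C" "s z0 = 0" and q: "q \<in> qring (range xe)"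
  shows "smult (range xe) q (gen z0) \<in> cycles (range xe) C" "smult (range xe) q (gen z0) z0 = q"
  using gen_elts[OF axis_ideal[OF ax] z0(1)] z0 q
  by (auto simp: pairing_cycles[OF ax pr fin] smult_elts) (auto simp: smult_def gen_def qring_iff)

lemma pairing_free_generator:
  assumes ax: "axis xe" and pr: "pairing xe C p s" and fin: "finite (basis C)"
    and z0: "z0 \<in> basis C" "s z0 = 0" "\<forall>x\<in>basis C. s x = 0 \<longrightarrow> x = z0"
  shows "free_generator (range xe) (UV_mono (xe 1)) C (gen z0)"
proof -
  let ?S = "range xe" let ?R = "tors_rel ?S (UV_mono (xe 1)) C"
  note R = pairing_tors_rel[OF ax pr fin z0]
  note g = pairing_gen_cycle[OF ax pr fin z0(1,2)]
  have cl: "?R `` {v} = {w \<in> cycles ?S C. w z0 = v z0}" if "v \<in> cycles ?S C" for v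
    using that unfolding R by auto
  have 1: "1 \<in> qring ?S" using axis_0[OF ax] by (auto simp: qring_def intro: range_eqI[of _ _ 0])
  have "gen z0 \<in> cycles ?S C"
    using g(1)[OF 1] gen_elts[OF axis_ideal[OF ax] z0(1)] by (simp add: smult_1)
  moreover have "inj_on (\<lambda>q. ?R `` {smult ?S q (gen z0)}) (qring ?S)"
  proof (rule inj_onI)
    fix q q' assume q: "q \<in> qring ?S" "q' \<in> qring ?S"
      and eq: "?R `` {smult ?S q (gen z0)} = ?R `` {smult ?S q' (gen z0)}"
    have "smult ?S q (gen z0) \<in> ?R `` {smult ?S q' (gen z0)}"
      using g(1)[OF q(1)] unfolding eq[symmetric] cl[OF g(1)[OF q(1)]] by simp
    then show "q = q'" unfolding cl[OF g(1)[OF q(2)]] by (simp add: g(2) q)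
  qed
  moreover have "(\<lambda>q. ?R `` {smult ?S q (gen z0)}) ` qring ?S = hom_mod_tors ?S (UV_mono (xe 1)) C"
  proof safe
    fix q assume "q \<in> qring ?S"
    then show "?R `` {smult ?S q (gen z0)} \<in> hom_mod_tors ?S (UV_mono (xe 1)) C"
      unfolding hom_mod_tors_def using g(1) by (blast intro: quotientI)
  next
    fix K assume "K \<in> hom_mod_tors ?S (UV_mono (xe 1)) C"
    then obtain v where v: "v \<in> cycles ?S C" "K = ?R `` {v}"
      unfolding hom_mod_tors_def quotient_def by blast
    have q: "v z0 \<in> qring ?S" using v(1) z0(1) by (auto simp: cycles_def elts_def)
    have "K = ?R `` {smult ?S (v z0) (gen z0)}"
      unfolding v(2) cl[OF v(1)] cl[OF g(1)[OF q]] g(2)[OF q] by simp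
    then show "K \<in> (\<lambda>q. ?R `` {smult ?S q (gen z0)}) ` qring ?S" using q by blast
  qed
  ultimately show ?thesis by (simp add: free_generator_def bij_betw_def)
qed

text \<open>
  Any generator of the homology modulo torsion has coefficient 1 at the unmatched element, which
  therefore has the bidegree of the generator.  This determines the gradings of a standard complex
  from the arrows.
\<close>

lemma pairing_generator_grade:
  assumes ax: "axis xe" and pr: "pairing xe C p s" and fin: "finite (basis C)"
    and z0: "z0 \<in> basis C" "s z0 = 0" "\<forall>x\<in>basis C. s x = 0 \<longrightarrow> x = z0"
    and z: "free_generator (range xe) (UV_mono (xe 1)) C z" "homogeneous C g z"
  shows "gr C z0 = g"
proof -
  let ?S = "range xe" let ?R = "tors_rel ?S (UV_mono (xe 1)) C"
  note R = pairing_tors_rel[OF ax pr fin z0]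
  have 1: "1 \<in> qring ?S" using axis_0[OF ax] by (auto simp: qring_def intro: range_eqI[of _ _ 0])
  have c: "gen z0 \<in> cycles ?S C"
    using pairing_gen_cycle(1)[OF ax pr fin z0(1,2) 1] gen_elts[OF axis_ideal[OF ax] z0(1)] by (simp add: smult_1)
  then have "?R `` {gen z0} \<in> (\<lambda>q. ?R `` {smult ?S q z}) ` qring ?S"
    using z(1) unfolding free_generator_def bij_betw_def hom_mod_tors_def by (auto intro: quotientI)
  then obtain q where "?R `` {gen z0} = ?R `` {smult ?S q z}" by auto
  moreover have "gen z0 \<in> ?R `` {gen z0}" using c unfolding R by auto
  ultimately have "(smult ?S q z, gen z0) \<in> ?R" by auto
  then have "normal_form ?S (q * z z0) = 1"
    unfolding R by (auto simp: smult_def gen_def)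
  then have "lk (normal_form ?S (q * z z0)) 0 = 1" by simp
  then have "0 \<in> Poly_Mapping.keys (q * z z0)" by (simp add: in_keys_iff split: if_splits)
  then obtain a b where ab: "0 = a + b" "b \<in> Poly_Mapping.keys (z z0)"
    using keys_mult[of q "z z0"] by auto
  then have "b = 0" by (cases a; cases b) (auto simp: zero_prod_def)
  then show ?thesis using z(2) ab z0(1) unfolding homogeneous_def by (metis add.right_neutral wt_0)
qed

lemma correct_homology_pairing:
  assumes "finite (basis C)" "pairing Vax C p s" "z \<in> basis C" "s z = 0"
    "\<forall>x\<in>basis C. s x = 0 \<longrightarrow> x = z" "fst (gr C z) = 0"
    and "pairing Uax C p' s'" "z' \<in> basis C" "s' z' = 0"
    "\<forall>x\<in>basis C. s' x = 0 \<longrightarrow> x = z'" "snd (gr C z') = 0"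
  shows "correct_homology C"
proof -
  have h: "homogeneous C (gr C x) (gen x)" for x by (auto simp: homogeneous_def gen_def)
  have "free_generator mons_V V_var C (gen z)"
    using pairing_free_generator[OF axis_V assms(2,1,3,4,5)] by (simp add: mons_V_range)
  moreover have "free_generator mons_U U_var C (gen z')"
    using pairing_free_generator[OF axis_U assms(7,1,8,9,10)] by (simp add: mons_U_range)
  ultimately show ?thesis
    unfolding correct_homology_def using h[of z] h[of z'] assms(6,11) by (metis prod.collapse)
qed


section \<open>Chain maps between matched complexes\<close>

text \<open>
  The possible behaviours of a basis element with respect to one of the variables, as encoded by
  the signed length \<open>s x\<close> of the arrow at it, in the order: left by an arrow of length 1, of length
  2, and so on; unmatched; and so on, entered by an arrow of length 2, of length 1.
\<close>

definition letter_le :: "int \<Rightarrow> int \<Rightarrow> bool" where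
  "letter_le s t \<longleftrightarrow> (if 0 < s then t \<le> 0 \<or> s \<le> t else if s = 0 then t \<le> 0 else s \<le> t \<and> t < 0)"

lemma letter_le_trans: "letter_le s t \<Longrightarrow> letter_le t u \<Longrightarrow> letter_le s u"
  by (auto simp: letter_le_def split: if_splits)

lemma letter_le_antisym: "letter_le s t \<Longrightarrow> letter_le t s \<Longrightarrow> s = t"
  by (auto simp: letter_le_def split: if_splits)

text \<open>
  Compare the coefficients in \<open>\<partial> F = F \<partial>\<close>.  If \<open>F x\<close> contains \<open>y\<close> with constant coefficient and \<open>y\<close> has
  an outgoing arrow of length \<open>k\<close>, then \<open>\<partial> (F x)\<close> contains the \<open>k\<close>-th power times the partner of \<open>y\<close>, and so
  does \<open>F (\<partial> x)\<close>, which is divisible by the power of the variable at the arrow out of \<open>x\<close>.  So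
  there is such an arrow, it is at most as long, and if it is equally long, the quotient is a
  constant coefficient between the partners.  For incoming arrows the argument is applied to the
  partner of \<open>x\<close>.
\<close>

lemma letter_step:
  assumes ax: "axis xe" and C: "pairing xe C p s" "finite (basis C)" and D: "pairing xe D p' s'" "finite (basis D)"
    and comm: "\<And>x z. x \<in> basis C \<Longrightarrow> z \<in> basis D \<Longrightarrow>
      normal_form (range xe) (mm (basis C) (del C) F x z) = normal_form (range xe) (mm (basis D) F (del D) x z)"
    and x: "x \<in> basis C" and y: "y \<in> basis D" and one: "lk (F x y) 0 = 1"
  shows "letter_le (s x) (s' y) \<and> (s x = s' y \<longrightarrow> lk (F (p x) (p' y)) 0 = 1)"
proof -
  have px: "p x \<in> basis C" "p (p x) = x" "s (p x) = - s x" "s x = 0 \<Longrightarrow> p x = x"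
    using C x by (auto simp: pairing_def)
  have py: "p' y \<in> basis D" "p' (p' y) = y" "s' (p' y) = - s' y" "s' y = 0 \<Longrightarrow> p' y = y"
    using D y by (auto simp: pairing_def)
  have one': "lk (UV_mono m * F x y) m = 1" for m
    using lookup_mono_mult[of m "F x y" 0] one by simp
  \<comment> \<open>divisibility by a power of the variable, with the constant term of the quotient if the power is exact\<close>
  have shift: "i \<le> k \<and> (i = k \<longrightarrow> lk q 0 = 1)" if "lk (UV_mono (xe i) * q) (xe k) = 1" for i k q
  proof -
    have "xe k \<in> Poly_Mapping.keys (UV_mono (xe i) * q)" using that by (simp add: in_keys_iff)
    then obtain j where "xe k = xe i + j" using keys_mono_mult by blast
    then have "i \<le> k" by (rule axis_diff[OF ax])
    then show ?thesis using that lookup_mono_mult[of "xe i" q 0] by auto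
  qed
  have A: "0 < s x \<and> s x \<le> s' y \<and> (s x = s' y \<longrightarrow> lk (F (p x) (p' y)) 0 = 1)" if pos: "0 < s' y"
  proof -
    have eq: "(if 0 < s x then normal_form (range xe) (UV_mono (xe (nat (s x))) * F (p x) (p' y)) else 0)
        = normal_form (range xe) (UV_mono (xe (nat (s' y))) * F x y)"
      using pairing_left[OF ax C x, of F "p' y"] pairing_right[OF ax D py(1), of F x] comm[OF x py(1)] py pos by simp
    have l: "lk (if 0 < s x then normal_form (range xe) (UV_mono (xe (nat (s x))) * F (p x) (p' y)) else 0)
        (xe (nat (s' y))) = 1"
      unfolding eq by (simp add: one')
    then have sx: "0 < s x" by (auto split: if_splits)
    then show ?thesis using shift[of "nat (s x)" "F (p x) (p' y)" "nat (s' y)"] l pos by auto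
  qed
  have B: "s' y < 0 \<and> s x \<le> s' y \<and> (s x = s' y \<longrightarrow> lk (F (p x) (p' y)) 0 = 1)" if neg: "s x < 0"
  proof -
    have eq: "normal_form (range xe) (UV_mono (xe (nat (- s x))) * F x y)
        = (if s' y < 0 then normal_form (range xe) (UV_mono (xe (nat (- s' y))) * F (p x) (p' y)) else 0)"
      using pairing_left[OF ax C px(1), of F y] pairing_right[OF ax D y, of F "p x"] comm[OF px(1) y] px neg by simp
    have l: "lk (if s' y < 0 then normal_form (range xe) (UV_mono (xe (nat (- s' y))) * F (p x) (p' y)) else 0)
        (xe (nat (- s x))) = 1"
      unfolding eq[symmetric] by (simp add: one')
    then have sy: "s' y < 0" by (auto split: if_splits)
    then show ?thesis using shift[of "nat (- s' y)" "F (p x) (p' y)" "nat (- s x)"] l neg by auto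
  qed
  show ?thesis
  proof (cases "0 < s' y \<or> s x < 0")
    case True
    then show ?thesis using A B by (auto simp: letter_le_def)
  next
    case False
    then show ?thesis using px(4) py(4) one by (auto simp: letter_le_def)
  qed
qed


section \<open>Homology modulo torsion is functorial\<close>

lemma boundaries_add: "v \<in> boundaries S C \<Longrightarrow> w \<in> boundaries S C \<Longrightarrow> v + w \<in> boundaries S C"
  unfolding boundaries_def bd_matmap by (auto simp flip: matmap_add intro: elts_add)

lemma boundaries_smult: "order_ideal S \<Longrightarrow> v \<in> boundaries S C \<Longrightarrow> smult S p v \<in> boundaries S C"
  unfolding boundaries_def bd_matmap by (auto simp flip: matmap_smult intro: smult_elts)

lemma equiv_tors_rel:
  assumes S: "order_ideal S"
  shows "equiv (cycles S C) (tors_rel S X C)"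
proof (rule equivI)
  show "tors_rel S X C \<subseteq> cycles S C \<times> cycles S C"
    by (auto simp: tors_rel_def)
  have "0 \<in> boundaries S C" unfolding boundaries_def bd_matmap
    by (rule image_eqI[of _ _ 0]) simp_all
  then show "refl_on (cycles S C) (tors_rel S X C)"
    by (auto simp: refl_on_def tors_rel_def)
  show "sym (tors_rel S X C)"
    by (auto simp: sym_def tors_rel_def add.commute)
  show "trans (tors_rel S X C)"
  proof (rule transI)
    fix u v w assume "(u, v) \<in> tors_rel S X C" "(v, w) \<in> tors_rel S X C"
    then obtain k l where c: "u \<in> cycles S C" "w \<in> cycles S C"
      and kl: "smult S (X ^ k) (u + v) \<in> boundaries S C" "smult S (X ^ l) (v + w) \<in> boundaries S C"
      by (auto simp: tors_rel_def)
    have "smult S (X ^ (k + l)) (u + v) \<in> boundaries S C"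
      using boundaries_smult[OF S kl(1), of "X ^ l"] by (simp add: smult_smult[OF S] power_add mult.commute)
    moreover have "smult S (X ^ (k + l)) (v + w) \<in> boundaries S C"
      using boundaries_smult[OF S kl(2), of "X ^ k"] by (simp add: smult_smult[OF S] power_add)
    moreover have "(u + v) + (v + w) = u + w"
    proof -
      have "(u + v) + (v + w) = u + ((v + v) + w)" by (simp only: add.assoc)
      then show ?thesis by (simp only: elt_add_self add_0_left)
    qed
    ultimately have "smult S (X ^ (k + l)) (u + w) \<in> boundaries S C"
      using boundaries_add by (metis smult_add)
    then show "(u, w) \<in> tors_rel S X C" using c by (auto simp: tors_rel_def)
  qed
qed

lemma reduce_chain_map:
  assumes f: "chain_map (mons 1) C D f" and S: "order_ideal S" "S \<subseteq> mons 1"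
    and fin: "finite (basis C)" "finite (basis D)"
  defines "F \<equiv> \<lambda>x. f (gen x)"
  shows "\<And>v. v \<in> elts S C \<Longrightarrow> (reduce_elt S \<circ> f) v = matmap S (basis C) (basis D) F v"
    and "\<And>v. bd S D (matmap S (basis C) (basis D) F v) = matmap S (basis C) (basis D) F (bd S C v)"
proof -
  fix v assume v: "v \<in> elts S C"
  then have v1: "v \<in> elts (mons 1) C" using S(2) by (auto simp: elts_def intro: qring_mono)
  show "(reduce_elt S \<circ> f) v = matmap S (basis C) (basis D) F v"
    using chain_map_matrix(1)[OF f order_ideal_1 fin v1]
    by (auto simp: reduce_elt_def matmap_def fun_eq_iff F_def nf_subset[OF S(2)])
next
  fix v
  have "normal_form S (mm (basis C) (del C) F x z) = normal_form S (mm (basis D) F (del D) x z)"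
    if "x \<in> basis C" "z \<in> basis D" for x z
    using chain_map_matrix(3)[OF f order_ideal_1 fin that]
    unfolding F_def by (metis nf_subset[OF S(2)])
  then show "bd S D (matmap S (basis C) (basis D) F v) = matmap S (basis C) (basis D) F (bd S C v)"
    unfolding bd_matmap matmap_comp[OF S(1) fin(1) fin(1)] matmap_comp[OF S(1) fin]
    by (intro matmap_cong[OF S(1)]) simp
qed

lemma induced_map_class:
  assumes f: "chain_map (mons 1) C D f" and S: "order_ideal S" "S \<subseteq> mons 1"
    and fin: "finite (basis C)" "finite (basis D)" and v: "v \<in> cycles S C"
  shows "induced_map S X D f (tors_rel S X C `` {v}) = tors_rel S X D `` {(reduce_elt S \<circ> f) v}"
    "(reduce_elt S \<circ> f) v \<in> cycles S D"
proof -
  define \<phi> where "\<phi> = matmap S (basis C) (basis D) (\<lambda>x. f (gen x))"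
  note r = reduce_chain_map[OF f S fin, folded \<phi>_def]
  have el: "\<phi> w \<in> elts S D" for w by (simp add: \<phi>_def)
  have cyc: "\<phi> w \<in> cycles S D" if "w \<in> cycles S C" for w
    using that el r(2)[of w] by (auto simp: cycles_def \<phi>_def)
  then show "(reduce_elt S \<circ> f) v \<in> cycles S D" using v r(1)[of v] by (auto simp: cycles_def)
  have tors: "(\<phi> w, \<phi> w') \<in> tors_rel S X D" if ww: "(w, w') \<in> tors_rel S X C" for w w'
  proof -
    obtain k u where u: "w \<in> cycles S C" "w' \<in> cycles S C" "u \<in> elts S C" "smult S (X ^ k) (w + w') = bd S C u"
      using ww by (auto simp: tors_rel_def boundaries_def)
    have "smult S (X ^ k) (\<phi> w + \<phi> w') = \<phi> (smult S (X ^ k) (w + w'))"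
      by (simp add: \<phi>_def matmap_add matmap_smult[OF S(1)])
    also have "\<dots> = bd S D (\<phi> u)" using u r(2) by simp
    finally show ?thesis using u cyc el by (auto simp: tors_rel_def boundaries_def)
  qed
  have im: "(reduce_elt S \<circ> f) ` (tors_rel S X C `` {v}) = \<phi> ` (tors_rel S X C `` {v})"
    by (rule image_cong) (auto simp: r(1)[unfolded o_def] o_def tors_rel_def cycles_def)
  have cls: "tors_rel S X D `` {\<phi> w} = tors_rel S X D `` {\<phi> v}" if "w \<in> tors_rel S X C `` {v}" for w
  proof (rule equiv_class_eq[OF equiv_tors_rel[OF S(1)], symmetric])
    show "(\<phi> v, \<phi> w) \<in> tors_rel S X D" using tors that by blast
  qed
  have self: "v \<in> tors_rel S X C `` {v}" using equiv_class_self[OF equiv_tors_rel[OF S(1)] v] .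
  have "tors_rel S X D `` (\<phi> ` (tors_rel S X C `` {v})) = tors_rel S X D `` {\<phi> v}"
    using cls self by blast
  then show "induced_map S X D f (tors_rel S X C `` {v}) = tors_rel S X D `` {(reduce_elt S \<circ> f) v}"
    unfolding induced_map_def im using v r(1)[of v] by (simp add: cycles_def)
qed

text \<open>
  A map that takes a generator to a generator is, in terms of the two bijections with the ring, the
  identity.
\<close>

lemma induced_bij:
  assumes f: "chain_map (mons 1) C D f" and S: "order_ideal S" "S \<subseteq> mons 1"
    and fin: "finite (basis C)" "finite (basis D)"
    and z: "free_generator S X C z" "free_generator S X D z'"
    and fz: "(reduce_elt S \<circ> f) z = z'"
  shows "bij_betw (induced_map S X D f) (hom_mod_tors S X C) (hom_mod_tors S X D)"
proof -
  let ?g = "\<lambda>p. tors_rel S X C `` {smult S p z}" and ?g' = "\<lambda>p. tors_rel S X D `` {smult S p z'}"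
  have g: "bij_betw ?g (qring S) (hom_mod_tors S X C)" "bij_betw ?g' (qring S) (hom_mod_tors S X D)"
    and zc: "z \<in> cycles S C" using z by (auto simp: free_generator_def)
  have "induced_map S X D f (?g p) = ?g' p" if "p \<in> qring S" for p
  proof -
    have ze: "z \<in> elts S C" using zc by (simp add: cycles_def)
    have "smult S p z \<in> cycles S C"
      using zc by (auto simp: cycles_def smult_elts bd_matmap matmap_smult[OF S(1)])
    note 1 = induced_map_class(1)[OF f S fin this]
    have "(reduce_elt S \<circ> f) (smult S p z) = smult S p z'"
      using reduce_chain_map(1)[OF f S fin smult_elts[OF ze]] reduce_chain_map(1)[OF f S fin ze] fz
      by (simp add: matmap_smult[OF S(1)])
    then show ?thesis using 1 by simp
  qed
  then have "bij_betw (induced_map S X D f \<circ> ?g) (qring S) (hom_mod_tors S X D)"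
    using g(2) by (subst bij_betw_cong[where g="?g'"]) auto
  then show ?thesis using bij_betw_comp_iff[OF g(1)] by blast
qed

text \<open>
  If the coefficient vanished, the image of the generator \<open>z0\<close> under \<open>g \<circ> f\<close> would be torsion; but
  both maps are injective modulo torsion, and \<open>z0\<close> is not torsion.
\<close>

lemma local_coeff_nonzero:
  assumes ax: "axis xe" and pr: "pairing xe C p s"
    and z0: "z0 \<in> basis C" "s z0 = 0" "\<forall>x\<in>basis C. s x = 0 \<longrightarrow> x = z0"
    and fin: "finite (basis C)" "finite (basis D)"
    and f: "chain_map (mons 1) C D f" and g: "chain_map (mons 1) D C g"
    and bij: "inj_on (induced_map (range xe) (UV_mono (xe 1)) D f) (hom_mod_tors (range xe) (UV_mono (xe 1)) C)"
      "inj_on (induced_map (range xe) (UV_mono (xe 1)) C g) (hom_mod_tors (range xe) (UV_mono (xe 1)) D)"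
  shows "normal_form (range xe) (mm (basis D) (\<lambda>x. f (gen x)) (\<lambda>x. g (gen x)) z0 z0) \<noteq> 0"
proof
  assume zero: "normal_form (range xe) (mm (basis D) (\<lambda>x. f (gen x)) (\<lambda>x. g (gen x)) z0 z0) = 0"
  let ?S = "range xe" let ?X = "UV_mono (xe 1)"
  note S = axis_ideal[OF ax] axis_in_1[OF ax]
  note RC = pairing_tors_rel[OF ax pr fin(1) z0]
  have 1: "1 \<in> qring ?S" using axis_0[OF ax] by (auto simp: qring_def intro: range_eqI[of _ _ 0])
  have c: "gen z0 \<in> cycles ?S C"
    using pairing_gen_cycle(1)[OF ax pr fin(1) z0(1,2) 1] gen_elts[OF S(1) z0(1)] by (simp add: smult_1)
  have c0: "0 \<in> cycles ?S E" for E :: "'z based" by (simp add: cycles_def bd_matmap)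
  define v where "v = (reduce_elt ?S \<circ> f) (gen z0)"
  note if1 = induced_map_class[OF f S fin c, folded v_def]
  note ig = induced_map_class[OF g S fin(2,1) if1(2)]
  have f0: "(reduce_elt ?S \<circ> f) 0 = 0" and g0: "(reduce_elt ?S \<circ> g) 0 = 0"
    using reduce_chain_map(1)[OF f S fin elts_0] reduce_chain_map(1)[OF g S fin(2,1) elts_0] by simp_all
  have coeff: "(reduce_elt ?S \<circ> g) v z0 = 0"
  proof -
    have "v = matmap ?S (basis C) (basis D) (\<lambda>x. f (gen x)) (gen z0)"
      unfolding v_def using c by (intro reduce_chain_map(1)[OF f S fin]) (simp add: cycles_def)
    moreover have "v \<in> elts ?S D" using if1(2) by (simp add: cycles_def)
    ultimately have "(reduce_elt ?S \<circ> g) v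
       = matmap ?S (basis C) (basis C) (mm (basis D) (\<lambda>x. f (gen x)) (\<lambda>x. g (gen x))) (gen z0)"
      using reduce_chain_map(1)[OF g S fin(2,1)] matmap_comp[OF S(1) fin] by metis
    then show ?thesis using matmap_gen[OF fin(1) z0(1) z0(1)] zero by metis
  qed
  have "((reduce_elt ?S \<circ> g) v, 0) \<in> tors_rel ?S ?X C"
    unfolding RC using ig(2) c0 coeff by auto
  then have "induced_map ?S ?X C g (tors_rel ?S ?X D `` {v}) = induced_map ?S ?X C g (tors_rel ?S ?X D `` {0})"
    unfolding ig(1) induced_map_class(1)[OF g S fin(2,1) c0] g0
    by (rule equiv_class_eq[OF equiv_tors_rel[OF S(1)]])
  then have "tors_rel ?S ?X D `` {v} = tors_rel ?S ?X D `` {0}"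
    by (rule inj_onD[OF bij(2)]) (auto simp only: hom_mod_tors_def intro: quotientI if1(2) c0)
  then have "induced_map ?S ?X D f (tors_rel ?S ?X C `` {gen z0}) = induced_map ?S ?X D f (tors_rel ?S ?X C `` {0})"
    unfolding if1(1) induced_map_class(1)[OF f S fin c0] f0 .
  then have "tors_rel ?S ?X C `` {gen z0} = tors_rel ?S ?X C `` {0}"
    by (rule inj_onD[OF bij(1)]) (auto simp only: hom_mod_tors_def intro: quotientI c c0)
  then have "(gen z0, 0) \<in> tors_rel ?S ?X C"
    using eq_equiv_class[OF _ equiv_tors_rel[OF S(1)] c0] by blast
  then show False unfolding RC by (auto simp: gen_def)
qed

section \<open>Standard complexes\<close>

text \<open>
  The matchings of a standard complex modulo \<open>V\<close>, which leaves over \<open>x_2n\<close>, and modulo \<open>U\<close>, which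
  leaves over \<open>x_0\<close>.
\<close>

definition std_pU :: "nat \<Rightarrow> nat \<Rightarrow> nat" where
  "std_pU n x = (if x = 2 * n then x else if even x then Suc x else x - 1)"

definition std_sU :: "nat \<Rightarrow> (nat \<Rightarrow> int) \<Rightarrow> nat \<Rightarrow> int" where
  "std_sU n a x = (if x = 2 * n then 0 else if even x then - a (Suc x) else a x)"

definition std_pV :: "nat \<Rightarrow> nat" where
  "std_pV x = (if x = 0 then 0 else if even x then x - 1 else Suc x)"

definition std_sV :: "(nat \<Rightarrow> int) \<Rightarrow> nat \<Rightarrow> int" where
  "std_sV a x = (if x = 0 then 0 else if even x then a x else - a (Suc x))"

abbreviation nonzero_seq :: "nat \<Rightarrow> (nat \<Rightarrow> int) \<Rightarrow> bool" where
  "nonzero_seq n a \<equiv> \<forall>i\<in>{1..2 * n}. a i \<noteq> 0"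

definition edge :: "(nat \<Rightarrow> int) \<Rightarrow> nat \<Rightarrow> nat \<times> nat" where
  "edge a i = (if odd i then (nat \<bar>a i\<bar>, 0) else (0, nat \<bar>a i\<bar>))"

lemma std_coeff_edge: "std_coeff a i = UV_mono (edge a i)"
  by (simp add: std_coeff_def edge_def)

lemma edge_in_1: "edge a i \<in> mons 1"
  by (simp add: edge_def)

lemma std_del_simps:
  "std_del a x (Suc x) = (if a (Suc x) < 0 then UV_mono (edge a (Suc x)) else 0)"
  "std_del a (Suc x) x = (if 0 < a (Suc x) then UV_mono (edge a (Suc x)) else 0)"
  "y \<noteq> Suc x \<Longrightarrow> x \<noteq> Suc y \<Longrightarrow> std_del a x y = 0"
  by (simp_all add: std_del_def std_coeff_edge)

lemma std_del_nz:
  assumes "std_del a x y \<noteq> 0"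
  obtains i where "x = Suc i" "y = i" "0 < a (Suc i)" "std_del a x y = UV_mono (edge a (Suc i))"
  | i where "x = i" "y = Suc i" "a (Suc i) < 0" "std_del a x y = UV_mono (edge a (Suc i))"
  using assms by (auto simp: std_del_def std_coeff_edge split: if_splits)

lemma std_del_1: "normal_form (mons 1) (std_del a x y) = std_del a x y"
  by (cases "std_del a x y = 0") (auto simp: nf_mono edge_in_1 elim!: std_del_nz)

text \<open>
  The gradings are left open, so that the definition covers the standard complex before its
  gradings are known and all lifts of it.
\<close>

definition std_based :: "nat \<Rightarrow> (nat \<Rightarrow> int) \<Rightarrow> nat based \<Rightarrow> bool" where
  "std_based n a C \<longleftrightarrow> basis C = {0..2 * n} \<and>
     (\<forall>x\<in>{0..2 * n}. \<forall>y\<in>{0..2 * n}. normal_form (mons 1) (del C x y) = std_del a x y)"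

lemma edge_nz: "nonzero_seq n a \<Longrightarrow> 1 \<le> i \<Longrightarrow> i \<le> 2 * n \<Longrightarrow> edge a i \<in> range Uax \<longleftrightarrow> odd i"
  "nonzero_seq n a \<Longrightarrow> 1 \<le> i \<Longrightarrow> i \<le> 2 * n \<Longrightarrow> edge a i \<in> range Vax \<longleftrightarrow> even i"
  by (auto simp: edge_def)

lemma pairing_std_U:
  assumes "nonzero_seq n a" "std_based n a C"
  shows "pairing Uax C (std_pU n) (std_sU n a)"
proof -
  have 1: "std_pU n x \<in> {0..2 * n} \<and> std_pU n (std_pU n x) = x \<and> std_sU n a (std_pU n x) = - std_sU n a x
      \<and> (std_sU n a x = 0 \<longrightarrow> std_pU n x = x)" if "x \<in> {0..2 * n}" for x
  proof -
    consider "x = 2 * n" | k where "x = 2 * k" "k < n" | k where "x = Suc (2 * k)" "k < n"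
    proof (cases "even x")
      case True
      then obtain k where "x = 2 * k" by (rule evenE)
      then show ?thesis using \<open>x \<in> {0..2 * n}\<close> that(1) that(2)[of k] by (cases "k < n") auto
    next
      case False
      then obtain k where "x = 2 * k + 1" by (rule oddE)
      then show ?thesis using \<open>x \<in> {0..2 * n}\<close> that(3)[of k] by auto
    qed
    then show ?thesis
    proof cases
      case (2 k)
      then have "a (Suc (2 * k)) \<noteq> 0" using assms(1) by auto
      then show ?thesis using 2 by (auto simp: std_pU_def std_sU_def)
    next
      case (3 k)
      then have "a (Suc (2 * k)) \<noteq> 0" using assms(1) by auto
      then show ?thesis using 3 by (auto simp: std_pU_def std_sU_def)
    qed (simp add: std_pU_def std_sU_def)
  qed
  have 2: "normal_form (range Uax) (del C x y) =
      (if 0 < std_sU n a x \<and> y = std_pU n x then UV_mono (Uax (nat (std_sU n a x))) else 0)"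
    if x: "x \<in> {0..2 * n}" and y: "y \<in> {0..2 * n}" for x y
  proof -
    have "normal_form (range Uax) (del C x y) = normal_form (range Uax) (std_del a x y)"
      using assms(2) x y nf_subset[OF axis_in_1[OF axis_U], of "del C x y"]
      unfolding std_based_def by simp
    also have "\<dots> = (if 0 < std_sU n a x \<and> y = std_pU n x then UV_mono (Uax (nat (std_sU n a x))) else 0)"
    proof (cases "y = Suc x \<or> x = Suc y")
      case True
      have d: "std_del a x y = (if 0 < a x then UV_mono (edge a x) else 0)" if "Suc y = x"
        using std_del_simps(2)[of a y] that by simp
      from True show ?thesis
        using x y edge_nz(1)[OF assms(1), of "Suc x"] edge_nz(1)[OF assms(1), of x] d
        by (auto simp: std_del_simps nf_mono std_sU_def std_pU_def edge_def)
    next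
      case False
      then show ?thesis
        using x y Suc_pred'[OF odd_pos, of x] by (auto simp: std_del_simps std_sU_def std_pU_def)
    qed
    finally show ?thesis .
  qed
  show ?thesis using 1 2 assms(2) unfolding pairing_def std_based_def by simp
qed

lemma pairing_std_V:
  assumes "nonzero_seq n a" "std_based n a C"
  shows "pairing Vax C std_pV (std_sV a)"
proof -
  have 1: "std_pV x \<in> {0..2 * n} \<and> std_pV (std_pV x) = x \<and> std_sV a (std_pV x) = - std_sV a x
      \<and> (std_sV a x = 0 \<longrightarrow> std_pV x = x)" if "x \<in> {0..2 * n}" for x
  proof -
    consider "x = 0" | k where "x = Suc (Suc (2 * k))" "k < n" | k where "x = Suc (2 * k)" "k < n"
    proof (cases "even x")
      case True
      then obtain k where "x = 2 * k" by (rule evenE)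
      then show ?thesis using \<open>x \<in> {0..2 * n}\<close> that(1) that(2)[of "k - 1"] by (cases k) auto
    next
      case False
      then obtain k where "x = 2 * k + 1" by (rule oddE)
      then show ?thesis using \<open>x \<in> {0..2 * n}\<close> that(3)[of k] by auto
    qed
    then show ?thesis
    proof cases
      case (2 k)
      then have "a (Suc (Suc (2 * k))) \<noteq> 0" using assms(1) by auto
      then show ?thesis using 2 by (auto simp: std_pV_def std_sV_def)
    next
      case (3 k)
      then have "a (Suc (Suc (2 * k))) \<noteq> 0" using assms(1) by auto
      then show ?thesis using 3 by (auto simp: std_pV_def std_sV_def)
    qed (simp add: std_pV_def std_sV_def)
  qed
  have 2: "normal_form (range Vax) (del C x y) =
      (if 0 < std_sV a x \<and> y = std_pV x then UV_mono (Vax (nat (std_sV a x))) else 0)"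
    if x: "x \<in> {0..2 * n}" and y: "y \<in> {0..2 * n}" for x y
  proof -
    have "normal_form (range Vax) (del C x y) = normal_form (range Vax) (std_del a x y)"
      using assms(2) x y nf_subset[OF axis_in_1[OF axis_V], of "del C x y"]
      unfolding std_based_def by simp
    also have "\<dots> = (if 0 < std_sV a x \<and> y = std_pV x then UV_mono (Vax (nat (std_sV a x))) else 0)"
    proof (cases "y = Suc x \<or> x = Suc y")
      case True
      then show ?thesis
        using x y edge_nz(2)[OF assms(1), of "Suc x"] edge_nz(2)[OF assms(1), of x]
        by (auto simp: std_del_simps nf_mono std_sV_def std_pV_def edge_def)
    next
      case False
      then show ?thesis
        using x y by (auto simp: std_del_simps std_sV_def std_pV_def)
    qed
    finally show ?thesis .
  qed
  show ?thesis using 1 2 assms(2) unfolding pairing_def std_based_def by simp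
qed

lemma unmatched_U:
  assumes "nonzero_seq n a" "x \<in> {0..2 * n}"
  shows "std_sU n a x = 0 \<longleftrightarrow> x = 2 * n"
proof -
  have "a (Suc x) \<noteq> 0" if "x \<noteq> 2 * n" using assms that by simp
  moreover have "a x \<noteq> 0" if "odd x" using assms odd_pos[OF that] by simp
  ultimately show ?thesis by (auto simp: std_sU_def)
qed

lemma unmatched_V:
  assumes "nonzero_seq n a" "x \<in> {0..2 * n}"
  shows "std_sV a x = 0 \<longleftrightarrow> x = 0"
proof -
  have "a (Suc x) \<noteq> 0" if "odd x"
  proof -
    have "x \<noteq> 2 * n" using that by auto
    then show ?thesis using assms by simp
  qed
  moreover have "a x \<noteq> 0" if "x \<noteq> 0" using assms that by simp
  ultimately show ?thesis by (auto simp: std_sV_def)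
qed

lemma nf_1_zero_iff:
  "normal_form (mons 1) p = 0 \<longleftrightarrow> normal_form (range Uax) p = 0 \<and> normal_form (range Vax) p = 0"
proof
  assume "normal_form (mons 1) p = 0"
  then show "normal_form (range Uax) p = 0 \<and> normal_form (range Vax) p = 0"
    by (metis axis_in_1 axis_U axis_V nf_subset nf_0)
next
  assume h: "normal_form (range Uax) p = 0 \<and> normal_form (range Vax) p = 0"
  show "normal_form (mons 1) p = 0"
  proof (rule poly_mapping_eqI)
    fix m :: "nat \<times> nat"
    have "m \<in> mons 1 \<Longrightarrow> m \<in> range Uax \<or> m \<in> range Vax" by (cases m) auto
    then show "lk (normal_form (mons 1) p) m = lk 0 m"
      using h by (metis lookup_nf lookup_zero)
  qed
qed

text \<open>
  Two arrows of a matching cannot be composed.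
\<close>

lemma pairing_square:
  assumes ax: "axis xe" and pr: "pairing xe C p s" and fin: "finite (basis C)" and x: "x \<in> basis C" "z \<in> basis C"
  shows "normal_form (range xe) (mm (basis C) (del C) (del C) x z) = 0"
proof (cases "0 < s x")
  case True
  have "p x \<in> basis C" "s (p x) = - s x" using pr x by (auto simp: pairing_def)
  then have "normal_form (range xe) (del C (p x) z) = 0"
    using pr x True by (simp add: pairing_def)
  then have "normal_form (range xe) (UV_mono (xe (nat (s x))) * del C (p x) z) = 0"
    by (metis nf_mult_zero[OF axis_ideal[OF ax]] mult.commute)
  then show ?thesis using pairing_left[OF ax pr fin x(1), of "del C" z] by simp
next
  case False
  then show ?thesis using pairing_left[OF ax pr fin x(1), of "del C" z] by simp
qed

lemma pairing_chain_complex_1: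
  assumes "based_module 1 C" "pairing Uax C p s" "pairing Vax C p' s'"
  shows "chain_complex 1 C"
proof -
  have "finite (basis C)" using assms(1) by (simp add: based_module_def)
  then show ?thesis
    using assms by (auto simp: chain_complex_iff nf_1_zero_iff intro: pairing_square)
qed

definition edge_gr :: "(nat \<Rightarrow> int) \<Rightarrow> nat \<Rightarrow> int \<times> int" where
  "edge_gr a i = (if 0 < a i then (1, 1) + wt (edge a i) else - (1, 1) - wt (edge a i))"

text \<open>
  The arrows determine the gradings up to a common shift.
\<close>

lemma std_hmat_iff:
  assumes "nonzero_seq n a" "basis C = {0..2 * n}"
  shows "hmat C C (- (1, 1)) (std_del a) \<longleftrightarrow> (\<forall>x<2 * n. gr C (Suc x) = gr C x + edge_gr a (Suc x))"
proof
  assume h: "hmat C C (- (1, 1)) (std_del a)"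
  show "\<forall>x<2 * n. gr C (Suc x) = gr C x + edge_gr a (Suc x)"
  proof (intro allI impI)
    fix x assume x: "x < 2 * n"
    show "gr C (Suc x) = gr C x + edge_gr a (Suc x)"
    proof (cases "0 < a (Suc x)")
      case True
      then have "edge a (Suc x) \<in> Poly_Mapping.keys (std_del a (Suc x) x)" by (simp add: std_del_simps)
      then have "gr C x + wt (edge a (Suc x)) = gr C (Suc x) + - (1, 1)"
        using h x assms(2) unfolding hmat_def by simp
      then show ?thesis using True by (simp add: edge_gr_def algebra_simps prod_eq_iff)
    next
      case False
      then have "a (Suc x) < 0" using assms(1)[rule_format, of "Suc x"] x by simp
      then have "edge a (Suc x) \<in> Poly_Mapping.keys (std_del a x (Suc x))" by (simp add: std_del_simps)
      then have "gr C (Suc x) + wt (edge a (Suc x)) = gr C x + - (1, 1)"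
        using h x assms(2) unfolding hmat_def by simp
      then show ?thesis using False by (simp add: edge_gr_def algebra_simps prod_eq_iff)
    qed
  qed
next
  assume h: "\<forall>x<2 * n. gr C (Suc x) = gr C x + edge_gr a (Suc x)"
  show "hmat C C (- (1, 1)) (std_del a)"
    unfolding hmat_def
  proof (intro ballI)
    fix x y m assume x: "x \<in> basis C" and y: "y \<in> basis C" and m: "m \<in> Poly_Mapping.keys (std_del a x y)"
    then have "std_del a x y \<noteq> 0" by auto
    then show "gr C y + wt m = gr C x + - (1, 1)"
    proof (cases rule: std_del_nz)
      case (1 i)
      then have "m = edge a (Suc i)" using m by simp
      moreover have "gr C (Suc i) = gr C i + ((1, 1) + wt (edge a (Suc i)))"
        using h[rule_format, of i] x assms(2) 1 by (simp add: edge_gr_def)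
      ultimately show ?thesis using 1 by (auto simp: prod_eq_iff wt_fst_snd)
    next
      case (2 i)
      then have "m = edge a (Suc i)" using m by simp
      moreover have "gr C (Suc i) = gr C i + (- (1, 1) - wt (edge a (Suc i)))"
        using h[rule_format, of i] y assms(2) 2 by (simp add: edge_gr_def)
      ultimately show ?thesis using 2 by (auto simp: prod_eq_iff wt_fst_snd)
    qed
  qed
qed

lemma std_knot_like:
  assumes nz: "nonzero_seq n a" and B: "basis C = {0..2 * n}" and d: "del C = std_del a"
    and g: "\<forall>x<2 * n. gr C (Suc x) = gr C x + edge_gr a (Suc x)"
    and e: "fst (gr C 0) = 0" "snd (gr C (2 * n)) = 0"
  shows "knot_like C"
proof -
  have sb: "std_based n a C" using B d by (simp add: std_based_def std_del_1)
  have "based_module 1 C"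
    using g std_hmat_iff[OF nz B] B d by (auto simp: based_module_hmat qring_iff std_del_1)
  then have "chain_complex 1 C"
    using pairing_std_U[OF nz sb] pairing_std_V[OF nz sb] by (rule pairing_chain_complex_1)
  moreover have "correct_homology C"
    by (rule correct_homology_pairing[OF _ pairing_std_V[OF nz sb] _ _ _ _ pairing_std_U[OF nz sb], of 0 "2 * n"])
      (use B e unmatched_U[OF nz] unmatched_V[OF nz] in auto)
  ultimately show ?thesis by (simp add: knot_like_def)
qed

lemma std_knot_like_grading:
  assumes nz: "nonzero_seq n a" and B: "basis C = {0..2 * n}" and d: "del C = std_del a" and k: "knot_like C"
  shows "\<forall>x<2 * n. gr C (Suc x) = gr C x + edge_gr a (Suc x)" "fst (gr C 0) = 0" "snd (gr C (2 * n)) = 0"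
proof -
  have sb: "std_based n a C" using B d by (simp add: std_based_def std_del_1)
  show "\<forall>x<2 * n. gr C (Suc x) = gr C x + edge_gr a (Suc x)"
    using k std_hmat_iff[OF nz B] d by (auto simp: knot_like_def chain_complex_def based_module_hmat)
  obtain z h z' h' where z: "homogeneous C (0, h) z" "free_generator mons_V V_var C z"
    and z': "homogeneous C (h', 0) z'" "free_generator mons_U U_var C z'"
    using k by (auto simp: knot_like_def correct_homology_def)
  have "gr C 0 = (0, h)"
    by (rule pairing_generator_grade[OF axis_V pairing_std_V[OF nz sb], of 0 z])
      (use B z unmatched_V[OF nz] mons_V_range in auto)
  then show "fst (gr C 0) = 0" by simp
  have "gr C (2 * n) = (h', 0)"
    by (rule pairing_generator_grade[OF axis_U pairing_std_U[OF nz sb], of "2 * n" z'])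
      (use B z' unmatched_U[OF nz] mons_U_range in auto)
  then show "snd (gr C (2 * n)) = 0" by simp
qed

text \<open>
  Summing the grading differences along the complex determines the gradings up to a shift, and
  the shift is fixed by the homology, whose generators are \<open>x_0\<close> and \<open>x_2n\<close>.  So the definite
  description in the definition of the gradings has exactly one candidate.
\<close>

lemma standard_complex_knot_like:
  assumes nz: "nonzero_seq n a"
  shows "knot_like (standard_complex n a)"
proof -
  define g where "g x = (if x \<in> {0..2 * n} then (\<Sum>i\<in>{1..x}. edge_gr a i) - (0, snd (\<Sum>i\<in>{1..2 * n}. edge_gr a i)) else 0)" for x
  let ?K = "\<lambda>h. (\<forall>x. x \<notin> {0..2 * n} \<longrightarrow> h x = (0, 0)) \<and>
             knot_like \<lparr>basis = {0..2 * n}, gr = h, del = std_del a\<rparr>"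
  have "?K g"
  proof
    show "knot_like \<lparr>basis = {0..2 * n}, gr = g, del = std_del a\<rparr>"
      by (rule std_knot_like[OF nz]) (auto simp: g_def)
  qed (simp add: g_def zero_prod_def)
  moreover have "h = g" if h: "?K h" for h
  proof -
    have kl: "knot_like \<lparr>basis = {0..2 * n}, gr = h, del = std_del a\<rparr>" using h by simp
    note G = std_knot_like_grading[OF nz _ _ kl, simplified]
    have s: "h x = h 0 + (\<Sum>i\<in>{1..x}. edge_gr a i)" if "x \<le> 2 * n" for x
      using that
    proof (induction x)
      case (Suc x)
      then show ?case using G(1) by (simp add: add.assoc)
    qed simp
    have "h 0 = - (0, snd (\<Sum>i\<in>{1..2 * n}. edge_gr a i))"
      using s[of "2 * n"] G(2,3) by (simp add: prod_eq_iff)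
    moreover have "h x = g x" if "\<not> x \<le> 2 * n" for x
      using h that by (simp add: g_def zero_prod_def)
    ultimately have "h x = g x" for x
      using s[of x] by (cases "x \<le> 2 * n") (simp_all add: g_def)
    then show "h = g" by blast
  qed
  ultimately have "?K (std_gr n a)" unfolding std_gr_def by (rule theI[of ?K])
  then show ?thesis by (simp add: standard_complex_def)
qed

lemma standard_complex_basis [simp]: "basis (standard_complex n a) = {0..2 * n}"
  and standard_complex_del [simp]: "del (standard_complex n a) = std_del a"
  by (simp_all add: standard_complex_def)

lemmas standard_complex_grading =
  std_knot_like_grading[OF _ standard_complex_basis standard_complex_del standard_complex_knot_like]

lemma standard_complex_based [simp]: "std_based n a (standard_complex n a)"
  by (simp add: std_based_def std_del_1)

lemma standard_complex_hmat:
  "nonzero_seq n a \<Longrightarrow> hmat (standard_complex n a) (standard_complex n a) (- (1, 1)) (std_del a)"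
  using standard_complex_grading(1) std_hmat_iff[OF _ standard_complex_basis] by blast

text \<open>
  An arrow changes both gradings by an odd number.  So arrows of any kind only join elements of
  different parity.
\<close>

lemma standard_complex_parity:
  assumes nz: "nonzero_seq n a" and x: "x \<le> 2 * n"
  shows "even (fst (gr (standard_complex n a) x)) \<longleftrightarrow> even x" "even (snd (gr (standard_complex n a) x)) \<longleftrightarrow> even x"
proof -
  let ?C = "standard_complex n a"
  have o: "odd (fst (edge_gr a i))" "odd (snd (edge_gr a i))" for i
    by (auto simp: edge_gr_def wt_fst_snd)
  have s: "(even (fst (gr ?C y)) \<longleftrightarrow> (even y \<longleftrightarrow> even (fst (gr ?C 0)))) \<and>
      (even (snd (gr ?C y)) \<longleftrightarrow> (even y \<longleftrightarrow> even (snd (gr ?C 0))))" if "y \<le> 2 * n" for y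
    using that
  proof (induction y)
    case (Suc y)
    then show ?case using standard_complex_grading(1)[OF nz nz] o[of "Suc y"] by auto
  qed simp
  show "even (fst (gr ?C x)) \<longleftrightarrow> even x" using s[OF x] standard_complex_grading(2)[OF nz nz] by simp
  show "even (snd (gr ?C x)) \<longleftrightarrow> even x" using s[OF x] s[of "2 * n"] standard_complex_grading(3)[OF nz nz] by simp
qed

section \<open>Interchanging the variables\<close>

lemma lookup_swap [simp]: "lk (swap_UV p) m = lk p (prod.swap m)"
  unfolding swap_UV_def by (subst map_key.rep_eq) auto

lemma swap_UV_swap [simp]: "swap_UV (swap_UV p) = p"
  by (rule poly_mapping_eqI) simp

lemma swap_add: "swap_UV (p + q) = swap_UV p + swap_UV q"
  by (rule poly_mapping_eqI) (simp add: lookup_add)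

lemma swap_0 [simp]: "swap_UV 0 = 0"
  by (rule poly_mapping_eqI) simp

lemma swap_eq_iff: "swap_UV p = q \<longleftrightarrow> p = swap_UV q"
  by (metis swap_UV_swap)

lemma swap_sum: "swap_UV (sum f A) = (\<Sum>x\<in>A. swap_UV (f x))"
  by (induction A rule: infinite_finite_induct) (auto simp: swap_add)

lemma swap_plus: "prod.swap (m + k) = prod.swap m + prod.swap k"
  by (cases m; cases k) simp

lemma swap_mult: "swap_UV (p * q) = swap_UV p * swap_UV q"
proof (rule poly_mapping_eqI)
  fix m
  have inner: "(\<Sum>j. (lk q j when prod.swap m = l + j)) = (\<Sum>j. (lk (swap_UV q) j when m = prod.swap l + j))" for l
  proof (rule Sum_any.reindex_cong[where l=prod.swap])
    have "prod.swap m = l + prod.swap j \<longleftrightarrow> m = prod.swap l + j" for j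
      by (cases m; cases l; cases j) auto
    then show "(\<lambda>j. (lk q j when prod.swap m = l + j)) \<circ> prod.swap
        = (\<lambda>j. (lk (swap_UV q) j when m = prod.swap l + j))"
      by (auto simp: fun_eq_iff when_def)
  qed (auto simp: inj_def surj_def)
  have "(\<Sum>l. lk p l * (\<Sum>j. (lk q j when prod.swap m = l + j)))
      = (\<Sum>l. lk (swap_UV p) l * (\<Sum>j. (lk (swap_UV q) j when m = l + j)))"
    unfolding inner
    by (rule Sum_any.reindex_cong[where l=prod.swap]) (auto simp: fun_eq_iff inj_def surj_def)
  then show "lk (swap_UV (p * q)) m = lk (swap_UV p * swap_UV q) m"
    by (simp add: lookup_mult)
qed

lemma swap_mono: "swap_UV (UV_mono m) = UV_mono (prod.swap m)"
  by (rule poly_mapping_eqI) (auto simp: lookup_mono)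

lemma conj_simps [simp]:
  "basis (conj_complex C) = basis C"
  "gr (conj_complex C) = (\<lambda>x. prod.swap (gr C x))"
  "del (conj_complex C) = (\<lambda>x y. swap_UV (del C x y))"
  by (simp_all add: conj_complex_def)

lemma conj_conj [simp]: "conj_complex (conj_complex C) = C"
  by (simp add: conj_complex_def)

lemma nf_swap: "normal_form S (swap_UV p) = swap_UV (normal_form (prod.swap ` S) p)"
proof (rule poly_mapping_eqI)
  fix m :: "nat \<times> nat"
  have "prod.swap m \<in> prod.swap ` S \<longleftrightarrow> m \<in> S" by (metis image_iff swap_swap)
  then show "lk (normal_form S (swap_UV p)) m = lk (swap_UV (normal_form (prod.swap ` S) p)) m"
    by simp
qed

lemma swap_mons [simp]: "prod.swap ` mons i = mons i"
  by (auto simp: mons_def min.commute image_iff)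

lemma swap_range [simp]: "prod.swap ` range Uax = range Vax" "prod.swap ` range Vax = range Uax"
  by auto

lemma swap_wt: "prod.swap (wt m) = wt (prod.swap m)"
  by (cases m) (simp add: wt.simps)

lemma keys_swap: "m \<in> Poly_Mapping.keys (swap_UV p) \<longleftrightarrow> prod.swap m \<in> Poly_Mapping.keys p"
  by (simp add: in_keys_iff)

lemma hmat_conj:
  assumes "hmat C D k F"
  shows "hmat (conj_complex C) (conj_complex D) (prod.swap k) (\<lambda>x y. swap_UV (F x y))"
proof -
  have "prod.swap (gr D y) + wt m = prod.swap (gr C x) + prod.swap k"
    if "gr D y + wt (prod.swap m) = gr C x + k" for x y m
    using arg_cong[OF that, of prod.swap] by (simp add: swap_plus swap_wt)
  then show ?thesis using assms unfolding hmat_def by (auto simp: keys_swap simp del: prod.swap_def)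
qed

lemma swap_mm: "mm B (\<lambda>x y. swap_UV (F x y)) (\<lambda>x y. swap_UV (G x y)) x z = swap_UV (mm B F G x z)"
  by (simp add: mm_def swap_sum swap_mult)

lemma based_module_conj: "based_module i C \<Longrightarrow> based_module i (conj_complex C)"
  using hmat_conj[of C C "- (1, 1)" "del C"]
  by (auto simp: based_module_hmat qring_iff nf_swap)

lemma chain_complex_conj: "1 \<le> i \<Longrightarrow> chain_complex i C \<Longrightarrow> chain_complex i (conj_complex C)"
  by (auto simp: chain_complex_iff based_module_conj swap_mm nf_swap)

lemma pairing_conj:
  "pairing Uax C p s \<Longrightarrow> pairing Vax (conj_complex C) p s"
  "pairing Vax C p s \<Longrightarrow> pairing Uax (conj_complex C) p s"
  by (auto simp: pairing_def nf_swap swap_mono)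


section \<open>One step of the Procedure\<close>

text \<open>
  A coefficient of \<open>\<partial>\<^sup>2\<close> at a monomial with \<open>V\<close>-exponent 1 comes from a horizontal arrow and
  another arrow; as the horizontal arrows form a matching, at most two compositions contribute.
\<close>

lemma lookup_mult_V1:
  "lk (p * q) (c, 1) = lk (normal_form (range Uax) p * q) (c, 1) + lk (p * normal_form (range Uax) q) (c, 1)"
proof -
  define p0 p1 q0 q1 where "p0 = normal_form (range Uax) p" and "p1 = p + p0"
    and "q0 = normal_form (range Uax) q" and "q1 = q + q0"
  have p: "p = p0 + p1" and q: "q = q0 + q1"
    unfolding p1_def q1_def by (simp_all only: add.left_commute[of p0 p p0] add.left_commute[of q0 q q0] FUV_add_self add_0_right)
  have k0: "snd m = 0" if "m \<in> Poly_Mapping.keys (normal_form (range Uax) r)" for m r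
    using that by (auto simp: in_keys_iff split: if_splits)
  have k1: "1 \<le> snd m" if "m \<in> Poly_Mapping.keys (r + normal_form (range Uax) r)" for m r
    using that by (cases m; cases "snd m") (auto simp: in_keys_iff lookup_add simp del: bit_not_zero_iff)
  have 0: "lk (p0 * q0) (c, 1) = 0"
  proof -
    have "(c, 1) \<notin> Poly_Mapping.keys (p0 * q0)"
    proof
      assume "(c, 1) \<in> Poly_Mapping.keys (p0 * q0)"
      then obtain a b where "(c, 1) = a + b" "a \<in> Poly_Mapping.keys p0" "b \<in> Poly_Mapping.keys q0"
        using keys_mult[of p0 q0] by auto
      then show False using k0[of a p] k0[of b q] by (cases a; cases b) (auto simp: p0_def q0_def)
    qed
    then show ?thesis by (simp add: in_keys_iff)
  qed
  have 1: "lk (p1 * q1) (c, 1) = 0"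
  proof -
    have "(c, 1) \<notin> Poly_Mapping.keys (p1 * q1)"
    proof
      assume "(c, 1) \<in> Poly_Mapping.keys (p1 * q1)"
      then obtain a b where "(c, 1) = a + b" "a \<in> Poly_Mapping.keys p1" "b \<in> Poly_Mapping.keys q1"
        using keys_mult[of p1 q1] by auto
      then show False using k1[of a p] k1[of b q] by (cases a; cases b) (auto simp: p1_def q1_def p0_def q0_def)
    qed
    then show ?thesis by (simp add: in_keys_iff)
  qed
  have "lk (p * q) (c, 1) = lk (p0 * q) (c, 1) + lk (p1 * q0) (c, 1) + lk (p1 * q1) (c, 1)"
  proof -
    have "p * q = p0 * q + (p1 * q0 + p1 * q1)"
      by (simp only: p distrib_right flip: distrib_left q)
    then show ?thesis by (simp only: lookup_add add.assoc)
  qed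
  also have "\<dots> = lk (p0 * q) (c, 1) + lk (p * q0) (c, 1)"
  proof -
    have "p * q0 = p0 * q0 + p1 * q0" by (simp only: p distrib_right)
    then show ?thesis using 0 1 by (simp only: lookup_add add_0_left add_0_right)
  qed
  finally show ?thesis unfolding p0_def q0_def .
qed

lemma lookup_U_mult:
  "lk (UV_mono (l, 0) * q) (c, d) = (if l \<le> c then lk q (c - l, d) else 0)"
proof (cases "l \<le> c")
  case True
  then show ?thesis using lookup_mono_mult[of "(l, 0)" q "(c - l, d)"] by simp
next
  case False
  have "(c, d) \<notin> Poly_Mapping.keys (UV_mono (l, 0) * q)"
    using False keys_mono_mult[of "(c, d)" "(l, 0)" q] by auto
  then show ?thesis using False by (simp add: in_keys_iff)
qed

text \<open>
  The hypotheses used for defects at \<open>U^aV\<close>.  They hold for the conjugate of a lift of a standard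
  complex as well, which takes care of the defects at \<open>UV^b\<close>.
\<close>

definition lift2 :: "'b based \<Rightarrow> ('b \<Rightarrow> 'b) \<Rightarrow> ('b \<Rightarrow> int) \<Rightarrow> bool" where
  "lift2 C p s \<longleftrightarrow> based_module 2 C \<and> pairing Uax C p s"

lemma sq_coeff_mm:
  assumes "based_module 2 C" "x \<in> basis C" "y \<in> basis C"
  shows "sq_coeff C x y c d = (if (c, d) \<in> mons 2 then lk (mm (basis C) (del C) (del C) x y) (c, d) else 0)"
proof -
  have fin: "finite (basis C)" using assms by (simp add: based_module_def)
  have "bd (mons 2) C (bd (mons 2) C (gen x)) y = normal_form (mons 2) (mm (basis C) (del C) (del C) x y)"
    unfolding bd_matmap matmap_comp[OF order_ideal_2 fin fin] by (rule matmap_gen[OF fin assms(2,3)])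
  then show ?thesis by (simp add: sq_coeff_def)
qed

text \<open>
  The first summand is the composition that starts with the horizontal arrow out of \<open>x\<close>, the second
  one the composition that ends with the horizontal arrow into \<open>y\<close>.
\<close>

lemma sq_coeff_V1:
  assumes C: "lift2 C p s" and x: "x \<in> basis C" and y: "y \<in> basis C"
  shows "sq_coeff C x y c 1 =
      (if 0 < s x \<and> nat (s x) \<le> c then lk (del C (p x) y) (c - nat (s x), 1) else 0) +
      (if s y < 0 \<and> nat (- s y) \<le> c then lk (del C x (p y)) (c - nat (- s y), 1) else 0)"
proof -
  have fin: "finite (basis C)" and pr: "pairing Uax C p s"
    using C by (auto simp: lift2_def based_module_def)
  have px: "p x \<in> basis C" "p y \<in> basis C" using pr x y by (auto simp: pairing_def)
  have r: "normal_form (range Uax) (del C u y) = (if u = p y then (if s y < 0 then UV_mono (nat (- s y), 0) else 0) else 0)"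
    if u: "u \<in> basis C" for u
  proof -
    have "0 < s u \<and> y = p u \<longleftrightarrow> u = p y \<and> s y < 0"
      using pr y u unfolding pairing_def by (metis minus_minus neg_less_0_iff_less)
    then show ?thesis using pr y u by (auto simp: pairing_def)
  qed
  have l: "normal_form (range Uax) (del C x u) = (if u = p x then (if 0 < s x then UV_mono (nat (s x), 0) else 0) else 0)"
    if u: "u \<in> basis C" for u
    using pr x u by (auto simp: pairing_def)
  have "sq_coeff C x y c 1 = (\<Sum>u\<in>basis C. lk (del C x u * del C u y) (c, 1))"
    using sq_coeff_mm[of C x y c 1] C x y by (simp add: mm_def lookup_sum lift2_def)
  also have "\<dots> = (\<Sum>u\<in>basis C. lk (normal_form (range Uax) (del C x u) * del C u y) (c, 1))
      + (\<Sum>u\<in>basis C. lk (del C x u * normal_form (range Uax) (del C u y)) (c, 1))"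
    by (subst lookup_mult_V1) (rule sum.distrib)
  also have "(\<Sum>u\<in>basis C. lk (normal_form (range Uax) (del C x u) * del C u y) (c, 1))
      = (\<Sum>u\<in>basis C. if u = p x then lk ((if 0 < s x then UV_mono (nat (s x), 0) else 0) * del C (p x) y) (c, 1) else 0)"
    by (rule sum.cong) (auto simp: l)
  also have "\<dots> = (if 0 < s x \<and> nat (s x) \<le> c then lk (del C (p x) y) (c - nat (s x), 1) else 0)"
    using px fin by (simp add: lookup_U_mult)
  also have "(\<Sum>u\<in>basis C. lk (del C x u * normal_form (range Uax) (del C u y)) (c, 1))
      = (\<Sum>u\<in>basis C. if u = p y then lk (del C x (p y) * (if s y < 0 then UV_mono (nat (- s y), 0) else 0)) (c, 1) else 0)"
    by (rule sum.cong) (auto simp: r)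
  also have "\<dots> = (if s y < 0 \<and> nat (- s y) \<le> c then lk (del C x (p y)) (c - nat (- s y), 1) else 0)"
    using px fin by (simp add: mult.commute[of "del C x (p y)"] lookup_U_mult)
  finally show ?thesis .
qed

lemma horizontal_out:
  assumes "lift2 C p s" "arrow C x u l 0"
  shows "u = p x" "0 < s x" "l = nat (s x)"
proof -
  have x: "x \<in> basis C" "u \<in> basis C" and l: "lk (normal_form (range Uax) (del C x u)) (l, 0) = 1"
    using assms by (auto simp: arrow_def)
  have "normal_form (range Uax) (del C x u) = (if 0 < s x \<and> u = p x then UV_mono (Uax (nat (s x))) else 0)"
    using assms(1) x unfolding lift2_def pairing_def by blast
  then have "lk (if 0 < s x \<and> u = p x then UV_mono (Uax (nat (s x))) else 0) (l, 0) = 1"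
    using l by (simp only:)
  then show "u = p x" "0 < s x" "l = nat (s x)"
    by (cases "0 < s x \<and> u = p x"; simp add: lookup_mono split: if_splits)+
qed

lemma horizontal_in:
  assumes "lift2 C p s" "arrow C z y d 0"
  shows "z = p y" "s y < 0" "d = nat (- s y)"
proof -
  note h = horizontal_out[OF assms]
  have "z \<in> basis C" using assms(2) by (simp add: arrow_def)
  then have "p (p z) = z" "s (p z) = - s z" using assms(1) by (simp_all add: lift2_def pairing_def)
  then show "z = p y" "s y < 0" "d = nat (- s y)" using h by simp_all
qed

lemma horizontal_arrow:
  assumes "lift2 C p s" "x \<in> basis C"
  shows "0 < s x \<Longrightarrow> arrow C x (p x) (nat (s x)) 0" "s x < 0 \<Longrightarrow> arrow C (p x) x (nat (- s x)) 0"
proof -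
  have *: "arrow C x (p x) (nat (s x)) 0" if "0 < s x" "x \<in> basis C" for x
  proof -
    have "lk (normal_form (range Uax) (del C x (p x))) (nat (s x), 0) = 1" "p x \<in> basis C"
      using assms(1) that by (auto simp: lift2_def pairing_def lookup_mono)
    then show ?thesis using that by (auto simp: arrow_def split: if_splits)
  qed
  show "0 < s x \<Longrightarrow> arrow C x (p x) (nat (s x)) 0" using * assms(2) by blast
  show "s x < 0 \<Longrightarrow> arrow C (p x) x (nat (- s x)) 0"
    using *[of "p x"] assms by (auto simp: lift2_def pairing_def)
qed

text \<open>
  \<open>D\<close> is a complex over \<open>R_2\<close> with the same reduction as \<open>C\<close> and with all arrows of \<open>C\<close>.  The point
  of the Procedure is that the property of \<open>C\<close> to lie below \<open>D\<close> is preserved by each step.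
\<close>

definition above :: "'b based \<Rightarrow> 'b based \<Rightarrow> bool" where
  "above C D \<longleftrightarrow> chain_complex 2 D \<and> basis D = basis C \<and>
     (\<forall>x\<in>basis C. \<forall>y\<in>basis C. normal_form (mons 1) (del D x y) = normal_form (mons 1) (del C x y) \<and>
        (\<forall>m. lk (del C x y) m = 1 \<longrightarrow> lk (del D x y) m = 1))"

lemma above_conj: "above C D \<Longrightarrow> above (conj_complex C) (conj_complex D)"
  by (auto simp: above_def chain_complex_conj nf_swap)

lemma above_lift2:
  assumes "lift2 C p s" "above C D"
  shows "lift2 D p s"
proof -
  have "normal_form (range Uax) (del D x y) = normal_form (range Uax) (del C x y)"
    if "x \<in> basis C" "y \<in> basis C" for x y
  proof -
    have "normal_form (mons 1) (del D x y) = normal_form (mons 1) (del C x y)"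
      using assms(2) that by (simp add: above_def)
    then show ?thesis
      using nf_subset[OF axis_in_1[OF axis_U], of "del D x y"] nf_subset[OF axis_in_1[OF axis_U], of "del C x y"] by simp
  qed
  then show ?thesis
    using assms by (auto simp: lift2_def pairing_def above_def chain_complex_def)
qed

lemma chain_complex_sq_coeff:
  assumes "chain_complex 2 D" "x \<in> basis D" "y \<in> basis D"
  shows "sq_coeff D x y c d = 0"
proof -
  have b: "based_module 2 D" using assms by (simp add: chain_complex_def)
  have "normal_form (mons 2) (mm (basis D) (del D) (del D) x y) = 0"
    using assms by (simp add: chain_complex_iff)
  then have "(c, d) \<in> mons 2 \<Longrightarrow> lk (mm (basis D) (del D) (del D) x y) (c, d) = 0"
    by (metis lookup_nf lookup_zero)
  then show ?thesis using sq_coeff_mm[OF b assms(2,3)] by simp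
qed

text \<open>
  The composition along \<open>u\<close> is present in \<open>C\<close>, hence in \<open>D\<close>, where the coefficient of \<open>\<partial>\<^sup>2\<close> vanishes;
  so the second composition must be present in \<open>D\<close>.  Its first arrow has coefficient \<open>U^(c-d)V\<close>, if
  \<open>d\<close> is the length of the horizontal arrow into \<open>y\<close>.  It is not vertical, as otherwise it would be
  present in \<open>C\<close> and there would be no defect; so \<open>d < c\<close>.
\<close>

lemma forced_a:
  assumes C: "lift2 C p s" and df: "defect C x y c 1"
    and u: "arrow C x u l 0" "arrow C u y c' 1" "l + c' = c" and D: "above C D"
  shows "s y < 0 \<and> nat (- s y) < c \<and> lk (del D x (p y)) (c - nat (- s y), 1) = 1"
proof -
  have x: "x \<in> basis C" and y: "y \<in> basis C" and c: "sq_coeff C x y c 1 = 1"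
    using df by (auto simp: defect_def)
  note h = horizontal_out[OF C u(1)]
  have c': "c - nat (s x) = c'" "nat (s x) \<le> c" using h u(3) by auto
  have uy: "lk (del C (p x) y) (c', 1) = 1" "p x \<in> basis C" using u(2) h by (auto simp: arrow_def)
  have uyD: "lk (del D (p x) y) (c', 1) = 1" using D y uy by (auto simp: above_def)
  have bD: "basis D = basis C" using D by (simp add: above_def)
  have "sq_coeff D x y c 1 = 0"
    using D x y by (intro chain_complex_sq_coeff) (auto simp: above_def)
  then have D1: "s y < 0 \<and> nat (- s y) \<le> c \<and> lk (del D x (p y)) (c - nat (- s y), 1) = 1"
    using sq_coeff_V1[OF above_lift2[OF C D], of x y c] x y h c' uyD bD by (auto split: if_splits)
  have "nat (- s y) \<noteq> c"
  proof
    assume e: "nat (- s y) = c"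
    have "p y \<in> basis C" using C y by (auto simp: lift2_def pairing_def)
    then have "normal_form (mons 1) (del D x (p y)) = normal_form (mons 1) (del C x (p y))"
      using D x by (auto simp: above_def)
    then have "lk (del C x (p y)) (0, 1) = 1"
      using D1 e by (metis diff_self_eq_0 in_mons_1 lookup_nf)
    then show False using sq_coeff_V1[OF C x y, of c] c h c' uy D1 e by simp
  qed
  then show ?thesis using D1 by auto
qed

text \<open>
  The mirror image of \<open>forced_a\<close>, with the horizontal arrow out of \<open>x\<close> in the second composition.
\<close>

lemma forced_b:
  assumes C: "lift2 C p s" and df: "defect C x y c 1"
    and u: "arrow C x u c' 1" "arrow C u y l 0" "l + c' = c" and D: "above C D"
  shows "0 < s x \<and> nat (s x) < c \<and> lk (del D (p x) y) (c - nat (s x), 1) = 1"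
proof -
  have x: "x \<in> basis C" and y: "y \<in> basis C" and c: "sq_coeff C x y c 1 = 1"
    using df by (auto simp: defect_def)
  note h = horizontal_in[OF C u(2)]
  have c': "c - nat (- s y) = c'" "nat (- s y) \<le> c" using h u(3) by auto
  have uy: "lk (del C x (p y)) (c', 1) = 1" "p y \<in> basis C" using u(1) h by (auto simp: arrow_def)
  have uyD: "lk (del D x (p y)) (c', 1) = 1" using D x uy by (auto simp: above_def)
  have bD: "basis D = basis C" using D by (simp add: above_def)
  have "sq_coeff D x y c 1 = 0"
    using D x y by (intro chain_complex_sq_coeff) (auto simp: above_def)
  then have D1: "0 < s x \<and> nat (s x) \<le> c \<and> lk (del D (p x) y) (c - nat (s x), 1) = 1"
    using sq_coeff_V1[OF above_lift2[OF C D], of x y c] x y h c' uyD bD by (auto split: if_splits)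
  have "nat (s x) \<noteq> c"
  proof
    assume e: "nat (s x) = c"
    have "p x \<in> basis C" using C x by (auto simp: lift2_def pairing_def)
    then have "normal_form (mons 1) (del D (p x) y) = normal_form (mons 1) (del C (p x) y)"
      using D y by (auto simp: above_def)
    then have "lk (del C (p x) y) (0, 1) = 1"
      using D1 e by (metis diff_self_eq_0 in_mons_1 lookup_nf)
    then show False using sq_coeff_V1[OF C x y, of c] c h c' uy D1 e by simp
  qed
  then show ?thesis using D1 by auto
qed

lemma fail_b1_not_above:
  assumes "lift2 C p s" "fail_b1 C"
  shows "\<not> above C D"
  using assms(2)
proof cases
  case (fail_b1_a x y c u l c')
  have y: "y \<in> basis C" using fail_b1_a by (simp add: defect_def)
  show ?thesis
    using forced_a[OF assms(1) fail_b1_a(1-4)] fail_b1_a(5) horizontal_arrow(2)[OF assms(1) y] by blast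
next
  case (fail_b1_b x y c u c' l)
  have x: "x \<in> basis C" using fail_b1_b by (simp add: defect_def)
  show ?thesis
    using forced_b[OF assms(1) fail_b1_b(1-4)] fail_b1_b(5) horizontal_arrow(1)[OF assms(1) x] by blast
qed

lemma arrow_grade:
  assumes "based_module i C" "arrow C x y c d"
  shows "gr C y + wt (c, d) = gr C x + - (1, 1)"
proof -
  have "(c, d) \<in> Poly_Mapping.keys (del C x y)" using assms(2) by (simp add: arrow_def in_keys_iff)
  then show ?thesis using assms unfolding based_module_hmat hmat_def arrow_def by blast
qed

text \<open>
  What the rest of the argument needs to know about a step that adds an arrow: it is new, diagonal
  and homogeneous, and all complexes above have it.
\<close>

definition good_addition :: "'b based \<Rightarrow> 'b based \<Rightarrow> 'b \<Rightarrow> 'b \<Rightarrow> nat \<Rightarrow> nat \<Rightarrow> bool" where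
  "good_addition C C' x y c d \<longleftrightarrow> C' = add_arrow C x y c d \<and> x \<in> basis C \<and> y \<in> basis C \<and>
     lk (del C x y) (c, d) = 0 \<and> (c, d) \<in> mons 2 \<and> (c, d) \<notin> mons 1 \<and>
     gr C y + wt (c, d) = gr C x + - (1, 1) \<and> (\<forall>D. above C D \<longrightarrow> lk (del D x y) (c, d) = 1)"

lemma add_b1_good:
  assumes C: "lift2 C p s" and "add_b1 C C'"
  shows "\<exists>x y c. good_addition C C' x y c 1"
  using assms(2)
proof cases
  case (add_b1_a x y c u l c' z d)
  have x: "x \<in> basis C" and y: "y \<in> basis C" and sq: "sq_coeff C x y c 1 = 1"
    using add_b1_a by (auto simp: defect_def)
  have b: "based_module 2 C" using C by (simp add: lift2_def)
  note h = horizontal_out[OF C add_b1_a(3)] and h' = horizontal_in[OF C add_b1_a(6)]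
  have z: "z \<in> basis C" using add_b1_a(6) by (simp add: arrow_def)
  have "c - nat (s x) = c'" "nat (s x) \<le> c" "lk (del C (p x) y) (c', 1) = 1"
    using h add_b1_a by (auto simp: arrow_def)
  then have "lk (del C x z) (c - d, 1) = 0"
    using sq_coeff_V1[OF C x y, of c] sq h h' add_b1_a(7) by simp
  moreover have "gr C z + wt (c - d, 1) = gr C x + - (1, 1)"
    using arrow_grade[OF b add_b1_a(3)] arrow_grade[OF b add_b1_a(4)] arrow_grade[OF b add_b1_a(6)] add_b1_a(5,7)
    by (auto simp: wt_fst_snd prod_eq_iff)
  moreover have "\<forall>D. above C D \<longrightarrow> lk (del D x z) (c - d, 1) = 1"
    using forced_a[OF C add_b1_a(2-5)] h' by simp
  ultimately have "good_addition C C' x z (c - d) 1"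
    using add_b1_a x z by (auto simp: good_addition_def)
  then show ?thesis by blast
next
  case (add_b1_b x y c u c' l z d)
  have x: "x \<in> basis C" and y: "y \<in> basis C" and sq: "sq_coeff C x y c 1 = 1"
    using add_b1_b by (auto simp: defect_def)
  have b: "based_module 2 C" using C by (simp add: lift2_def)
  note h = horizontal_in[OF C add_b1_b(4)] and h' = horizontal_out[OF C add_b1_b(6)]
  have z: "z \<in> basis C" using add_b1_b(6) by (simp add: arrow_def)
  have "c - nat (- s y) = c'" "nat (- s y) \<le> c" "lk (del C x (p y)) (c', 1) = 1"
    using h add_b1_b by (auto simp: arrow_def)
  then have "lk (del C z y) (c - d, 1) = 0"
    using sq_coeff_V1[OF C x y, of c] sq h h' add_b1_b(7) by simp
  moreover have "gr C y + wt (c - d, 1) = gr C z + - (1, 1)"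
    using arrow_grade[OF b add_b1_b(3)] arrow_grade[OF b add_b1_b(4)] arrow_grade[OF b add_b1_b(6)] add_b1_b(5,7)
    by (auto simp: wt_fst_snd prod_eq_iff)
  moreover have "\<forall>D. above C D \<longrightarrow> lk (del D z y) (c - d, 1) = 1"
    using forced_b[OF C add_b1_b(2-5)] h' by simp
  ultimately have "good_addition C C' z y (c - d) 1"
    using add_b1_b y z by (auto simp: good_addition_def)
  then show ?thesis by blast
qed

lemma defect_b1_step:
  assumes C: "lift2 C p s" and df: "defect C x y c 1"
  shows "fail_b1 C \<or> (\<exists>C'. add_b1 C C')"
proof -
  have x: "x \<in> basis C" and y: "y \<in> basis C" and sq: "sq_coeff C x y c 1 = 1"
    using df by (auto simp: defect_def)
  consider "0 < s x" "nat (s x) \<le> c" "lk (del C (p x) y) (c - nat (s x), 1) = 1"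
    | "s y < 0" "nat (- s y) \<le> c" "lk (del C x (p y)) (c - nat (- s y), 1) = 1"
    using sq sq_coeff_V1[OF C x y, of c] by (auto split: if_splits)
  then show ?thesis
  proof cases
    case 1
    have u: "arrow C x (p x) (nat (s x)) 0" "arrow C (p x) y (c - nat (s x)) 1" "nat (s x) + (c - nat (s x)) = c"
      using 1 y horizontal_arrow(1)[OF C x 1(1)] by (auto simp: arrow_def)
    show ?thesis using fail_b1_a[OF df u] add_b1_a[OF df u] by blast
  next
    case 2
    have u: "arrow C x (p y) (c - nat (- s y)) 1" "arrow C (p y) y (nat (- s y)) 0" "nat (- s y) + (c - nat (- s y)) = c"
      using 2 x horizontal_arrow(2)[OF C y 2(1)] by (auto simp: arrow_def)
    show ?thesis using fail_b1_b[OF df u] add_b1_b[OF df u] by blast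
  qed
qed

section \<open>Correctness and termination of the Procedure\<close>

definition std_lift :: "nat \<Rightarrow> (nat \<Rightarrow> int) \<Rightarrow> nat based \<Rightarrow> bool" where
  "std_lift n a C \<longleftrightarrow> based_module 2 C \<and> std_based n a C \<and>
     (\<forall>x\<le>2 * n. gr C x = gr (standard_complex n a) x)"

lemma std_lift_lift2:
  assumes "nonzero_seq n a" "std_lift n a C"
  shows "lift2 C (std_pU n) (std_sU n a)" "lift2 (conj_complex C) std_pV (std_sV a)"
  using assms by (auto simp: lift2_def std_lift_def based_module_conj
      intro: pairing_conj pairing_std_U pairing_std_V)

lemma standard_complex_std_lift: "nonzero_seq n a \<Longrightarrow> std_lift n a (standard_complex n a)"
proof -
  assume nz: "nonzero_seq n a"
  have "std_del a x y \<in> qring (mons 2)" for x y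
    using std_del_1[of a x y] mons_1_2 by (metis nf_qring qring_mono)
  then show ?thesis
    using standard_complex_hmat[OF nz] by (simp add: std_lift_def based_module_hmat)
qed

lemma partial_realization_std_lift:
  assumes "partial_realization D (standard_complex n a)"
  shows "std_lift n a D" "above (standard_complex n a) D"
proof -
  have r: "chain_complex 2 D" "basis D = {0..2 * n}" "\<forall>x\<le>2 * n. gr D x = gr (standard_complex n a) x"
    "\<forall>x\<le>2 * n. \<forall>y\<le>2 * n. normal_form (mons 1) (del D x y) = std_del a x y"
    using assms by (auto simp: partial_realization_def is_reduction_def)
  then show "std_lift n a D"
    by (auto simp: std_lift_def std_based_def chain_complex_def)
  show "above (standard_complex n a) D"
    unfolding above_def
  proof (intro conjI ballI allI impI)
    fix x y m assume x: "x \<in> basis (standard_complex n a)" "y \<in> basis (standard_complex n a)"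
    then have e: "normal_form (mons 1) (del D x y) = std_del a x y" using r by simp
    then show "normal_form (mons 1) (del D x y) = normal_form (mons 1) (del (standard_complex n a) x y)"
      by (simp add: std_del_1)
    assume "lk (del (standard_complex n a) x y) m = 1"
    then show "lk (del D x y) m = 1" unfolding standard_complex_del e[symmetric] by (simp split: if_splits)
  qed (use r in auto)
qed

text \<open>
  The coefficients of \<open>\<partial>\<^sup>2\<close> at powers of \<open>U\<close> or \<open>V\<close> vanish since these arrows form matchings; over \<open>R_2\<close>
  all others are coefficients that could be defects.
\<close>

lemma no_defect_chain_complex:
  assumes nz: "nonzero_seq n a" and C: "std_lift n a C" and nd: "\<not> (\<exists>x y c d. defect C x y c d)"
  shows "partial_realization C (standard_complex n a)"
proof -
  have b: "based_module 2 C" and sb: "std_based n a C" using C by (auto simp: std_lift_def)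
  have fin: "finite (basis C)" using b by (simp add: based_module_def)
  have "normal_form (mons 2) (mm (basis C) (del C) (del C) x z) = 0" if x: "x \<in> basis C" "z \<in> basis C" for x z
  proof (rule poly_mapping_eqI)
    fix m :: "nat \<times> nat"
    let ?p = "mm (basis C) (del C) (del C) x z"
    have 1: "normal_form (mons 1) ?p = 0"
      using pairing_square[OF axis_U pairing_std_U[OF nz sb] fin x]
        pairing_square[OF axis_V pairing_std_V[OF nz sb] fin x] by (simp add: nf_1_zero_iff)
    obtain c d where m: "m = (c, d)" by (cases m)
    have "lk ?p m = 0" if "m \<in> mons 2"
    proof (cases "m \<in> mons 1")
      case True
      then show ?thesis using 1 by (metis lookup_nf lookup_zero)
    next
      case False
      then have "1 \<in> {c, d}" "1 \<le> c" "1 \<le> d" using that m by auto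
      then have "sq_coeff C x z c d = 0" using nd x by (auto simp: defect_def)
      then show ?thesis using sq_coeff_mm[OF b x, of c d] that m by simp
    qed
    then show "lk (normal_form (mons 2) ?p) m = lk 0 m" by simp
  qed
  then have "chain_complex 2 C" using b by (simp add: chain_complex_iff)
  then show ?thesis
    using C by (auto simp: partial_realization_def is_reduction_def std_lift_def std_based_def)
qed

lemma above_trans_add:
  assumes "above C D" "good_addition C C' x y c d"
  shows "above C' D"
proof -
  have e: "C' = add_arrow C x y c d" and g: "x \<in> basis C" "y \<in> basis C" "lk (del D x y) (c, d) = 1" "(c, d) \<notin> mons 1"
    using assms by (auto simp: good_addition_def)
  have d: "del C' u v = (if u = x \<and> v = y then del C u v + UV_mono (c, d) else del C u v)" for u v
    by (simp add: e add_arrow_def)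
  show ?thesis
    using assms(1) g by (auto simp: above_def d nf_add nf_mono lookup_add lookup_mono e add_arrow_def split: if_splits)
qed

lemma std_lift_add:
  assumes C: "std_lift n a C" and g: "good_addition C C' x y c d"
  shows "std_lift n a C'"
proof -
  have e: "C' = add_arrow C x y c d" and g: "(c, d) \<in> mons 2" "(c, d) \<notin> mons 1"
    "gr C y + wt (c, d) = gr C x + - (1, 1)"
    using g by (auto simp: good_addition_def)
  have b: "basis C' = basis C" "gr C' = gr C" by (simp_all add: e add_arrow_def)
  have d: "del C' u v = (if u = x \<and> v = y then del C u v + UV_mono (c, d) else del C u v)" for u v
    by (simp add: e add_arrow_def)
  have "hmat C' C' (- (1, 1)) (del C')"
  proof -
    have "gr C v + wt m = gr C u + - (1, 1)"
      if "u \<in> basis C" "v \<in> basis C" "m \<in> Poly_Mapping.keys (del C' u v)" for u v m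
    proof (cases "u = x \<and> v = y \<and> m = (c, d)")
      case False
      then have "m \<in> Poly_Mapping.keys (del C u v)"
        using that(3) by (auto simp: in_keys_iff d lookup_add lookup_mono split: if_splits)
      then show ?thesis
        using C that unfolding std_lift_def based_module_hmat hmat_def by blast
    qed (use g in simp)
    then show ?thesis by (simp add: hmat_def b)
  qed
  then show ?thesis
    using C g by (auto simp: std_lift_def based_module_hmat std_based_def b d nf_add nf_mono qring_iff)
qed

lemma good_addition_conj:
  assumes "good_addition (conj_complex C) (conj_complex C') x y c d"
  shows "good_addition C C' x y d c"
proof -
  have g: "conj_complex C' = add_arrow (conj_complex C) x y c d"
    "lk (del (conj_complex C) x y) (c, d) = 0" "(c, d) \<in> mons 2" "(c, d) \<notin> mons 1"
    "prod.swap (gr C y) + wt (c, d) = prod.swap (gr C x) + - (1, 1)"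
    "\<And>D. above (conj_complex C) D \<Longrightarrow> lk (del D x y) (c, d) = 1"
    and xy: "x \<in> basis C" "y \<in> basis C"
    using assms by (auto simp: good_addition_def)
  have "C' = conj_complex (add_arrow (conj_complex C) x y c d)"
    using g(1) by (metis conj_conj)
  also have "\<dots> = add_arrow C x y d c"
    by (auto simp: conj_complex_def add_arrow_def fun_eq_iff swap_add swap_mono)
  finally have "C' = add_arrow C x y d c" .
  moreover have "gr C y + wt (d, c) = gr C x + - (1, 1)"
    using arg_cong[OF g(5), of prod.swap] by (simp add: swap_plus swap_wt)
  moreover have "lk (del D x y) (d, c) = 1" if "above C D" for D
    using g(6)[OF above_conj[OF that]] by simp
  ultimately show ?thesis using g xy by (auto simp: good_addition_def)
qed

lemma proc_step_good:
  assumes nz: "nonzero_seq n a" and C: "std_lift n a C" and st: "proc_step (Running C) (Running C')"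
  shows "\<exists>x y c d. good_addition C C' x y c d"
  using st
proof cases
  case add_horizontal
  then show ?thesis using add_b1_good[OF std_lift_lift2(1)[OF nz C]] by blast
next
  case add_vertical
  then obtain x y c where "good_addition (conj_complex C) (conj_complex C') x y c 1"
    using add_b1_good[OF std_lift_lift2(2)[OF nz C]] by metis
  then show ?thesis using good_addition_conj by metis
qed

lemma proc_step_failure:
  assumes nz: "nonzero_seq n a" and C: "std_lift n a C" and st: "proc_step (Running C) Failure"
  shows "\<not> above C D"
  using st
proof cases
  case fail_horizontal
  then show ?thesis using fail_b1_not_above[OF std_lift_lift2(1)[OF nz C]] by blast
next
  case fail_vertical
  then show ?thesis using fail_b1_not_above[OF std_lift_lift2(2)[OF nz C]] above_conj by blast
qed

lemma sq_coeff_conj: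
  assumes "based_module 2 C" "x \<in> basis C" "y \<in> basis C"
  shows "sq_coeff (conj_complex C) x y c d = sq_coeff C x y d c"
  using assms sq_coeff_mm[of C x y d c] sq_coeff_mm[of "conj_complex C" x y c d]
  by (auto simp: based_module_conj swap_mm)

lemma proc_step_exists:
  assumes nz: "nonzero_seq n a" and C: "std_lift n a C"
  shows "\<exists>s. proc_step (Running C) s"
proof (cases "\<exists>x y c d. defect C x y c d")
  case False
  then show ?thesis using succeed by blast
next
  case True
  then obtain x y c d where df: "defect C x y c d" by blast
  have b: "based_module 2 C" using C by (simp add: std_lift_def)
  consider "d = 1" | "c = 1" using df by (auto simp: defect_def)
  then show ?thesis
  proof cases
    case 1
    then have "fail_b1 C \<or> (\<exists>C'. add_b1 C C')"
      using defect_b1_step[OF std_lift_lift2(1)[OF nz C]] df by blast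
    then show ?thesis using add_horizontal fail_horizontal by blast
  next
    case 2
    have "defect (conj_complex C) x y d 1"
      using df 2 sq_coeff_conj[OF b, of x y d c] by (auto simp: defect_def)
    then have "fail_b1 (conj_complex C) \<or> (\<exists>C'. add_b1 (conj_complex C) C')"
      using defect_b1_step[OF std_lift_lift2(2)[OF nz C]] by blast
    then show ?thesis using add_vertical fail_vertical by (metis conj_conj)
  qed
qed

definition arrows :: "'b based \<Rightarrow> ('b \<times> 'b \<times> nat \<times> nat) set" where
  "arrows C = {(x, y, m). x \<in> basis C \<and> y \<in> basis C \<and> lk (del C x y) m = 1}"

text \<open>
  By parity of the gradings an arrow joins an even and an odd basis element, and the gradings
  determine its coefficient.  There are no arrows in both directions between the same two elements:
  the product of their coefficients would have to be \<open>UV\<close>, so both would be arrows of the standard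
  complex, or one would have a constant coefficient.
\<close>

lemma card_arrows:
  assumes nz: "nonzero_seq n a" and C: "std_lift n a C"
  shows "finite (arrows C)" "card (arrows C) \<le> n\<^sup>2 + n"
proof -
  let ?g = "gr (standard_complex n a)"
  let ?Ev = "(\<lambda>k. 2 * k) ` {0..n}" and ?Od = "(\<lambda>k. 2 * k + 1) ` {0..<n}"
  define \<phi> :: "nat \<times> nat \<times> nat \<times> nat \<Rightarrow> nat \<times> nat" where
    "\<phi> = (\<lambda>(x, y, m). if even x then (x, y) else (y, x))"
  have B: "basis C = {0..2 * n}" using C by (simp add: std_lift_def std_based_def)
  have gr: "?g y + wt m = ?g x + - (1, 1)" "x \<le> 2 * n" "y \<le> 2 * n" if "(x, y, m) \<in> arrows C" for x y m
    using that arrow_grade[of 2 C x y "fst m" "snd m"] C by (auto simp: arrows_def arrow_def std_lift_def B)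
  have par: "even x \<longleftrightarrow> odd y" if "(x, y, m) \<in> arrows C" for x y m
  proof -
    have "fst (?g y) + fst (wt m) = fst (?g x) - 1" using gr(1)[OF that] by (auto simp: prod_eq_iff)
    then have "even (fst (?g x)) \<longleftrightarrow> odd (fst (?g y))" unfolding wt_fst_snd by presburger
    then show ?thesis using standard_complex_parity(1)[OF nz] gr(2,3)[OF that] by blast
  qed
  have one: "std_del a x y \<noteq> 0 \<and> m \<noteq> 0" if "(x, y, m) \<in> arrows C" "m \<in> mons 1" for x y m
  proof -
    have "normal_form (mons 1) (del C x y) = std_del a x y"
      using C gr(2,3)[OF that(1)] by (simp add: std_lift_def std_based_def)
    then have l: "lk (std_del a x y) m = 1" using that by (auto simp: arrows_def dest: sym)
    then have nz': "std_del a x y \<noteq> 0" by auto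
    moreover have "m \<noteq> 0"
      using nz'
    proof (cases rule: std_del_nz)
      case (1 i)
      then show ?thesis using l by (auto simp: lookup_mono edge_def zero_prod_def split: if_splits)
    next
      case (2 i)
      then show ?thesis using l by (auto simp: lookup_mono edge_def zero_prod_def split: if_splits)
    qed
    ultimately show ?thesis by simp
  qed
  have not_both: False if "(x, y, m) \<in> arrows C" "(y, x, k) \<in> arrows C" for x y m k
  proof -
    have "wt m + wt k = wt (1, 1)"
      using gr(1)[OF that(1)] gr(1)[OF that(2)] by (auto simp: prod_eq_iff wt_fst_snd)
    then have mk: "m + k = (1, 1)" by (simp add: wt_inj flip: wt_add)
    obtain m1 m2 k1 k2 where e: "m = (m1, m2)" "k = (k1, k2)" by (cases m; cases k)
    have "m1 = 0 \<and> k1 = 1 \<or> m1 = 1 \<and> k1 = 0" "m2 = 0 \<and> k2 = 1 \<or> m2 = 1 \<and> k2 = 0"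
      using mk e by (simp, arith)+
    then consider "m = 0" | "k = 0" | "m \<in> mons 1" "k \<in> mons 1" "m \<noteq> 0"
      unfolding e by (auto simp: zero_prod_def)
    then show False
    proof cases
      case 1
      then show ?thesis using one[OF that(1)] by (simp add: zero_prod_def)
    next
      case 2
      then show ?thesis using one[OF that(2)] by (simp add: zero_prod_def)
    next
      case 3
      then have "std_del a x y \<noteq> 0" "std_del a y x \<noteq> 0" using one that by blast+
      then show False by (auto simp: std_del_def split: if_splits)
    qed
  qed
  have inj: "inj_on \<phi> (arrows C)"
  proof (rule inj_onI)
    fix t t' assume t: "t \<in> arrows C" "t' \<in> arrows C" "\<phi> t = \<phi> t'"
    obtain x y m x' y' m' where e: "t = (x, y, m)" "t' = (x', y', m')" by (cases t; cases t') auto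
    show "t = t'"
    proof (cases "x = x' \<and> y = y'")
      case True
      then have "wt m = wt m'" using gr(1)[of x y m] gr(1)[of x' y' m'] t e by (auto simp: prod_eq_iff)
      then show ?thesis using True e by (simp add: wt_inj)
    next
      case False
      then have "x = y'" "y = x'" using t(3) by (auto simp: \<phi>_def e split: if_splits)
      then show ?thesis using not_both[of x y m m'] t e by simp
    qed
  qed
  have img: "\<phi> ` arrows C \<subseteq> ?Ev \<times> ?Od"
  proof -
    have ev: "v \<in> ?Ev" if "even v" "v \<le> 2 * n" for v using that by (auto elim!: evenE)
    have od: "v \<in> ?Od" if "odd v" "v \<le> 2 * n" for v using that by (auto elim!: oddE simp: image_iff)
    show ?thesis
    proof (rule image_subsetI)
      fix t assume t: "t \<in> arrows C"
      obtain x y m where e: "t = (x, y, m)" by (cases t) auto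
      show "\<phi> t \<in> ?Ev \<times> ?Od"
        using ev[of x] ev[of y] od[of x] od[of y] gr(2,3)[OF t[unfolded e]] par[OF t[unfolded e]]
        by (cases "even x") (simp_all add: \<phi>_def e del: image_iff)
    qed
  qed
  have fin: "finite (?Ev \<times> ?Od)" by simp
  show "finite (arrows C)" using finite_imageD[OF finite_subset[OF img fin] inj] .
  have "card (arrows C) \<le> card (?Ev \<times> ?Od)" by (rule card_inj_on_le[OF inj img fin])
  also have "\<dots> = (n + 1) * n"
  proof -
    have "card ?Ev = n + 1" "card ?Od = n" by (simp_all add: card_image inj_on_def)
    then show ?thesis unfolding card_cartesian_product by (simp only:)
  qed
  also have "\<dots> = n\<^sup>2 + n" by (simp only: power2_eq_square distrib_right mult_1_left)
  finally show "card (arrows C) \<le> n\<^sup>2 + n" .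
qed

lemma arrows_add:
  assumes "good_addition C C' x y c d"
  shows "arrows C' = insert (x, y, c, d) (arrows C)" "(x, y, c, d) \<notin> arrows C"
proof -
  have e: "C' = add_arrow C x y c d" and g: "x \<in> basis C" "y \<in> basis C" "lk (del C x y) (c, d) = 0"
    using assms by (auto simp: good_addition_def)
  show "arrows C' = insert (x, y, c, d) (arrows C)" "(x, y, c, d) \<notin> arrows C"
    using g by (auto simp: arrows_def e add_arrow_def lookup_add lookup_mono split: if_splits)
qed

lemma proc_adds_bound:
  assumes nz: "nonzero_seq n a" and st: "(proc_adds ^^ k) (standard_complex n a) C"
  shows "std_lift n a C \<and> k \<le> card (arrows C)"
  using st
proof (induction k arbitrary: C)
  case 0
  then show ?case using standard_complex_std_lift[OF nz] by auto
next
  case (Suc k)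
  then obtain C1 where C1: "(proc_adds ^^ k) (standard_complex n a) C1" "proc_adds C1 C" by auto
  then have IH: "std_lift n a C1" "k \<le> card (arrows C1)" using Suc.IH by auto
  obtain x y c d where g: "good_addition C1 C x y c d"
    using proc_step_good[OF nz IH(1)] C1(2) unfolding proc_adds_def by metis
  show ?case
    using std_lift_add[OF IH(1) g] arrows_add[OF g] IH(2) card_arrows(1)[OF nz IH(1)] by simp
qed

text \<open>
  The invariant: all partial realizations lie above the current object, so that \<open>Failure\<close> refutes
  their existence.
\<close>

definition proc_inv :: "nat \<Rightarrow> (nat \<Rightarrow> int) \<Rightarrow> nat proc_state \<Rightarrow> bool" where
  "proc_inv n a s \<longleftrightarrow> (case s of
      Running C \<Rightarrow> std_lift n a C \<and> (\<forall>D. partial_realization D (standard_complex n a) \<longrightarrow> above C D)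
    | Success C \<Rightarrow> partial_realization C (standard_complex n a)
    | Failure \<Rightarrow> \<not> partially_realizable (standard_complex n a))"

lemma proc_inv_reachable:
  assumes nz: "nonzero_seq n a" and st: "proc_step\<^sup>*\<^sup>* (Running (standard_complex n a)) s"
  shows "proc_inv n a s"
  using st
proof (induction rule: rtranclp_induct)
  case base
  then show ?case
    using standard_complex_std_lift[OF nz] partial_realization_std_lift(2) by (auto simp: proc_inv_def)
next
  case (step s s')
  then obtain C where s: "s = Running C" by (auto elim: proc_step.cases)
  have C: "std_lift n a C" "\<And>D. partial_realization D (standard_complex n a) \<Longrightarrow> above C D"
    using step(3) by (auto simp: proc_inv_def s)
  show ?case
  proof (cases s')
    case (Running C')
    obtain x y c d where g: "good_addition C C' x y c d"
      using proc_step_good[OF nz C(1)] step(2) unfolding s Running by metis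
    show ?thesis
      using std_lift_add[OF C(1) g] above_trans_add[OF C(2) g] by (auto simp: proc_inv_def Running)
  next
    case (Success C')
    then have "C' = C" "\<not> (\<exists>x y c d. defect C x y c d)" using step(2) s by (auto elim: proc_step.cases)
    then show ?thesis using no_defect_chain_complex[OF nz C(1)] by (simp add: proc_inv_def Success)
  next
    case Failure
    then show ?thesis
      using proc_step_failure[OF nz C(1)] step(2) C(2) s by (auto simp: proc_inv_def partially_realizable_def)
  qed
qed

lemma proc_ends_inv:
  assumes nz: "nonzero_seq n a" and e: "proc_ends (standard_complex n a) s"
  shows "(\<exists>D. s = Success D \<and> partial_realization D (standard_complex n a)) \<or>
    (s = Failure \<and> \<not> partially_realizable (standard_complex n a))"
proof -
  have i: "proc_inv n a s" using proc_inv_reachable[OF nz] e by (simp add: proc_ends_def)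
  have "s \<noteq> Running C" for C
    using i e proc_step_exists[OF nz, of C] by (auto simp: proc_ends_def proc_inv_def)
  then show ?thesis using i by (cases s) (auto simp: proc_inv_def)
qed

text \<open>If no arrow has length 1, compositions of two arrows vanish modulo \<open>U\<^sup>2V\<^sup>2\<close>.\<close>

lemma long_partially_realizable:
  assumes nz: "nonzero_seq n a" and long: "\<forall>i\<in>{1..2 * n}. \<bar>a i\<bar> \<ge> 2"
  shows "partially_realizable (standard_complex n a)"
proof -
  let ?C = "standard_complex n a"
  have lift: "std_lift n a ?C" by (rule standard_complex_std_lift[OF nz])
  have b: "based_module 2 ?C" using lift by (simp add: std_lift_def)
  have "\<not> defect ?C x y c d" for x y c d
  proof
    assume df: "defect ?C x y c d"
    then have xy: "x \<le> 2 * n" "y \<le> 2 * n" and cd: "1 \<le> c" "1 \<le> d" "1 \<in> {c, d}" and "sq_coeff ?C x y c d = 1"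
      by (auto simp: defect_def)
    then have "lk (mm {0..2 * n} (std_del a) (std_del a) x y) (c, d) = 1"
      using sq_coeff_mm[OF b, of x y c d] by (simp split: if_splits)
    then have "(\<Sum>u\<in>{0..2 * n}. lk (std_del a x u * std_del a u y) (c, d)) = 1"
      by (simp add: mm_def lookup_sum)
    then obtain u where u: "u \<in> {0..2 * n}" "lk (std_del a x u * std_del a u y) (c, d) \<noteq> 0"
      by (metis (no_types, lifting) sum.neutral zero_neq_one)
    then obtain k l where kl: "(c, d) = k + l" "k \<in> Poly_Mapping.keys (std_del a x u)" "l \<in> Poly_Mapping.keys (std_del a u y)"
      using keys_mult[of "std_del a x u" "std_del a u y"] unfolding in_keys_iff[symmetric] by blast
    have e: "\<exists>i\<in>{1..2 * n}. m = edge a i" if "m \<in> Poly_Mapping.keys (std_del a v w)" "v \<le> 2 * n" "w \<le> 2 * n" for m v w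
    proof -
      have "std_del a v w \<noteq> 0" using that by auto
      then show ?thesis
      proof (cases rule: std_del_nz)
        case (1 i)
        then show ?thesis using that by (intro bexI[of _ "Suc i"]) auto
      next
        case (2 i)
        then show ?thesis using that by (intro bexI[of _ "Suc i"]) auto
      qed
    qed
    obtain i j where ij: "i \<in> {1..2 * n}" "k = edge a i" "j \<in> {1..2 * n}" "l = edge a j"
      using e[OF kl(2)] e[OF kl(3)] u xy by auto
    have "2 \<le> nat \<bar>a i\<bar>" "2 \<le> nat \<bar>a j\<bar>"
      using long[rule_format, OF ij(1)] long[rule_format, OF ij(3)] by linarith+
    then show False using kl(1) cd ij by (auto simp: edge_def split: if_splits)
  qed
  then show ?thesis
    using no_defect_chain_complex[OF nz lift] by (auto simp: partially_realizable_def)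
qed

section \<open>Self-maps of standard complexes\<close>

text \<open>
  As \<open>R\<close> is acyclic and finite, the iteration \<open>Q \<mapsto> 1 + N Q\<close> becomes stationary, first in the rows
  without successors; in characteristic 2 a fixed point is an inverse of \<open>N + 1\<close>.
\<close>

lemma nilpotent_inverse:
  fixes N :: "'b \<Rightarrow> 'b \<Rightarrow> FUV"
  assumes fin: "finite (basis C)" and h: "hmat C C 0 N"
    and supp: "\<And>x y. x \<in> basis C \<Longrightarrow> y \<in> basis C \<Longrightarrow> N x y \<noteq> 0 \<Longrightarrow> (x, y) \<in> R"
    and R: "acyclic R" "finite R"
  shows "\<exists>Q. hmat C C 0 Q \<and>
    (\<forall>x\<in>basis C. \<forall>z\<in>basis C. mm (basis C) (N + unit_matrix) Q x z = unit_matrix x z \<and>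
      mm (basis C) Q (N + unit_matrix) x z = unit_matrix x z)"
proof -
  let ?B = "basis C"
  define Q where "Q = rec_nat 0 (\<lambda>_ q. unit_matrix + mm ?B N q)"
  have Q0: "Q 0 = 0" and QS: "Q (Suc k) = unit_matrix + mm ?B N (Q k)" for k
    by (simp_all add: Q_def)
  have D: "Q (Suc (Suc k)) + Q (Suc k) = mm ?B N (Q (Suc k) + Q k)" for k
  proof -
    have "Q (Suc (Suc k)) + Q (Suc k) = (unit_matrix + unit_matrix) + (mm ?B N (Q (Suc k)) + mm ?B N (Q k))"
      by (simp only: QS[of "Suc k"] QS[of k] add.assoc add.left_commute)
    also have "unit_matrix + unit_matrix = (0 :: 'b \<Rightarrow> 'b \<Rightarrow> FUV)"
      by (intro ext) (simp only: plus_fun_apply zero_fun_apply FUV_add_self)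
    finally show ?thesis by (simp only: mm_add_right add_0_left)
  qed
  have "wf (R\<inverse>)" by (rule finite_acyclic_wf_converse) (use R in auto)
  then have stab: "x \<in> ?B \<Longrightarrow> \<exists>K. \<forall>k\<ge>K. \<forall>z. (Q (Suc k) + Q k) x z = 0" for x
  proof (induction x rule: wf_induct_rule)
    case (less x)
    have "\<forall>y\<in>?B. \<exists>K. N x y \<noteq> 0 \<longrightarrow> (\<forall>k\<ge>K. \<forall>z. (Q (Suc k) + Q k) y z = 0)"
    proof
      fix y assume y: "y \<in> ?B"
      show "\<exists>K. N x y \<noteq> 0 \<longrightarrow> (\<forall>k\<ge>K. \<forall>z. (Q (Suc k) + Q k) y z = 0)"
        using less.IH[of y] supp[OF less.prems y] y by blast
    qed
    then obtain K where K: "\<And>y k z. y \<in> ?B \<Longrightarrow> N x y \<noteq> 0 \<Longrightarrow> K y \<le> k \<Longrightarrow> (Q (Suc k) + Q k) y z = 0"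
      by (metis (no_types, lifting) bchoice)
    have "(Q (Suc k) + Q k) x z = 0" if k: "Suc (\<Sum>y\<in>?B. K y) \<le> k" for k z
    proof -
      obtain j where j: "k = Suc j" "(\<Sum>y\<in>?B. K y) \<le> j" using k by (cases k) auto
      have "N x y * (Q (Suc j) + Q j) y z = 0" if y: "y \<in> ?B" for y
      proof (cases "N x y = 0")
        case False
        have "K y \<le> j" using j(2) member_le_sum[OF y, of K] fin by simp
        then show ?thesis using K[OF y False] by simp
      qed simp
      then show ?thesis unfolding j(1) D mm_def by (rule sum.neutral[OF ballI])
    qed
    then show ?case by blast
  qed
  have "\<forall>x\<in>?B. \<exists>K. \<forall>k\<ge>K. \<forall>z. (Q (Suc k) + Q k) x z = 0" using stab by blast
  then obtain K where K: "\<And>x k z. x \<in> ?B \<Longrightarrow> K x \<le> k \<Longrightarrow> (Q (Suc k) + Q k) x z = 0"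
    by (metis (no_types, lifting) bchoice)
  define L where "L = (\<Sum>x\<in>?B. K x)"
  have KL: "K x \<le> L" if "x \<in> ?B" for x unfolding L_def using member_le_sum[OF that, of K] fin by simp
  have hQ: "hmat C C 0 (Q k)" for k
  proof (induction k)
    case 0
    then show ?case by (simp add: Q0 hmat_def)
  next
    case (Suc k)
    have "hmat C C 0 (mm ?B N (Q k))" using hmat_mm[OF h Suc] by simp
    then show ?case unfolding QS by (rule hmat_add[OF hmat_unit])
  qed
  have comm: "mm ?B (Q k) N x z = mm ?B N (Q k) x z" if "x \<in> ?B" "z \<in> ?B" for k x z
    using that
  proof (induction k arbitrary: x z)
    case 0
    then show ?case by (simp add: Q0 mm_def)
  next
    case (Suc k)
    have "mm ?B (Q (Suc k)) N x z = N x z + mm ?B N (mm ?B (Q k) N) x z"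
      unfolding QS mm_add_left plus_fun_apply by (simp add: mm_unit_left fin Suc.prems mm_assoc)
    also have "mm ?B N (mm ?B (Q k) N) x z = mm ?B N (mm ?B N (Q k)) x z"
      by (rule mm_cong) (use Suc in auto)
    also have "N x z + mm ?B N (mm ?B N (Q k)) x z = mm ?B N (Q (Suc k)) x z"
      unfolding QS mm_add_right plus_fun_apply by (simp add: mm_unit_right fin Suc.prems)
    finally show ?case .
  qed
  have right: "mm ?B (N + unit_matrix) (Q L) x z = unit_matrix x z" if x: "x \<in> ?B" and z: "z \<in> ?B" for x z
  proof -
    have "mm ?B (N + unit_matrix) (Q L) x z = mm ?B N (Q L) x z + Q L x z"
      unfolding mm_add_left plus_fun_apply by (simp add: mm_unit_left fin x)
    moreover have "unit_matrix x z + mm ?B N (Q L) x z + Q L x z = 0"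
      using K[OF x KL[OF x], of z] unfolding QS by simp
    ultimately show ?thesis by (metis FUV_add_self add.assoc add_left_imp_eq)
  qed
  moreover have "mm ?B (Q L) (N + unit_matrix) x z = unit_matrix x z" if x: "x \<in> ?B" and z: "z \<in> ?B" for x z
  proof -
    have "mm ?B (Q L) (N + unit_matrix) x z = mm ?B (Q L) N x z + Q L x z"
      unfolding mm_add_right plus_fun_apply by (simp add: mm_unit_right fin z)
    also have "\<dots> = mm ?B (N + unit_matrix) (Q L) x z"
      unfolding mm_add_left plus_fun_apply by (simp add: mm_unit_left fin x comm[OF x z])
    finally show ?thesis using right[OF x z] by simp
  qed
  ultimately show ?thesis using hQ by blast
qed

lemma std_neighbour:
  assumes "Suc x \<le> 2 * n"
  shows "(std_pU n x = Suc x \<and> std_pU n (Suc x) = x) \<or> (std_pV x = Suc x \<and> std_pV (Suc x) = x)"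
proof (cases "even x")
  case True
  then have "x \<noteq> 2 * n" "Suc x \<noteq> 2 * n" using assms by (auto dest: arg_cong[where f=even])
  then show ?thesis using True by (simp add: std_pU_def)
qed (use odd_pos in \<open>auto simp: std_pV_def\<close>)

text \<open>
  A map of a standard complex to itself that is the identity at the end \<open>x_0\<close>, up to higher order
  terms, is invertible.  Walking along the complex shows that all diagonal entries are 1.  The
  nonzero entries off the diagonal form an acyclic relation: along a cycle the grading could not
  increase, so all entries would be constant, all letters would agree, and the neighbours would
  form a cycle, too; so \<open>x_0\<close> would lie on a cycle, but no other element is unmatched modulo \<open>U\<close>.
\<close>

lemma std_self_map_invertible:
  assumes nz: "nonzero_seq n a"
  defines "C \<equiv> standard_complex n a"
  assumes h: "hmat C C 0 P"
    and comm: "\<And>x z. x \<in> basis C \<Longrightarrow> z \<in> basis C \<Longrightarrow>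
      normal_form (mons 1) (mm (basis C) (del C) P x z) = normal_form (mons 1) (mm (basis C) P (del C) x z)"
    and one: "lk (P 0 0) 0 = 1"
  shows "\<exists>Q. hmat C C 0 Q \<and> (\<forall>x\<in>basis C. \<forall>z\<in>basis C.
    mm (basis C) P Q x z = unit_matrix x z \<and> mm (basis C) Q P x z = unit_matrix x z)"
proof -
  have B: "basis C = {0..2 * n}" and fin: "finite (basis C)" and sb: "std_based n a C"
    by (simp_all add: C_def)
  note prU = pairing_std_U[OF nz sb] and prV = pairing_std_V[OF nz sb]
  have commx: "normal_form (range xe) (mm (basis C) (del C) P x z) = normal_form (range xe) (mm (basis C) P (del C) x z)"
    if "x \<in> basis C" "z \<in> basis C" "axis xe" for x z xe
    using arg_cong[OF comm[OF that(1,2)], of "normal_form (range xe)"]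
    by (simp add: nf_subset[OF axis_in_1[OF that(3)]])
  note lU = letter_step[OF axis_U prU fin prU fin commx[OF _ _ axis_U]]
  note lV = letter_step[OF axis_V prV fin prV fin commx[OF _ _ axis_V]]
  have diag: "lk (P x x) 0 = 1" if "x \<le> 2 * n" for x
    using that
  proof (induction x)
    case (Suc x)
    then have "lk (P x x) 0 = 1" "x \<in> basis C" by (auto simp: B)
    then show ?case using std_neighbour[OF Suc.prems] lU[of x x] lV[of x x] by auto
  qed (rule one)
  define R where "R = {(x, y). x \<in> basis C \<and> y \<in> basis C \<and> x \<noteq> y \<and> P x y \<noteq> 0}"
  define R0 where "R0 = {(x, y). x \<in> basis C \<and> y \<in> basis C \<and> x \<noteq> y \<and> lk (P x y) 0 = 1}"
  define t where "t x = fst (gr C x) + snd (gr C x)" for x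
  have R_t: "t x \<le> t y \<and> (t x = t y \<longrightarrow> (x, y) \<in> R0)" if xy: "(x, y) \<in> R" for x y
  proof -
    have "Poly_Mapping.keys (P x y) \<noteq> {}"
      using xy by (auto simp: R_def intro: poly_mapping_eqI simp: in_keys_iff set_eq_iff)
    then obtain m where m: "m \<in> Poly_Mapping.keys (P x y)" by blast
    then have g: "gr C y + wt m = gr C x + 0" using h xy unfolding hmat_def R_def by blast
    then have g': "t x = t y - 2 * int (fst m) - 2 * int (snd m)"
      unfolding t_def by (auto simp: prod_eq_iff wt_fst_snd)
    have "m = 0" if "t x = t y" using g' that by (cases m) (auto simp: zero_prod_def)
    then show ?thesis using g' m xy by (auto simp: R_def R0_def in_keys_iff)
  qed
  \<comment> \<open>along a cycle the total grading is constant, so all of its entries are constants\<close>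
  have R_plus: "t x \<le> t y \<and> (t x = t y \<longrightarrow> (x, y) \<in> R0\<^sup>+)" if "(x, y) \<in> R\<^sup>+" for x y
    using that
  proof (induction rule: trancl_induct)
    case (base y)
    then show ?case using R_t by blast
  next
    case (step y z)
    then show ?case using R_t[OF step(2)] by (auto intro: trancl_into_trancl)
  qed
  have R0_step: "letter_le (s x) (s y) \<and> (s x = s y \<longrightarrow> (p x, p y) \<in> R0\<^sup>+)"
    if "(x, y) \<in> R0\<^sup>+" and ps: "(p, s) = (std_pU n, std_sU n a) \<or> (p, s) = (std_pV, std_sV a)" for x y p s
    using that(1)
  proof (induction rule: trancl_induct)
    case base': (base y)
    have pp: "p x \<in> basis C" "p y \<in> basis C" "p x = p y \<Longrightarrow> x = y"
      using ps prU prV base' unfolding pairing_def R0_def by auto metis+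
    show ?case using ps lU[of x y] lV[of x y] base' pp by (auto simp: R0_def intro!: r_into_trancl)
  next
    case (step y z)
    have pp: "p y \<in> basis C" "p z \<in> basis C" "p y = p z \<Longrightarrow> y = z"
      using ps prU prV step(2) unfolding pairing_def R0_def by auto metis+
    have l: "letter_le (s y) (s z) \<and> (s y = s z \<longrightarrow> (p y, p z) \<in> R0)"
      using ps lU[of y z] lV[of y z] step(2) pp by (auto simp: R0_def)
    show ?case
    proof (intro conjI impI)
      show "letter_le (s x) (s z)" using l step.IH letter_le_trans by blast
      assume e: "s x = s z"
      then have "s x = s y" using l step.IH letter_le_antisym[of "s x" "s y"] by simp
      then show "(p x, p z) \<in> R0\<^sup>+" using l step.IH e by (auto intro: trancl_into_trancl)
    qed
  qed
  note sU = R0_step[where p="std_pU n" and s="std_sU n a", simplified]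
    and sV = R0_step[where p="std_pV" and s="std_sV a", simplified]
  have down: "(x, x) \<in> R0\<^sup>+ \<Longrightarrow> x \<le> 2 * n \<Longrightarrow> (0, 0) \<in> R0\<^sup>+" for x
  proof (induction x)
    case (Suc x)
    have "(x, x) \<in> R0\<^sup>+"
      using std_neighbour[OF Suc.prems(2)] sU[OF Suc.prems(1)] sV[OF Suc.prems(1)] by auto
    then show ?case using Suc by simp
  qed
  \<comment> \<open>a successor of 0 on such a cycle would be unmatched modulo U, like 0\<close>
  have no0: "(0, 0) \<notin> R0\<^sup>+"
  proof
    assume "(0, 0) \<in> R0\<^sup>+"
    then obtain y where y: "(0, y) \<in> R0" "(y, 0) \<in> R0\<^sup>*" by (metis tranclD)
    then have "y \<noteq> 0" "y \<in> {0..2 * n}" by (auto simp: R0_def B)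
    moreover have "(y, 0) \<in> R0\<^sup>+" using y \<open>y \<noteq> 0\<close> by (metis rtranclD)
    then have "letter_le (std_sV a y) 0" using sV[of y 0] by (simp add: std_sV_def)
    moreover have "letter_le 0 (std_sV a y)" using sV[of 0 y] r_into_trancl[OF y(1)] by (simp add: std_sV_def)
    ultimately show False
      using letter_le_antisym unmatched_V[OF nz] by blast
  qed
  have acyc: "acyclic R"
  proof (rule acyclicI, rule allI, rule notI)
    fix x assume xx: "(x, x) \<in> R\<^sup>+"
    then have "x \<le> 2 * n" by (auto simp: R_def B dest: tranclD)
    then show False using R_plus[OF xx] down no0 by blast
  qed
  have finR: "finite R" by (rule finite_subset[of _ "basis C \<times> basis C"]) (use fin in \<open>auto simp: R_def\<close>)
  have Pxx: "P x x = 1" if "x \<in> basis C" for x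
    using hmatD[OF h that that] diag[of x] that by (simp add: B)
  have supp: "(x, y) \<in> R" if "x \<in> basis C" "y \<in> basis C" "(P + unit_matrix) x y \<noteq> 0" for x y
  proof (cases "x = y")
    case True
    then show ?thesis using that Pxx[of x] FUV_add_self[of 1] unfolding plus_fun_apply unit_matrix_def by simp
  next
    case False
    then show ?thesis using that by (auto simp: R_def unit_matrix_def)
  qed
  have "P + unit_matrix + unit_matrix = P"
    by (intro ext) (simp only: plus_fun_apply add.assoc FUV_add_self add_0_right)
  then show ?thesis
    using nilpotent_inverse[OF fin hmat_add[OF h hmat_unit] supp acyc finR] by simp
qed


section \<open>Realizable classes come from partially realizable complexes\<close>

lemma chain_map_comp:
  assumes "chain_map S C D f" "chain_map S D E g"
  shows "chain_map S C E (g \<circ> f)"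
proof -
  have el: "f w \<in> elts S D" if "w \<in> elts S C" for w
    using assms(1) that by (auto simp: chain_map_def linear_map_def)
  have "has_degree S C E (0, 0) (g \<circ> f)"
    using assms el unfolding chain_map_def has_degree_def zero_prod_def[symmetric] by simp
  then show ?thesis
    using assms el unfolding chain_map_def linear_map_def by auto
qed

text \<open>
  Only homogeneity needs an argument.  If \<open>f w\<close> is homogeneous of degree \<open>g\<close>, split off from \<open>w\<close> the
  part \<open>u\<close> of degree \<open>g\<close>; the image of the rest is homogeneous of degree \<open>g\<close>, but has no terms of
  degree \<open>g\<close>, so the rest is zero.
\<close>

lemma chain_map_inverse:
  assumes f: "chain_map S C D f" and bij: "bij_betw f (elts S C) (elts S D)"
    and S: "order_ideal S" and fin: "finite (basis C)" "finite (basis D)"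
  shows "chain_map S D C (inv_into (elts S C) f)"
proof -
  let ?g = "inv_into (elts S C) f"
  have gf: "?g (f w) = w" if "w \<in> elts S C" for w using bij that by (simp add: bij_betw_def)
  have fg: "f (?g w) = w" "?g w \<in> elts S C" if "w \<in> elts S D" for w
    using bij that by (auto simp: bij_betw_def f_inv_into_f inv_into_into)
  have lin: "linear_map S C D f" using f by (simp add: chain_map_def)
  have uniq: "?g w = v" if "v \<in> elts S C" "f v = w" for v w using gf that by auto
  have bdel: "bd S E w \<in> elts S E" for E :: "'z based" and w by (simp add: bd_matmap)
  have l: "linear_map S D C ?g"
    unfolding linear_map_def
  proof (intro conjI ballI)
    show "?g ` elts S D \<subseteq> elts S C" using fg by auto
  next
    fix v w assume "v \<in> elts S D" "w \<in> elts S D"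
    then show "?g (v + w) = ?g v + ?g w"
      using lin fg by (intro uniq) (auto simp: linear_map_def intro: elts_add)
  next
    fix p w assume "p \<in> qring S" "w \<in> elts S D"
    then show "?g (smult S p w) = smult S p (?g w)"
      using lin fg by (intro uniq) (auto simp: linear_map_def intro: smult_elts)
  qed
  have c: "?g (bd S D w) = bd S C (?g w)" if "w \<in> elts S D" for w
    using f fg[OF that] bdel by (intro uniq) (auto simp: chain_map_def)
  have d: "has_degree S D C (0, 0) ?g"
    unfolding has_degree_def
  proof (intro allI ballI impI)
    fix g w' assume w': "w' \<in> elts S D" "homogeneous D g w'"
    define w where "w = ?g w'"
    have w: "w \<in> elts S C" "f w = w'" using fg[OF w'(1)] by (auto simp: w_def)
    define u where "u x = normal_form {m. gr C x + wt m = g} (w x)" for x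
    define r where "r x = normal_form {m. gr C x + wt m \<noteq> g} (w x)" for x
    have wur: "w = u + r"
      by (rule ext, rule poly_mapping_eqI) (simp add: u_def r_def lookup_add)
    have el: "normal_form S (normal_form T (w x)) = normal_form T (w x)" for T x
      using eltsD[OF w(1), of x] by (metis inf_commute nf_nf)
    have elu: "u \<in> elts S C" and elr: "r \<in> elts S C"
      using w(1) el by (auto simp: elts_def u_def r_def qring_iff)
    have "homogeneous C g u"
      by (auto simp: homogeneous_def u_def in_keys_iff split: if_splits)
    then have fu: "homogeneous D g (f u)"
      using f elu unfolding chain_map_def has_degree_def zero_prod_def[symmetric] by (metis add.right_neutral)
    have fr: "f r = w' + f u"
    proof -
      have "w' = f u + f r" using lin elu elr w(2) unfolding wur linear_map_def by metis
      then have "w' + f u = f r + (f u + f u)" by (simp only: add.assoc add.commute add.left_commute)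
      then show ?thesis by (simp only: elt_add_self add_0_right)
    qed
    note M = chain_map_matrix[OF f S fin]
    have fr0: "f r y = 0" for y
    proof (cases "y \<in> basis D")
      case True
      have "m \<notin> Poly_Mapping.keys (f r y)" for m
      proof
        assume m: "m \<in> Poly_Mapping.keys (f r y)"
        then have g1: "gr D y + wt m = g"
        proof -
          have "m \<in> Poly_Mapping.keys (w' y) \<or> m \<in> Poly_Mapping.keys (f u y)"
            using m subsetD[OF keys_add, of m "w' y" "f u y"] unfolding fr plus_fun_apply by blast
          then show ?thesis using fu w'(2) True by (auto simp: homogeneous_def)
        qed
        have "m \<in> Poly_Mapping.keys (\<Sum>x\<in>basis C. r x * f (gen x) y)"
          using m True unfolding M(1)[OF elr] by (auto simp: matmap_def in_keys_iff simp del: bit_not_zero_iff split: if_splits)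
        then obtain x where x: "x \<in> basis C" "m \<in> Poly_Mapping.keys (r x * f (gen x) y)"
          using subsetD[OF keys_sum, of m] by blast
        then obtain i j where ij: "m = i + j" "i \<in> Poly_Mapping.keys (r x)" "j \<in> Poly_Mapping.keys (f (gen x) y)"
          using keys_mult[of "r x" "f (gen x) y"] by auto
        have "gr D y + wt j = gr C x + 0" using M(2) x(1) True ij(3) by (simp add: hmat_def)
        then have "gr D y + wt m = gr C x + wt i" by (simp add: ij(1) wt_add add.left_commute add.commute)
        moreover have "gr C x + wt i \<noteq> g" using ij(2) by (auto simp: r_def in_keys_iff split: if_splits)
        ultimately show False using g1 by simp
      qed
      then show ?thesis by (auto intro: poly_mapping_eqI simp: in_keys_iff)
    next
      case False
      have "f r \<in> elts S D" using lin elr by (auto simp: linear_map_def)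
      then show ?thesis using False by (rule elts_outside)
    qed
    then have "f r = f 0" using linear_map_0[OF lin] by (auto simp: fun_eq_iff)
    then have "r = 0" using gf[OF elr] gf[OF elts_0] by metis
    then have "w = u" using wur by simp
    then show "homogeneous C (g + (0, 0)) (?g w')"
      using \<open>homogeneous C g u\<close> by (simp add: w_def zero_prod_def[symmetric])
  qed
  show ?thesis using l c d by (simp add: chain_map_def)
qed

lemma chain_map_comp_matrix:
  assumes f: "chain_map (mons 1) C D f" and g: "chain_map (mons 1) D C g"
    and fin: "finite (basis C)" "finite (basis D)" and x: "x \<in> basis C" "z \<in> basis C"
  shows "g (f (gen x)) z = normal_form (mons 1) (mm (basis D) (\<lambda>x. f (gen x)) (\<lambda>x. g (gen x)) x z)"
proof -
  have e: "gen x \<in> elts (mons 1) C" by (rule gen_elts[OF order_ideal_1 x(1)])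
  have "f (gen x) \<in> elts (mons 1) D" using f e by (auto simp: chain_map_def linear_map_def)
  then have "g (f (gen x)) = matmap (mons 1) (basis C) (basis C) (mm (basis D) (\<lambda>x. f (gen x)) (\<lambda>x. g (gen x))) (gen x)"
    using chain_map_matrix(1)[OF g order_ideal_1 fin(2,1)] chain_map_matrix(1)[OF f order_ideal_1 fin e]
      matmap_comp[OF order_ideal_1 fin] by metis
  then show ?thesis using matmap_gen[OF fin(1) x] by metis
qed

text \<open>
  Let \<open>\<partial>\<close>, here \<open>d'\<close>, square to zero, and let \<open>F\<close> and \<open>G\<close> with \<open>F G = 1\<close> commute with the
  differentials modulo \<open>UV\<close>.  The square of \<open>F \<partial> G\<close> is \<open>F \<partial> E E \<partial> G\<close> for the complementary projection
  \<open>E = G F + 1\<close>.  As \<open>E\<close> commutes with \<open>\<partial>\<close> modulo \<open>UV\<close> and \<open>F E = 0 = E G\<close>, both factors \<open>F \<partial> E\<close> and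
  \<open>E \<partial> G\<close> are divisible by \<open>UV\<close>.
\<close>

lemma retract_square_zero:
  assumes fin: "finite B" "finite B'"
    and FG: "\<And>x z. x \<in> B \<Longrightarrow> z \<in> B \<Longrightarrow> mm B' F G x z = unit_matrix x z"
    and F: "\<And>x z. x \<in> B \<Longrightarrow> z \<in> B' \<Longrightarrow> normal_form (mons 1) (mm B d F x z) = normal_form (mons 1) (mm B' F d' x z)"
    and G: "\<And>x z. x \<in> B' \<Longrightarrow> z \<in> B \<Longrightarrow> normal_form (mons 1) (mm B' d' G x z) = normal_form (mons 1) (mm B G d x z)"
    and sq: "\<And>x z. x \<in> B' \<Longrightarrow> z \<in> B' \<Longrightarrow> mm B' d' d' x z = 0"
    and x: "x \<in> B" and z: "z \<in> B"
  defines "A \<equiv> mm B' F (mm B' d' G)"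
  shows "normal_form (mons 2) (mm B A A x z) = 0" "normal_form (mons 1) (A x z) = normal_form (mons 1) (d x z)"
proof -
  let ?X = "mm B' F d'" and ?Y = "mm B' d' G" and ?E = "mm B G F + unit_matrix"
  have FE: "mm B' F ?E u v = 0" if u: "u \<in> B" and v: "v \<in> B'" for u v
  proof -
    have "mm B' F ?E u v = mm B (mm B' F G) F u v + F u v"
      unfolding mm_add_right plus_fun_apply mm_assoc[OF fin(2,1)] by (simp add: mm_unit_right fin v)
    also have "mm B (mm B' F G) F u v = mm B unit_matrix F u v" by (rule mm_cong) (simp_all add: FG u)
    also have "\<dots> = F u v" by (simp add: mm_unit_left fin u)
    finally show ?thesis by (simp only: FUV_add_self)
  qed
  have EG: "mm B' ?E G u v = 0" if u: "u \<in> B'" and v: "v \<in> B" for u v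
  proof -
    have "mm B' ?E G u v = mm B G (mm B' F G) u v + G u v"
      unfolding mm_add_left plus_fun_apply mm_assoc[OF fin] by (simp add: mm_unit_left fin u)
    also have "mm B G (mm B' F G) u v = mm B G unit_matrix u v" by (rule mm_cong) (simp_all add: FG v)
    also have "\<dots> = G u v" by (simp add: mm_unit_right fin v)
    finally show ?thesis by (simp only: FUV_add_self)
  qed
  have EE: "mm B' ?E ?E u v = ?E u v" if u: "u \<in> B'" and v: "v \<in> B'" for u v
  proof -
    have "mm B' ?E ?E u v = mm B G (mm B' F ?E) u v + ?E u v"
      by (subst mm_add_left) (simp only: plus_fun_apply mm_assoc[OF fin] mm_unit_left[OF fin(2) u])
    also have "mm B G (mm B' F ?E) u v = mm B G (\<lambda>_ _. 0) u v" by (rule mm_cong) (simp_all add: FE v)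
    finally show ?thesis by (simp add: mm_def)
  qed
  have XE: "normal_form (mons 1) (mm B' ?X ?E u v) = 0" if u: "u \<in> B" and v: "v \<in> B'" for u v
  proof -
    have "normal_form (mons 1) (mm B' ?X ?E u v) = normal_form (mons 1) (mm B' (mm B d F) ?E u v)"
      by (rule nf_mm_cong) (simp_all add: F u)
    also have "mm B' (mm B d F) ?E u v = mm B d (\<lambda>_ _. 0) u v"
      unfolding mm_assoc[OF fin] by (rule mm_cong) (simp_all add: FE v)
    finally show ?thesis by (simp add: mm_def)
  qed
  have EY: "normal_form (mons 1) (mm B' ?E ?Y u v) = 0" if u: "u \<in> B'" and v: "v \<in> B" for u v
  proof -
    have "normal_form (mons 1) (mm B' ?E ?Y u v) = normal_form (mons 1) (mm B' ?E (mm B G d) u v)"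
      by (rule nf_mm_cong) (simp_all add: G v)
    also have "mm B' ?E (mm B G d) u v = mm B (\<lambda>_ _. 0) d u v"
      unfolding mm_assoc[OF fin(2,1), symmetric] by (rule mm_cong) (simp_all add: EG u)
    finally show ?thesis by (simp add: mm_def)
  qed
  have XY: "mm B' ?X ?Y x z = 0"
  proof -
    have "mm B' ?X ?Y x z = mm B' F (mm B' (mm B' d' d') G) x z"
      by (simp only: mm_assoc[OF fin(2,2)])
    also have "\<dots> = mm B' F (\<lambda>_ _. 0) x z"
      by (rule mm_cong) (simp_all add: mm_def[of _ "mm B' d' d'"] sq)
    finally show ?thesis by (simp add: mm_def)
  qed
  have "mm B A A x z = mm B (mm B' ?X G) (mm B' F ?Y) x z"
    unfolding A_def mm_assoc[OF fin(2,2)] ..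
  also have "\<dots> = mm B' ?X (mm B' (mm B G F) ?Y) x z"
    by (simp only: mm_assoc[OF fin(1,2)] mm_assoc[OF fin(2,1)])
  also have "\<dots> = mm B' ?X (mm B' ?E ?Y) x z + mm B' ?X ?Y x z"
  proof -
    have "mm B' (mm B G F) ?Y u z = mm B' ?E ?Y u z + ?Y u z" if "u \<in> B'" for u
      unfolding mm_add_left plus_fun_apply mm_unit_left[OF fin(2) that] add.assoc FUV_add_self by simp
    then show ?thesis unfolding mm_def[of B' ?X] by (simp add: distrib_left sum.distrib)
  qed
  also have "\<dots> = mm B' ?X (mm B' (mm B' ?E ?E) ?Y) x z"
  proof -
    have "mm B' (mm B' ?E ?E) ?Y u z = mm B' ?E ?Y u z" if "u \<in> B'" for u
      by (rule mm_cong) (simp_all only: EE that)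
    then have "mm B' ?X (mm B' (mm B' ?E ?E) ?Y) x z = mm B' ?X (mm B' ?E ?Y) x z"
      by (intro mm_cong[OF refl]) simp
    then show ?thesis by (simp only: XY add_0_right)
  qed
  also have "\<dots> = mm B' (mm B' ?X ?E) (mm B' ?E ?Y) x z"
    by (simp only: mm_assoc[OF fin(2,2)])
  finally have "mm B A A x z = mm B' (mm B' ?X ?E) (mm B' ?E ?Y) x z" .
  moreover have "normal_form (mons 2) (mm B' (mm B' ?X ?E) (mm B' ?E ?Y) x z) = 0"
    unfolding mm_def[of B' "mm B' ?X ?E"] nf_sum using XE[OF x] EY[OF _ z] by (simp add: UV_mult_nf_2)
  ultimately show "normal_form (mons 2) (mm B A A x z) = 0" by simp
  have "normal_form (mons 1) (A x z) = normal_form (mons 1) (mm B' ?X G x z)"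
    unfolding A_def mm_assoc[OF fin(2,2)] ..
  also have "\<dots> = normal_form (mons 1) (mm B' (mm B d F) G x z)"
    by (rule nf_mm_cong) (simp_all add: F x)
  also have "mm B' (mm B d F) G x z = mm B d unit_matrix x z"
    unfolding mm_assoc[OF fin] by (rule mm_cong) (simp_all add: FG z)
  finally show "normal_form (mons 1) (A x z) = normal_form (mons 1) (d x z)"
    by (simp add: mm_unit_right fin z)
qed

text \<open>
  The local maps between the standard complex and \<open>K\<close>, composed with the isomorphism to \<open>C'\<close> and its
  inverse, give \<open>F\<close> and \<open>G\<close>.  Their composition \<open>P\<close> is invertible over \<open>F[U,V]\<close>, so that replacing \<open>G\<close> by
  \<open>G P\<^sup>-\<^sup>1\<close> makes the standard complex a retract.
\<close>

lemma realizable_imp_partially_realizable: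
  assumes nz: "nonzero_seq n a" and K: "K \<in> local_class (standard_complex n a)"
    and iso: "isomorphic 1 K C'" and D: "full_realization D C'"
  shows "partially_realizable (standard_complex n a)"
proof -
  define C where "C = standard_complex n a"
  have B: "basis C = {0..2 * n}" and fin: "finite (basis C)" and sb: "std_based n a C"
    by (simp_all add: C_def)
  obtain f g where f: "local_map C K f" and g: "local_map K C g" and kl: "knot_like K"
    using K by (auto simp: local_class_def locally_equivalent_def C_def)
  obtain i where i: "chain_map (mons 1) K C' i" "bij_betw i (elts (mons 1) K) (elts (mons 1) C')"
    using iso by (auto simp: isomorphic_def)
  have finK: "finite (basis K)" using kl by (simp add: knot_like_def chain_complex_def based_module_def)
  have bD: "based_module \<infinity> D" "chain_complex \<infinity> D" and BD: "basis D = basis C'" and grD: "\<And>x. x \<in> basis C' \<Longrightarrow> gr D x = gr C' x"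
    and dC': "\<And>x y. x \<in> basis C' \<Longrightarrow> y \<in> basis C' \<Longrightarrow> del C' x y = normal_form (mons 1) (del D x y)"
    using D by (auto simp: full_realization_def is_reduction_def chain_complex_def)
  have finC': "finite (basis C')" using bD BD by (simp add: based_module_def)
  define j where "j = inv_into (elts (mons 1) K) i"
  have j: "chain_map (mons 1) C' K j" unfolding j_def by (rule chain_map_inverse[OF i order_ideal_1 finK finC'])
  define f' g' where "f' = i \<circ> f" and "g' = g \<circ> j"
  have fc: "chain_map (mons 1) C K f" and gc: "chain_map (mons 1) K C g"
    using f g by (auto simp: local_map_def)
  have f': "chain_map (mons 1) C C' f'" and g': "chain_map (mons 1) C' C g'"
    unfolding f'_def g'_def using chain_map_comp fc gc i(1) j by blast+
  define F G where "F = (\<lambda>x. f' (gen x))" and "G = (\<lambda>x. g' (gen x))"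
  let ?B = "basis C" and ?B' = "basis C'"
  note MF = chain_map_matrix[OF f' order_ideal_1 fin finC', folded F_def]
    and MG = chain_map_matrix[OF g' order_ideal_1 finC' fin, folded G_def]
  define P where "P = mm ?B' F G"
  have hP: "hmat C C 0 P" using hmat_mm[OF MF(2) MG(2)] by (simp add: P_def)
  have commP: "normal_form (mons 1) (mm ?B (del C) P x z) = normal_form (mons 1) (mm ?B P (del C) x z)"
    if x: "x \<in> ?B" and z: "z \<in> ?B" for x z
  proof -
    have "normal_form (mons 1) (mm ?B (del C) P x z) = normal_form (mons 1) (mm ?B' (mm ?B (del C) F) G x z)"
      unfolding P_def mm_assoc[OF fin finC'] ..
    also have "\<dots> = normal_form (mons 1) (mm ?B' (mm ?B' F (del C')) G x z)"
      by (rule nf_mm_cong) (simp_all add: MF(3) x)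
    also have "\<dots> = normal_form (mons 1) (mm ?B' F (mm ?B' (del C') G) x z)"
      unfolding mm_assoc[OF finC' finC'] ..
    also have "\<dots> = normal_form (mons 1) (mm ?B' F (mm ?B G (del C)) x z)"
      by (rule nf_mm_cong) (simp_all add: MG(3) z)
    also have "\<dots> = normal_form (mons 1) (mm ?B P (del C) x z)"
      unfolding P_def mm_assoc[OF finC' fin] ..
    finally show ?thesis .
  qed
  have one: "lk (P 0 0) 0 = 1"
  proof -
    have z: "0 \<in> ?B" by (simp add: B)
    have "normal_form (range Vax) (mm (basis K) (\<lambda>x. f (gen x)) (\<lambda>x. g (gen x)) 0 0) \<noteq> 0"
      by (rule local_coeff_nonzero[OF axis_V pairing_std_V[OF nz sb] z _ _ fin finK fc gc])
        (use f g unmatched_V[OF nz] B mons_V_range in \<open>auto simp: local_map_def bij_betw_def\<close>)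
    moreover have "normal_form (mons 1) (P 0 0) = normal_form (mons 1) (mm (basis K) (\<lambda>x. f (gen x)) (\<lambda>x. g (gen x)) 0 0)"
    proof -
      have "f (gen 0) \<in> elts (mons 1) K"
        using fc gen_elts[OF order_ideal_1 z] by (auto simp: chain_map_def linear_map_def)
      then have "g' (f' (gen 0)) = g (f (gen 0))"
        using i(2) by (simp add: f'_def g'_def j_def bij_betw_def)
      then show ?thesis
        using chain_map_comp_matrix[OF f' g' fin finC' z z] chain_map_comp_matrix[OF fc gc fin finK z z]
        by (simp add: P_def F_def G_def)
    qed
    ultimately have "normal_form (range Vax) (P 0 0) \<noteq> 0"
      by (metis nf_subset[OF axis_in_1[OF axis_V]])
    then have "P 0 0 \<noteq> 0" by auto
    then show ?thesis using hmatD[OF hP z z] by (cases "lk (P 0 0) 0") auto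
  qed
  obtain Q where hQ: "hmat C C 0 Q"
    and PQ: "\<And>x z. x \<in> ?B \<Longrightarrow> z \<in> ?B \<Longrightarrow> mm ?B P Q x z = unit_matrix x z"
      "\<And>x z. x \<in> ?B \<Longrightarrow> z \<in> ?B \<Longrightarrow> mm ?B Q P x z = unit_matrix x z"
    using std_self_map_invertible[OF nz hP[unfolded C_def] commP[unfolded C_def] one] unfolding C_def by auto
  have commQ: "normal_form (mons 1) (mm ?B (del C) Q x z) = normal_form (mons 1) (mm ?B Q (del C) x z)"
    if x: "x \<in> ?B" and z: "z \<in> ?B" for x z
  proof -
    have "mm ?B (del C) Q x z = mm ?B (mm ?B Q P) (mm ?B (del C) Q) x z"
    proof -
      have "mm ?B (mm ?B Q P) (mm ?B (del C) Q) x z = mm ?B unit_matrix (mm ?B (del C) Q) x z"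
        by (rule mm_cong) (simp_all add: PQ x)
      then show ?thesis by (simp add: mm_unit_left fin x)
    qed
    also have "\<dots> = mm ?B Q (mm ?B (mm ?B P (del C)) Q) x z"
      by (simp only: mm_assoc[OF fin fin])
    also have "normal_form (mons 1) \<dots> = normal_form (mons 1) (mm ?B Q (mm ?B (mm ?B (del C) P) Q) x z)"
    proof (rule nf_mm_cong[OF order_ideal_1 refl])
      fix y assume "y \<in> ?B"
      then show "normal_form (mons 1) (mm ?B (mm ?B P (del C)) Q y z) = normal_form (mons 1) (mm ?B (mm ?B (del C) P) Q y z)"
        by - (rule nf_mm_cong, simp_all add: commP)
    qed
    also have "mm ?B Q (mm ?B (mm ?B (del C) P) Q) x z = mm ?B (mm ?B Q (del C)) (mm ?B P Q) x z"
      by (simp only: mm_assoc[OF fin fin])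
    also have "\<dots> = mm ?B (mm ?B Q (del C)) unit_matrix x z"
      by (rule mm_cong) (simp_all add: PQ z)
    finally show ?thesis by (simp add: mm_unit_right fin z)
  qed
  define G' where "G' = mm ?B G Q"
  have FG': "mm ?B' F G' x z = unit_matrix x z" if "x \<in> ?B" "z \<in> ?B" for x z
    using PQ(1)[OF that] by (simp add: G'_def P_def mm_assoc[OF finC' fin])
  have nfd: "normal_form (mons 1) (del D x y) = normal_form (mons 1) (del C' x y)" if "x \<in> ?B'" "y \<in> ?B'" for x y
    using dC'[OF that] by simp
  have F2: "normal_form (mons 1) (mm ?B (del C) F x z) = normal_form (mons 1) (mm ?B' F (del D) x z)"
    if "x \<in> ?B" "z \<in> ?B'" for x z
    unfolding MF(3)[OF that] by (rule nf_mm_cong) (simp_all add: nfd that)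
  have G2: "normal_form (mons 1) (mm ?B' (del D) G' x z) = normal_form (mons 1) (mm ?B G' (del C) x z)"
    if x: "x \<in> ?B'" and z: "z \<in> ?B" for x z
  proof -
    have "normal_form (mons 1) (mm ?B' (del D) G' x z) = normal_form (mons 1) (mm ?B (mm ?B' (del C') G) Q x z)"
      unfolding G'_def mm_assoc[OF finC' fin] by (rule nf_mm_cong) (simp_all add: nfd x)
    also have "\<dots> = normal_form (mons 1) (mm ?B (mm ?B G (del C)) Q x z)"
      by (rule nf_mm_cong) (simp_all add: MG(3) x)
    also have "\<dots> = normal_form (mons 1) (mm ?B G (mm ?B (del C) Q) x z)"
      unfolding mm_assoc[OF fin fin] ..
    also have "\<dots> = normal_form (mons 1) (mm ?B G (mm ?B Q (del C)) x z)"
      by (rule nf_mm_cong) (simp_all add: commQ z)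
    finally show ?thesis unfolding G'_def mm_assoc[OF fin fin] .
  qed
  have sq: "mm ?B' (del D) (del D) x z = 0" if "x \<in> ?B'" "z \<in> ?B'" for x z
    using bD(2) that BD by (simp add: chain_complex_iff)
  define A where "A = mm ?B' F (mm ?B' (del D) G')"
  have rt: "normal_form (mons 2) (mm ?B A A x z) = 0" "normal_form (mons 1) (A x z) = normal_form (mons 1) (del C x z)"
    if "x \<in> ?B" "z \<in> ?B" for x z
    unfolding A_def
    by (rule retract_square_zero[OF fin finC', where d'="del D" and d="del C"]; fact FG' F2 G2 sq that)+
  have hA: "hmat C C (- (1, 1)) A"
  proof -
    have hd: "hmat C' C' (- (1, 1)) (del D)"
      using bD(1) grD BD by (auto simp: based_module_hmat hmat_def)
    show ?thesis
      using hmat_mm[OF MF(2) hmat_mm[OF hd hmat_mm[OF MG(2) hQ]]]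
      by (simp add: A_def G'_def)
  qed
  define E where "E = C\<lparr>del := \<lambda>x y. normal_form (mons 2) (A x y)\<rparr>"
  have E: "basis E = ?B" "gr E = gr C" "del E = (\<lambda>x y. normal_form (mons 2) (A x y))"
    by (simp_all add: E_def)
  have "hmat E E (- (1, 1)) (del E)"
    using hmat_nf[OF hA, of "mons 2"] by (simp add: hmat_def E)
  then have "based_module 2 E" using fin by (simp add: based_module_hmat E)
  moreover have "normal_form (mons 2) (mm (basis E) (del E) (del E) x z) = 0" if "x \<in> basis E" "z \<in> basis E" for x z
  proof -
    have "normal_form (mons 2) (mm ?B (del E) (del E) x z) = normal_form (mons 2) (mm ?B A A x z)"
      by (rule nf_mm_cong) (simp_all add: E)
    then show ?thesis using rt(1) that by (simp add: E)
  qed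
  ultimately have "chain_complex 2 E" by (simp add: chain_complex_iff)
  moreover have "is_reduction E C"
  proof -
    have "del C x y = normal_form (mons 1) (del E x y)" if "x \<in> ?B" "y \<in> ?B" for x y
      using rt(2)[OF that] by (simp add: E nf_subset[OF mons_1_2] C_def std_del_1)
    then show ?thesis by (simp add: is_reduction_def E)
  qed
  ultimately show ?thesis by (auto simp: partially_realizable_def partial_realization_def C_def)
qed

section \<open>Realizations as matrices over the two-element field\<close>

text \<open>
  The coefficients of the differential after setting \<open>U = V = 1\<close>; together with \<open>deg\<close>, the weight of
  an entry, they determine it.
\<close>

definition bits :: "'b based \<Rightarrow> 'b \<Rightarrow> 'b \<Rightarrow> bit" where
  "bits E x y = (if del E x y = 0 then 0 else 1)"

definition deg :: "'b based \<Rightarrow> 'b \<Rightarrow> 'b \<Rightarrow> int \<times> int" where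
  "deg E x y = gr E x - (1, 1) - gr E y"

text \<open>
  The weights of the monomials divisible by \<open>UV\<close>.
\<close>

definition diagonal :: "int \<times> int \<Rightarrow> bool" where
  "diagonal d \<longleftrightarrow> valid d \<and> fst d \<le> - 2 \<and> snd d \<le> - 2"

lemma bits_del:
  assumes "based_module i E" "x \<in> basis E" "y \<in> basis E"
  shows "del E x y = mk (deg E x y) (bits E x y)"
proof -
  have h: "hmat E E (- (1, 1)) (del E)" using assms by (simp add: based_module_hmat)
  have d: "gr E x + - (1, 1) - gr E y = deg E x y" by (simp add: deg_def prod_eq_iff)
  show ?thesis
    using hmatD[OF h assms(2,3), unfolded d]
    by (cases "lk (del E x y) (expo (deg E x y))") (auto simp: bits_def)
qed

lemma bits_valid:
  assumes "based_module i E" "x \<in> basis E" "y \<in> basis E" "bits E x y \<noteq> 0"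
  shows "valid (deg E x y)"
  using bits_del[OF assms(1-3)] assms(4) mk_eq_0[of "deg E x y" "bits E x y"]
  by (auto simp: bits_def split: if_splits)

lemma bits_conj [simp]: "bits (conj_complex E) = bits E"
  by (auto simp: bits_def fun_eq_iff swap_eq_iff)

lemma deg_conj [simp]: "deg (conj_complex E) x y = prod.swap (deg E x y)"
  by (cases "gr E x"; cases "gr E y") (simp add: deg_def)

text \<open>
  Over \<open>R_2\<close>, the square of the differential is divisible by \<open>U\<^sup>2V\<^sup>2\<close>; the conclusion describes the
  weight of \<open>\<partial>\<^sup>2/(UV)\<close>, which occurs in the cone below.
\<close>

lemma square_bits:
  assumes "chain_complex 2 E" "x \<in> basis E" "z \<in> basis E" "mm (basis E) (bits E) (bits E) x z \<noteq> 0"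
  shows "diagonal (gr E x - gr E z)"
proof -
  have b: "based_module 2 E" using assms by (simp add: chain_complex_def)
  let ?d = "gr E x - (2, 2) - gr E z"
  have dd: "deg E x y + deg E y z = ?d" for y by (simp add: deg_def prod_eq_iff)
  have "mm (basis E) (del E) (del E) x z = (\<Sum>y\<in>basis E. mk ?d (bits E x y * bits E y z))"
    unfolding mm_def
  proof (rule sum.cong[OF refl])
    fix y assume y: "y \<in> basis E"
    show "del E x y * del E y z = mk ?d (bits E x y * bits E y z)"
      using bits_valid[OF b assms(2) y] bits_valid[OF b y assms(3)]
      unfolding bits_del[OF b assms(2) y] bits_del[OF b y assms(3)] by (simp add: mk_mult dd)
  qed
  also have "\<dots> = mk ?d (mm (basis E) (bits E) (bits E) x z)" by (simp add: mm_def mk_sum)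
  finally have "mm (basis E) (del E) (del E) x z = mk ?d 1" using assms(4) by simp
  then have "normal_form (mons 2) (mk ?d 1) = 0"
    using assms by (metis chain_complex_iff one_le_numeral)
  moreover obtain y where y: "y \<in> basis E" "bits E x y * bits E y z \<noteq> 0"
    using assms(4) unfolding mm_def by (metis (no_types, lifting) sum.neutral)
  then have v: "valid ?d"
    using bits_valid[OF b assms(2) y(1)] bits_valid[OF b y(1) assms(3)] valid_add[of "deg E x y" "deg E y z"]
    by (simp add: dd)
  ultimately have "expo ?d \<notin> mons 2" using mk_eq_0[of ?d 1] by (auto simp: nf_mk split: if_splits)
  then have "2 \<le> - fst ?d div 2" "2 \<le> - snd ?d div 2" by (auto simp: expo_def)
  then show ?thesis using v by (auto simp: diagonal_def valid_def)
qed

lemma pairing_bits: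
  assumes b: "based_module i E" and pr: "pairing Vax E p s" and x: "x \<in> basis E" "y \<in> basis E"
  shows "bits E x y = 1 \<and> fst (deg E x y) = 0 \<longleftrightarrow> 0 < s x \<and> y = p x"
proof -
  have "normal_form (range Vax) (del E x y) = (if 0 < s x \<and> y = p x then UV_mono (Vax (nat (s x))) else 0)"
    using pr x by (simp add: pairing_def)
  then have 1: "0 < s x \<and> y = p x \<longleftrightarrow> normal_form (range Vax) (del E x y) \<noteq> 0" by simp
  show ?thesis
  proof (cases "bits E x y = 0")
    case zero: True
    then have "del E x y = 0" by (simp add: bits_def split: if_splits)
    then show ?thesis using 1 zero by simp
  next
    case False
    then have v: "valid (deg E x y)" using bits_valid[OF b x] by simp
    have "expo (deg E x y) \<in> range Vax \<longleftrightarrow> fst (deg E x y) = 0"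
      using v by (auto simp: expo_def valid_def image_iff)
    then show ?thesis
      unfolding 1 bits_del[OF b x] nf_mk using False v by (simp add: mk_eq_0)
  qed
qed

lemma bits_diag: "based_module i E \<Longrightarrow> x \<in> basis E \<Longrightarrow> bits E x x = 0"
  using bits_valid[of i E x x] by (cases "bits E x x") (auto simp: deg_def valid_def)

text \<open>
  In a complex over \<open>R_2\<close>, correct \<open>V^l z0\<close>, for the unmatched element \<open>z0\<close> modulo \<open>U\<close>, to a
  cycle: its boundary \<open>U V^l w\<close> modulo \<open>U\<^sup>2V\<^sup>2\<close> is a cycle modulo \<open>U\<close>, and as \<open>w\<close> does not involve
  \<open>z0\<close>, all terms of \<open>w\<close> are targets of vertical arrows; the sources of these arrows, with
  \<open>U\<close>-exponent 1, are the correction.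
\<close>

definition tower_row :: "'b based \<Rightarrow> ('b \<Rightarrow> 'b) \<Rightarrow> ('b \<Rightarrow> int) \<Rightarrow> 'b \<Rightarrow> 'b \<Rightarrow> bit" where
  "tower_row E p s z0 j =
     (if j = z0 \<or> (0 < s j \<and> bits E z0 (p j) = 1 \<and> fst (deg E z0 (p j)) = - 2) then 1 else 0)"

lemma tower_row_grade:
  assumes b: "based_module i E" and pr: "pairing Vax E p s" and z0: "z0 \<in> basis E"
    and j: "j \<in> basis E" "tower_row E p s z0 j \<noteq> 0" "j \<noteq> z0"
  shows "fst (gr E z0) - fst (gr E j) = - 2" "even (snd (gr E z0) - snd (gr E j))"
proof -
  have h: "0 < s j" "bits E z0 (p j) = 1" "fst (deg E z0 (p j)) = - 2" "p j \<in> basis E"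
    using j pr by (auto simp: tower_row_def pairing_def split: if_splits)
  have 1: "bits E j (p j) = 1" "fst (deg E j (p j)) = 0"
    using pairing_bits[OF b pr j(1) h(4)] h(1) by auto
  have v: "valid (deg E j (p j))" "valid (deg E z0 (p j))"
    using bits_valid[OF b j(1) h(4)] bits_valid[OF b z0 h(4)] 1 h by auto
  show "fst (gr E z0) - fst (gr E j) = - 2" using 1 h by (simp add: deg_def)
  have "snd (gr E z0) - snd (gr E j) = snd (deg E z0 (p j)) - snd (deg E j (p j))" by (simp add: deg_def)
  then show "even (snd (gr E z0) - snd (gr E j))" using v by (simp add: valid_def)
qed

text \<open>
  The boundary of the corrected element \<open>V^l (z0 + \<dots>)\<close> is divisible by \<open>U\<^sup>2\<close>.  Terms without \<open>U\<close> cannot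
  occur, as \<open>z0\<close> is unmatched.  A term \<open>z\<close> with \<open>U\<close>-exponent 1 in the boundary of \<open>z0\<close> is cancelled by the
  correction if \<open>z\<close> is the target of a vertical arrow; it is not the source of one, since otherwise
  \<open>\<partial>\<^sup>2 z0\<close> would contain the target with \<open>U\<close>-exponent 1; and it is not \<open>z0\<close>.
\<close>

lemma tower_row_boundary:
  assumes cc: "chain_complex 2 E" and pr: "pairing Vax E p s"
    and z0: "z0 \<in> basis E" "s z0 = 0" "\<forall>x\<in>basis E. s x = 0 \<longrightarrow> x = z0" and z: "z \<in> basis E"
    and nonzero: "(\<Sum>j\<in>basis E. tower_row E p s z0 j * bits E j z) \<noteq> 0"
  shows "fst (deg E z0 z) \<le> - 4" "even (fst (deg E z0 z))" "even (snd (deg E z0 z))"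
proof -
  let ?row = "tower_row E p s z0"
  have b: "based_module 2 E" using cc by (simp add: chain_complex_def)
  have fin: "finite (basis E)" using b by (simp add: based_module_def)
  note pb = pairing_bits[OF b pr]
  have row_deg: "fst (deg E z0 z) \<le> 0 \<and> even (fst (deg E z0 z)) \<and> even (snd (deg E z0 z)) \<and>
      (j \<noteq> z0 \<longrightarrow> fst (deg E z0 z) \<le> - 2 \<and> fst (deg E j z) = fst (deg E z0 z) + 2)"
    if j: "j \<in> basis E" "?row j * bits E j z \<noteq> 0" for j
  proof -
    have v: "valid (deg E j z)" using bits_valid[OF b j(1) z] j(2) by auto
    show ?thesis
    proof (cases "j = z0")
      case True
      then show ?thesis using v by (simp add: valid_def)
    next
      case False
      have r: "?row j \<noteq> 0" using j(2) by auto
      note g = tower_row_grade[OF b pr z0(1) j(1) r False]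
      have "fst (deg E z0 z) = fst (deg E j z) - 2"
        "snd (deg E z0 z) = snd (deg E j z) + (snd (gr E z0) - snd (gr E j))"
        using g(1) by (simp_all add: deg_def)
      then show ?thesis using v g(2) by (auto simp: valid_def)
    qed
  qed
  obtain j where j: "j \<in> basis E" "?row j * bits E j z \<noteq> 0"
    using nonzero by (metis (no_types, lifting) sum.neutral)
  note rd = row_deg[OF j]
  show "even (fst (deg E z0 z))" "even (snd (deg E z0 z))" using rd by auto
  have "fst (deg E z0 z) \<noteq> 0"
  proof
    assume 0: "fst (deg E z0 z) = 0"
    then have "j = z0" using rd by auto
    then have "0 < s z0" using pb[OF z0(1) z] j 0 by auto
    then show False using z0(2) by simp
  qed
  moreover have "fst (deg E z0 z) \<noteq> - 2"
  proof
    assume d: "fst (deg E z0 z) = - 2"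
    have pz: "p z \<in> basis E" "p (p z) = z" "s (p z) = - s z" using pr z by (auto simp: pairing_def)
    have summand: "?row j * bits E j z = (if j = p z then (if s z < 0 then bits E z0 z else 0) else 0)"
      if j: "j \<in> basis E" "j \<noteq> z0" for j
    proof (cases "j = p z \<and> s z < 0")
      case True
      then have "bits E j z = 1" using pb[OF j(1) z] pz by auto
      moreover have "?row j = bits E z0 z"
        using True d pz j by (cases "bits E z0 z") (simp_all add: tower_row_def)
      ultimately show ?thesis using True by simp
    next
      case False
      have "?row j * bits E j z = 0"
      proof (rule ccontr)
        assume nz: "?row j * bits E j z \<noteq> 0"
        then have "fst (deg E j z) = 0" using row_deg[OF j(1)] j(2) d by auto
        moreover have "bits E j z = 1" using nz by auto
        ultimately have "0 < s j" "z = p j" using pb[OF j(1) z] by auto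
        then show False using False pr j by (auto simp: pairing_def)
      qed
      then show ?thesis using False by auto
    qed
    have row0: "?row z0 = 1" by (simp add: tower_row_def)
    have "(\<Sum>j\<in>basis E. ?row j * bits E j z)
        = bits E z0 z + (\<Sum>j\<in>basis E - {z0}. ?row j * bits E j z)"
      using sum.remove[OF fin z0(1), of "\<lambda>j. ?row j * bits E j z"] row0 by simp
    also have "(\<Sum>j\<in>basis E - {z0}. ?row j * bits E j z)
        = (\<Sum>j\<in>basis E - {z0}. if j = p z then (if s z < 0 then bits E z0 z else 0) else 0)"
    proof (rule sum.cong[OF refl])
      fix j assume "j \<in> basis E - {z0}"
      then show "?row j * bits E j z = (if j = p z then (if s z < 0 then bits E z0 z else 0) else 0)"
        using summand by blast
    qed
    also have "\<dots> = (if s z < 0 then bits E z0 z else 0)"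
    proof (cases "s z < 0")
      case True
      then have "p z \<in> basis E - {z0}" using pz(1,3) z0(2) by auto
      then show ?thesis using fin True by (simp add: sum.delta)
    qed simp
    finally have nz: "bits E z0 z + (if s z < 0 then bits E z0 z else 0) \<noteq> 0"
      using nonzero by simp
    then have one: "bits E z0 z = 1" and sz: "\<not> s z < 0" by (auto split: if_splits)
    have "s z \<noteq> 0" using z0(3) z one bits_diag[OF b z0(1)] by auto
    then have sp: "0 < s z" using sz by simp
    have zp: "bits E z (p z) = 1" "fst (deg E z (p z)) = 0" using pb[OF z pz(1)] sp by auto
    \<comment> \<open>only the composition through z contributes: the other arrow from z0 would have to be vertical, or
          the arrow into p z would be the vertical one, which comes from z\<close>
    have "mm (basis E) (bits E) (bits E) z0 (p z) = (\<Sum>y\<in>basis E. if y = z then 1 else 0)"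
      unfolding mm_def
    proof (rule sum.cong[OF refl])
      fix y assume y: "y \<in> basis E"
      show "bits E z0 y * bits E y (p z) = (if y = z then 1 else 0)"
      proof (cases "y = z")
        case True
        then show ?thesis using one zp by simp
      next
        case False
        have "\<not> (bits E z0 y = 1 \<and> bits E y (p z) = 1)"
        proof
          assume h: "bits E z0 y = 1 \<and> bits E y (p z) = 1"
          then have v: "valid (deg E z0 y)" "valid (deg E y (p z))"
            using bits_valid[OF b z0(1) y] bits_valid[OF b y pz(1)] by auto
          have "fst (deg E z0 y) + fst (deg E y (p z)) = - 2"
            using d zp(2) by (simp add: deg_def)
          moreover have "fst (deg E z0 y) \<noteq> 0" using pb[OF z0(1) y] h z0(2) by auto
          ultimately have "fst (deg E y (p z)) = 0" using v unfolding valid_def by presburger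
          then have "0 < s y" "p z = p y" using pb[OF y pz(1)] h by auto
          then show False using False pr y pz by (metis pairing_def)
        qed
        then show ?thesis using False by (cases "bits E z0 y"; cases "bits E y (p z)") auto
      qed
    qed
    also have "\<dots> = 1" using fin z by simp
    finally have "diagonal (gr E z0 - gr E (p z))"
      using square_bits[OF cc z0(1) pz(1)] by simp
    then show False using d zp(2) by (simp add: diagonal_def deg_def)
  qed
  moreover have "fst (deg E z0 z) \<le> 0" "even (fst (deg E z0 z))" using rd by blast+
  ultimately show "fst (deg E z0 z) \<le> - 4" by presburger
qed


section \<open>Resolving a complex over \<open>R_2\<close>\<close>

text \<open>
  The three kinds of basis elements of the full realization: a copy \<open>Keep\<close> of the standard
  complex, which will split off modulo \<open>UV\<close>, a shifted \<open>Copy\<close>, and a standard complex with three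
  generators, \<open>Tower\<close>, that makes the homology of the second copy torsion.
\<close>

datatype blk = Keep nat | Copy nat | Tower nat

text \<open>The numbering of the basis by naturals, as required of representatives of a local class.\<close>

definition dec :: "nat \<Rightarrow> nat \<Rightarrow> blk" where
  "dec m y = (if y < m then Keep y else if y < 2 * m then Copy (y - m) else Tower (y - 2 * m))"

fun enc :: "nat \<Rightarrow> blk \<Rightarrow> nat" where
  "enc m (Keep i) = i"
| "enc m (Copy i) = m + i"
| "enc m (Tower i) = 2 * m + i"

definition blks :: "nat \<Rightarrow> blk set" where
  "blks m = Keep ` {..<m} \<union> Copy ` {..<m} \<union> Tower ` {..<3}"

lemma dec_enc: "b \<in> blks m \<Longrightarrow> dec m (enc m b) = b"
  by (auto simp: blks_def dec_def)

lemma enc_dec: "enc m (dec m y) = y"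
  by (auto simp: dec_def)

lemma dec_in: "y < 2 * m + 3 \<Longrightarrow> dec m y \<in> blks m"
  by (auto simp: dec_def blks_def)

lemma enc_less: "b \<in> blks m \<Longrightarrow> enc m b < 2 * m + 3"
  by (auto simp: blks_def)

lemma dec_bij: "bij_betw (dec m) {..<2 * m + 3} (blks m)"
  by (rule bij_betw_byWitness[where f'="enc m"]) (auto simp: dec_enc enc_dec dec_in enc_less)

lemma sum_dec: "(\<Sum>y<2 * m + 3. f (dec m y)) = (\<Sum>b\<in>blks m. f b)"
  using sum.reindex_bij_betw[OF dec_bij] .

lemma finite_blks [simp]: "finite (blks m)"
  by (simp add: blks_def)

lemma sum_blks:
  fixes f :: "blk \<Rightarrow> 'r::comm_ring_1"
  shows "(\<Sum>b\<in>blks m. f b) = (\<Sum>i<m. f (Keep i)) + (\<Sum>i<m. f (Copy i)) + (\<Sum>i<3. f (Tower i))"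
proof -
  have "(\<Sum>b\<in>blks m. f b) = sum f (Keep ` {..<m} \<union> Copy ` {..<m}) + sum f (Tower ` {..<3})"
    unfolding blks_def by (rule sum.union_disjoint) auto
  also have "sum f (Keep ` {..<m} \<union> Copy ` {..<m}) = sum f (Keep ` {..<m}) + sum f (Copy ` {..<m})"
    by (rule sum.union_disjoint) auto
  finally show ?thesis by (simp add: sum.reindex inj_on_def)
qed

lemma blks_cases:
  assumes "b \<in> blks m"
  obtains i where "i < m" "b = Keep i" | i where "i < m" "b = Copy i" | i where "i < 3" "b = Tower i"
  using assms by (auto simp: blks_def)

lemma blks_mem [simp]: "Keep i \<in> blks m \<longleftrightarrow> i < m" "Copy i \<in> blks m \<longleftrightarrow> i < m" "Tower i \<in> blks m \<longleftrightarrow> i < 3"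
  by (auto simp: blks_def)

text \<open>
  The differential of the cone, for a differential with bits \<open>e\<close> on \<open>Keep\<close> and \<open>Copy\<close>, \<open>t\<close> on \<open>Tower\<close>,
  and the map \<open>f\<close> from \<open>Tower\<close> to \<open>Copy\<close>.  Read with the gradings of \<open>cone_gr\<close>, the identity from \<open>Keep\<close>
  to \<open>Copy\<close> is multiplication by \<open>UV\<close>, and the entries from \<open>Copy\<close> and \<open>Tower\<close> to \<open>Keep\<close> are
  \<open>\<partial>\<^sup>2/(UV)\<close> and \<open>(\<partial> \<Phi> + \<Phi> \<partial>)/(UV)\<close>.
\<close>

fun cone_bits ::
    "nat \<Rightarrow> (nat \<Rightarrow> nat \<Rightarrow> 'r) \<Rightarrow> (nat \<Rightarrow> nat \<Rightarrow> 'r) \<Rightarrow> (nat \<Rightarrow> nat \<Rightarrow> 'r) \<Rightarrow> blk \<Rightarrow> blk \<Rightarrow> 'r::comm_ring_1" where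
  "cone_bits m e t f (Keep x) (Keep y) = e x y"
| "cone_bits m e t f (Keep x) (Copy y) = unit_matrix x y"
| "cone_bits m e t f (Keep x) (Tower y) = 0"
| "cone_bits m e t f (Copy x) (Keep y) = mm {..<m} e e x y"
| "cone_bits m e t f (Copy x) (Copy y) = e x y"
| "cone_bits m e t f (Copy x) (Tower y) = 0"
| "cone_bits m e t f (Tower x) (Keep y) = mm {..<m} f e x y + mm {..<3} t f x y"
| "cone_bits m e t f (Tower x) (Copy y) = f x y"
| "cone_bits m e t f (Tower x) (Tower y) = t x y"

lemma mm_blks:
  "mm (blks m) F G b c = (\<Sum>i<m. F b (Keep i) * G (Keep i) c) + (\<Sum>i<m. F b (Copy i) * G (Copy i) c)
     + (\<Sum>i<3. F b (Tower i) * G (Tower i) c)"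
  by (simp add: mm_def sum_blks)

lemma mm_sum: "(\<Sum>i\<in>I. F x i * G i z) = mm I F G x z"
  by (simp add: mm_def)

lemma sum_unit:
  fixes m :: nat
  shows "x < m \<Longrightarrow> (\<Sum>i<m. unit_matrix x i * F i) = (F x :: 'r::comm_ring_1)"
  "x < m \<Longrightarrow> (\<Sum>i<m. F i * unit_matrix i x) = (F x :: 'r::comm_ring_1)"
  using mm_unit_left[of "{..<m}" x "\<lambda>i _. F i" "()"] mm_unit_right[of "{..<m}" x "\<lambda>_. F" "()"]
  by (simp_all add: mm_def)

lemma mm_assoc_sum:
  fixes F :: "'x \<Rightarrow> 'y \<Rightarrow> 'r::comm_ring_1"
  assumes "finite I" "finite J"
  shows "(\<Sum>i\<in>I. mm J F G x i * H i z) = (\<Sum>j\<in>J. F x j * mm I G H j z)"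
  using fun_cong[OF fun_cong[OF mm_assoc[OF assms(2,1), of F G H]], of x z] by (simp add: mm_def)

lemma cone_bits_square:
  fixes e t f :: "nat \<Rightarrow> nat \<Rightarrow> 'r::comm_ring_1"
  assumes char2: "\<And>c::'r. c + c = 0"
    and t: "\<And>i j. mm {..<3} t t i j = 0" and b: "b \<in> blks m" and c: "c \<in> blks m"
  shows "mm (blks m) (cone_bits m e t f) (cone_bits m e t f) b c = 0"
proof -
  have tf: "(\<Sum>i<3. t x i * mm {..<3} t f i z) = 0" for x z
    using mm_assoc_sum[of "{..<3}" "{..<3}" t t x f z] by (simp add: t)
  have char2': "c + (c + d) = d" for c d :: 'r
    using char2[of c] by (simp flip: add.assoc)
  show ?thesis
    using b c
    by (elim blks_cases)
      (simp_all add: mm_blks sum_unit distrib_left distrib_right sum.distrib mm_assoc_sum mm_unit_right tf char2 char2'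
        mm_sum[where F=e and G=e] mm_sum[where F=f and G=e] mm_sum[where F=t and G=f] mm_sum[where F=t and G=t] t add.assoc add.left_commute add.commute)
qed

text \<open>
  The shifts by \<open>(1, 1)\<close> and \<open>(2, 2)\<close> account for the division by \<open>UV\<close> in the entries between the
  three parts, and for the degree of the cone construction.
\<close>

fun cone_gr :: "(nat \<Rightarrow> int \<times> int) \<Rightarrow> (nat \<Rightarrow> int \<times> int) \<Rightarrow> blk \<Rightarrow> int \<times> int" where
  "cone_gr g h (Keep i) = g i"
| "cone_gr g h (Copy i) = g i + (1, 1)"
| "cone_gr g h (Tower i) = h i + (2, 2)"

definition tower_bits :: "nat \<Rightarrow> nat \<Rightarrow> bit" where
  "tower_bits i j = (if i = 1 \<and> (j = 0 \<or> j = 2) then 1 else 0)"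

text \<open>
  The gradings of the complex \<open>T\<close> with \<open>\<partial> t_1 = U^N t_0 + V^N t_2\<close>.
\<close>

definition tower_gr :: "int \<Rightarrow> nat \<Rightarrow> int \<times> int" where
  "tower_gr N i = (if i = 0 then (0, - 2 * N) else if i = 1 then (1 - 2 * N, 1 - 2 * N) else (- 2 * N, 0))"

definition tower_map :: "nat \<Rightarrow> (nat \<Rightarrow> int) \<Rightarrow> nat based \<Rightarrow> nat \<Rightarrow> nat \<Rightarrow> bit" where
  "tower_map n a E i j =
     (if i = 0 then tower_row E std_pV (std_sV a) 0 j
      else if i = 2 then tower_row (conj_complex E) (std_pU n) (std_sU n a) (2 * n) j else 0)"

text \<open>
  The exponent \<open>N\<close>.  It exceeds all gradings of the given complex by at least 4, so that all
  exponents that have to be positive, or at least 2, are.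
\<close>

definition height :: "'b based \<Rightarrow> int" where
  "height E = 4 + (\<Sum>j\<in>basis E. \<bar>fst (gr E j)\<bar> + \<bar>snd (gr E j)\<bar>)"

definition cone_complex :: "nat \<Rightarrow> (nat \<Rightarrow> int) \<Rightarrow> nat based \<Rightarrow> nat based" where
  "cone_complex n a E =
    (let m = Suc (2 * n);
         g = (\<lambda>x. cone_gr (gr E) (tower_gr (height E)) (dec m x))
     in \<lparr>basis = {..<2 * m + 3}, gr = g,
         del = (\<lambda>x y. mk (g x - (1, 1) - g y)
           (cone_bits m (bits E) tower_bits (tower_map n a E) (dec m x) (dec m y)))\<rparr>)"

lemma mm_mk:
  assumes "\<And>y. y \<in> I \<Longrightarrow> A x y \<noteq> 0 \<Longrightarrow> valid (d1 x y)" "\<And>y. y \<in> I \<Longrightarrow> A' y z \<noteq> 0 \<Longrightarrow> valid (d2 y z)"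
    and "\<And>y. d1 x y + d2 y z = d"
  shows "mm I (\<lambda>x y. mk (d1 x y) (A x y)) (\<lambda>y z. mk (d2 y z) (A' y z)) x z = mk d (mm I A A' x z)"
  unfolding mm_def mk_sum by (rule sum.cong[OF refl]) (simp add: mk_mult assms)

lemma nf_mk_diagonal: "(c \<noteq> 0 \<Longrightarrow> diagonal d) \<Longrightarrow> normal_form (mons 1) (mk d c) = 0"
  by (cases c) (auto simp: nf_mk diagonal_def expo_def)

lemma nf_axis_nf_1: "axis xe \<Longrightarrow> normal_form (mons 1) p = 0 \<Longrightarrow> normal_form (range xe) p = 0"
  by (metis axis_in_1 nf_subset nf_0)

lemma less_3_cases: "(i::nat) < 3 \<Longrightarrow> i = 0 \<or> i = 1 \<or> i = 2"
  by linarith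

lemma expo_axis: "valid d \<Longrightarrow> expo d \<in> range Vax \<longleftrightarrow> fst d = 0" "valid d \<Longrightarrow> expo d \<in> range Uax \<longleftrightarrow> snd d = 0"
proof -
  assume "valid d"
  then obtain k where "d = wt k" by (auto simp: valid_iff)
  then show "expo d \<in> range Vax \<longleftrightarrow> fst d = 0" "expo d \<in> range Uax \<longleftrightarrow> snd d = 0"
    by (cases k; auto simp: wt.simps expo_def)+
qed

lemma cone_gr_diff:
  "cone_gr g h (Keep x) - (1, 1) - cone_gr g h (Keep y) = g x - (1, 1) - g y"
  "cone_gr g h (Copy x) - (1, 1) - cone_gr g h (Copy y) = g x - (1, 1) - g y"
  "cone_gr g h (Copy x) - (1, 1) - cone_gr g h (Keep y) = g x - g y"
  "cone_gr g h (Tower i) - (1, 1) - cone_gr g h (Keep y) = h i - g y + (1, 1)"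
  "cone_gr g h (Tower i) - (1, 1) - cone_gr g h (Copy y) = h i - g y"
  "cone_gr g h (Tower i) - (1, 1) - cone_gr g h (Tower j) = h i - (1, 1) - h j"
  by (simp_all add: prod_eq_iff)

lemma tower_bits_square: "mm {..<3} tower_bits tower_bits i j = 0"
  unfolding mm_def by (rule sum.neutral) (auto simp: tower_bits_def)

lemma mk_even: "even i \<Longrightarrow> even j \<Longrightarrow> i \<le> 0 \<Longrightarrow> j \<le> 0 \<Longrightarrow> mk (i, j) 1 = UV_mono (nat (- i div 2), nat (- j div 2))"
  by (simp add: mk_def valid_def expo_def UV_mono_def)

fun cone_p :: "nat \<Rightarrow> nat \<Rightarrow> nat \<Rightarrow> (nat \<Rightarrow> nat) \<Rightarrow> blk \<Rightarrow> blk" where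
  "cone_p i0 i1 z p (Keep j) = Keep (p j)"
| "cone_p i0 i1 z p (Copy j) = (if j = z then Tower i0 else Copy (p j))"
| "cone_p i0 i1 z p (Tower i) = (if i = i0 then Copy z else if i = i1 then Tower 1 else Tower i1)"

fun cone_s :: "nat \<Rightarrow> nat \<Rightarrow> nat \<Rightarrow> nat \<Rightarrow> nat \<Rightarrow> (nat \<Rightarrow> int) \<Rightarrow> blk \<Rightarrow> int" where
  "cone_s i0 i1 z l N s (Keep j) = s j"
| "cone_s i0 i1 z l N s (Copy j) = (if j = z then - int l else s j)"
| "cone_s i0 i1 z l N s (Tower i) = (if i = i0 then int l else if i = i1 then - int N else int N)"

text \<open>
  The differential of the cone modulo one variable: two copies of the given matching \<open>d\<close>, whose
  unmatched element \<open>z\<close> in \<open>Copy\<close> is now the target of the arrow from \<open>Tower i0\<close>, and the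
  arrow from \<open>Tower 1\<close> to \<open>Tower i1\<close>.  In the reduction modulo \<open>U\<close>, \<open>i0\<close> is 0 and \<open>i1\<close> is 2, modulo \<open>V\<close>
  the other way round.
\<close>

fun cone_axis :: "(nat \<Rightarrow> nat \<times> nat) \<Rightarrow> nat \<Rightarrow> nat \<Rightarrow> nat \<Rightarrow> nat \<Rightarrow> nat \<Rightarrow> (nat \<Rightarrow> nat \<Rightarrow> FUV) \<Rightarrow> blk \<Rightarrow> blk \<Rightarrow> FUV" where
  "cone_axis xe i0 i1 z l N d (Keep x) (Keep y) = d x y"
| "cone_axis xe i0 i1 z l N d (Copy x) (Copy y) = d x y"
| "cone_axis xe i0 i1 z l N d (Tower i) (Copy y) = (if i = i0 \<and> y = z then UV_mono (xe l) else 0)"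
| "cone_axis xe i0 i1 z l N d (Tower i) (Tower j) = (if i = 1 \<and> j = i1 then UV_mono (xe N) else 0)"
| "cone_axis xe i0 i1 z l N d _ _ = 0"

text \<open>
  Only \<open>z\<close> in \<open>Keep\<close> remains unmatched, which gives the correct homology.
\<close>

lemma pairing_cone:
  assumes E: "pairing xe E p s" "basis E = {..<m}" and z: "z < m" "s z = 0" "\<forall>x<m. s x = 0 \<longrightarrow> x = z"
    and i: "i0 = 0 \<and> i1 = 2 \<or> i0 = 2 \<and> i1 = 0" and pos: "0 < l" "0 < N"
    and D: "basis D = {..<2 * m + 3}"
    and ent: "\<And>b c. b \<in> blks m \<Longrightarrow> c \<in> blks m \<Longrightarrow> normal_form (range xe) (del D (enc m b) (enc m c)) =
      cone_axis xe i0 i1 z l N (\<lambda>x y. normal_form (range xe) (del E x y)) b c"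
  shows "pairing xe D (\<lambda>x. enc m (cone_p i0 i1 z p (dec m x))) (\<lambda>x. cone_s i0 i1 z l N s (dec m x))"
    and "\<forall>x\<in>basis D. cone_s i0 i1 z l N s (dec m x) = 0 \<longrightarrow> x = z"
    and "cone_s i0 i1 z l N s (dec m z) = 0"
proof -
  let ?p = "cone_p i0 i1 z p" and ?s = "cone_s i0 i1 z l N s"
  have Ep: "p x < m" "p (p x) = x" "s (p x) = - s x" "s x = 0 \<Longrightarrow> p x = x" if "x < m" for x
    using E that by (auto simp: pairing_def)
  have pz: "p x = z \<longleftrightarrow> x = z" if "x < m" for x
    using Ep[of x] Ep[of z] z that by metis
  have Ed: "normal_form (range xe) (del E x y) = (if 0 < s x \<and> y = p x then UV_mono (xe (nat (s x))) else 0)"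
    if "x < m" "y < m" for x y
    using E that by (simp add: pairing_def)
  have i': "i0 < 3" "i1 < 3" "i0 \<noteq> i1" "i0 \<noteq> 1" "i1 \<noteq> 1" using i by auto
  have tower: "k = i0 \<or> k = i1 \<or> k = 1" if "k < 3" for k using that i by auto
  have P: "?p b \<in> blks m \<and> ?p (?p b) = b \<and> ?s (?p b) = - ?s b \<and> (?s b = 0 \<longrightarrow> ?p b = b)" if "b \<in> blks m" for b
    using that
  proof (cases rule: blks_cases)
    case (1 j)
    then show ?thesis using Ep[OF 1(1)] by auto
  next
    case (2 j)
    then show ?thesis using Ep[OF 2(1)] pz[OF 2(1)] i' z(1) pos by (cases "j = z") auto
  next
    case (3 k)
    then show ?thesis using tower[OF 3(1)] i' z(1) pos by auto
  qed
  have S: "cone_axis xe i0 i1 z l N (\<lambda>x y. normal_form (range xe) (del E x y)) b c =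
      (if 0 < ?s b \<and> c = ?p b then UV_mono (xe (nat (?s b))) else 0)" if "b \<in> blks m" "c \<in> blks m" for b c
    using that(1)
  proof (cases rule: blks_cases)
    case (1 j)
    then show ?thesis using Ed[OF 1(1)] that(2) by (cases c) auto
  next
    case (2 j)
    then show ?thesis using Ed[OF 2(1)] that(2) z(2) pos by (cases "j = z"; cases c) auto
  next
    case (3 k)
    then show ?thesis using tower[OF 3(1)] i' pos that(2) by (cases c) auto
  qed
  show "pairing xe D (\<lambda>x. enc m (?p (dec m x))) (\<lambda>x. ?s (dec m x))"
    unfolding pairing_def D
  proof (intro conjI ballI)
    fix x assume x: "x \<in> {..<2 * m + 3}"
    then have b: "dec m x \<in> blks m" by (simp add: dec_in)
    note Pb = P[OF b]
    show "enc m (?p (dec m x)) \<in> {..<2 * m + 3}" using Pb by (simp add: enc_less)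
    show "enc m (?p (dec m (enc m (?p (dec m x))))) = x" using Pb by (simp add: dec_enc enc_dec)
    show "?s (dec m (enc m (?p (dec m x)))) = - ?s (dec m x)" using Pb by (simp add: dec_enc)
    show "?s (dec m x) = 0 \<longrightarrow> enc m (?p (dec m x)) = x" using Pb by (simp add: enc_dec)
    fix y assume y: "y \<in> {..<2 * m + 3}"
    then have c: "dec m y \<in> blks m" by (simp add: dec_in)
    have "y = enc m (?p (dec m x)) \<longleftrightarrow> dec m y = ?p (dec m x)"
      using Pb by (metis dec_enc enc_dec)
    then show "normal_form (range xe) (del D x y) =
      (if 0 < ?s (dec m x) \<and> y = enc m (?p (dec m x)) then UV_mono (xe (nat (?s (dec m x)))) else 0)"
      using ent[OF b c] S[OF b c] by (simp add: enc_dec)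
  qed
  have "?s b = 0 \<Longrightarrow> b = Keep z" if "b \<in> blks m" for b
    using that i z(3) pos by (elim blks_cases) (auto split: if_splits)
  then show "\<forall>x\<in>basis D. ?s (dec m x) = 0 \<longrightarrow> x = z"
    unfolding D by (metis dec_in enc.simps(1) enc_dec lessThan_iff)
  show "?s (dec m z) = 0" using z(1,2) by (simp add: dec_def)
qed


text \<open>
  Within this locale, \<open>D\<close> is the full realization constructed from the partial realization \<open>E\<close>, and
  \<open>M\<close> and \<open>G\<close> are its bits and gradings on the three parts.
\<close>

locale partial_real =
  fixes n :: nat and a :: "nat \<Rightarrow> int" and E :: "nat based"
  assumes nz: "nonzero_seq n a" and lift: "std_lift n a E" and cc: "chain_complex 2 E"
begin

abbreviation m :: nat where "m \<equiv> Suc (2 * n)"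
abbreviation N :: int where "N \<equiv> height E"
abbreviation e :: "nat \<Rightarrow> nat \<Rightarrow> bit" where "e \<equiv> bits E"
abbreviation f :: "nat \<Rightarrow> nat \<Rightarrow> bit" where "f \<equiv> tower_map n a E"
abbreviation M :: "blk \<Rightarrow> blk \<Rightarrow> bit" where "M \<equiv> cone_bits m e tower_bits f"
abbreviation G :: "blk \<Rightarrow> int \<times> int" where "G \<equiv> cone_gr (gr E) (tower_gr N)"
abbreviation D :: "nat based" where "D \<equiv> cone_complex n a E"

lemma B: "basis E = {..<m}" "basis E = {0..2 * n}"
  using lift by (auto simp: std_lift_def std_based_def)

lemma bE: "based_module 2 E" and sb: "std_based n a E"
  using lift by (auto simp: std_lift_def)

lemma prV: "pairing Vax E std_pV (std_sV a)" and prU: "pairing Uax E (std_pU n) (std_sU n a)"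
  using pairing_std_V[OF nz sb] pairing_std_U[OF nz sb] by auto

lemma ends: "fst (gr E 0) = 0" "snd (gr E (2 * n)) = 0"
  using standard_complex_grading(2,3)[OF nz nz] lift by (auto simp: std_lift_def)

lemma parity: "x < m \<Longrightarrow> even (fst (gr E x)) \<longleftrightarrow> even x" "x < m \<Longrightarrow> even (snd (gr E x)) \<longleftrightarrow> even x"
  using standard_complex_parity[OF nz, of x] lift by (auto simp: std_lift_def)

lemma bound:
  assumes "x < m"
  shows "\<bar>fst (gr E x)\<bar> + 4 \<le> N" "\<bar>snd (gr E x)\<bar> + 4 \<le> N"
proof -
  have "\<bar>fst (gr E x)\<bar> + \<bar>snd (gr E x)\<bar> \<le> (\<Sum>j\<in>basis E. \<bar>fst (gr E j)\<bar> + \<bar>snd (gr E j)\<bar>)"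
    using member_le_sum[of x "basis E" "\<lambda>j. \<bar>fst (gr E j)\<bar> + \<bar>snd (gr E j)\<bar>"] assms B(1) by simp
  then show "\<bar>fst (gr E x)\<bar> + 4 \<le> N" "\<bar>snd (gr E x)\<bar> + 4 \<le> N" by (simp_all add: height_def)
qed

lemma N_pos: "4 \<le> N"
  using bound[of 0] by simp

lemma D_simps:
  "basis D = {..<2 * m + 3}" "gr D = (\<lambda>x. G (dec m x))"
  "del D = (\<lambda>x y. mk (G (dec m x) - (1, 1) - G (dec m y)) (M (dec m x) (dec m y)))"
  by (simp_all add: cone_complex_def Let_def)

lemma e_valid: "x < m \<Longrightarrow> y < m \<Longrightarrow> e x y \<noteq> 0 \<Longrightarrow> valid (gr E x - (1, 1) - gr E y)"
  using bits_valid[OF bE, of x y] B(1) by (simp add: deg_def)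

lemma f0: "f 0 0 = 1" "f 2 (2 * n) = 1" "f 1 j = 0"
  by (simp_all add: tower_map_def tower_row_def)

lemma f_grade:
  assumes j: "j < m"
  shows "f 0 j \<noteq> 0 \<Longrightarrow> (j = 0 \<or> fst (gr E j) = 2) \<and> even (snd (gr E j))"
    "f 2 j \<noteq> 0 \<Longrightarrow> (j = 2 * n \<or> snd (gr E j) = 2) \<and> even (fst (gr E j))"
proof -
  assume f: "f 0 j \<noteq> 0"
  show "(j = 0 \<or> fst (gr E j) = 2) \<and> even (snd (gr E j))"
  proof (cases "j = 0")
    case True
    then show ?thesis using parity(2)[of 0] by simp
  next
    case False
    then show ?thesis
      using tower_row_grade[OF bE prV, of 0 j] f B(1) j ends parity(2)[of 0] by (auto simp: tower_map_def)
  qed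
next
  assume f: "f 2 j \<noteq> 0"
  show "(j = 2 * n \<or> snd (gr E j) = 2) \<and> even (fst (gr E j))"
  proof (cases "j = 2 * n")
    case True
    then show ?thesis using parity(1)[of "2 * n"] by simp
  next
    case False
    then show ?thesis
      using tower_row_grade[OF based_module_conj[OF bE] pairing_conj(1)[OF prU], of "2 * n" j]
        f B(1) j ends parity(1)[of "2 * n"] by (auto simp: tower_map_def)
  qed
qed

lemma f_valid:
  assumes i: "i < 3" and j: "j < m" and f: "f i j \<noteq> 0"
  shows "valid (tower_gr N i - gr E j)"
    "even (fst (gr E j))" "even (snd (gr E j))"
    "i = 0 \<Longrightarrow> snd (tower_gr N i - gr E j) \<le> - 2" "i = 2 \<Longrightarrow> fst (tower_gr N i - gr E j) \<le> - 2"
proof -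
  consider "i = 0" | "i = 2" using less_3_cases[OF i] f f0(3) by auto
  note c = this
  have ev: "even (fst (gr E j)) \<and> even (snd (gr E j))"
    using c f_grade[OF j] f parity[OF j] by cases auto
  then show "even (fst (gr E j))" "even (snd (gr E j))" by auto
  have b: "- 2 * N - fst (gr E j) \<le> - 2" "- 2 * N - snd (gr E j) \<le> - 2" using bound[OF j] by linarith+
  show "valid (tower_gr N i - gr E j)"
    using c
  proof cases
    case 1
    then have "fst (gr E j) \<ge> 0" using f_grade(1)[OF j] f ends by auto
    then show ?thesis using 1 ev b by (simp add: valid_def tower_gr_def)
  next
    case 2
    then have "snd (gr E j) \<ge> 0" using f_grade(2)[OF j] f ends by auto
    then show ?thesis using 2 ev b by (simp add: valid_def tower_gr_def)
  qed
  show "i = 0 \<Longrightarrow> snd (tower_gr N i - gr E j) \<le> - 2" "i = 2 \<Longrightarrow> fst (tower_gr N i - gr E j) \<le> - 2"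
    using b by (auto simp: tower_gr_def)
qed

text \<open>
  The map \<open>f\<close> lifts to a chain map over \<open>R_2\<close>: the entries of \<open>\<partial> \<Phi> + \<Phi> \<partial>\<close> are divisible by \<open>U\<^sup>2V\<^sup>2\<close>.  For
  \<open>t_0\<close> and \<open>t_2\<close> one exponent is large by the choice of \<open>N\<close>, and the other one is at least 2 by
  \<open>tower_row_boundary\<close>; for \<open>t_1\<close>, both are large.
\<close>

lemma theta_diagonal:
  assumes i: "i < 3" and z: "z < m" and nonzero: "mm {..<m} f e i z + mm {..<3} tower_bits f i z \<noteq> 0"
  shows "diagonal (tower_gr N i - gr E z + (1, 1))"
proof -
  have b: "- 2 * N - fst (gr E z) + 1 \<le> - 2" "- 2 * N - snd (gr E z) + 1 \<le> - 2"
    "2 - 2 * N - fst (gr E z) \<le> - 2" "2 - 2 * N - snd (gr E z) \<le> - 2"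
    using bound[OF z] by linarith+
  have sV0: "std_sV a 0 = 0" and sU0: "std_sU n a (2 * n) = 0" by (simp_all add: std_sV_def std_sU_def)
  consider "i = 0" | "i = 1" | "i = 2" using i by linarith
  then show ?thesis
  proof cases
    case 1
    have "mm {..<3} tower_bits f i z = 0" unfolding mm_def by (rule sum.neutral) (simp add: tower_bits_def 1)
    then have "(\<Sum>j\<in>basis E. tower_row E std_pV (std_sV a) 0 j * e j z) \<noteq> 0"
      using nonzero 1 by (simp add: mm_def tower_map_def B(1))
    moreover have "\<forall>x\<in>basis E. std_sV a x = 0 \<longrightarrow> x = 0"
      using unmatched_V[OF nz] B(2) by simp
    ultimately have "fst (deg E 0 z) \<le> - 4" "even (fst (deg E 0 z))" "even (snd (deg E 0 z))"
      using tower_row_boundary[OF cc prV _ sV0] z by (simp_all add: B(1))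
    then show ?thesis
      using 1 b ends(1) parity(2)[of 0] by (simp add: diagonal_def valid_def deg_def tower_gr_def)
  next
    case 3
    have "mm {..<3} tower_bits f i z = 0" unfolding mm_def by (rule sum.neutral) (simp add: tower_bits_def 3)
    then have "(\<Sum>j\<in>basis (conj_complex E). tower_row (conj_complex E) (std_pU n) (std_sU n a) (2 * n) j * bits (conj_complex E) j z) \<noteq> 0"
      using nonzero 3 by (simp add: mm_def tower_map_def B(1))
    moreover have "\<forall>x\<in>basis (conj_complex E). std_sU n a x = 0 \<longrightarrow> x = 2 * n"
      using unmatched_U[OF nz] B(2) by simp
    ultimately have "fst (deg (conj_complex E) (2 * n) z) \<le> - 4" "even (fst (deg (conj_complex E) (2 * n) z))"
      "even (snd (deg (conj_complex E) (2 * n) z))"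
      using tower_row_boundary[OF chain_complex_conj[OF _ cc] pairing_conj(1)[OF prU] _ sU0] z
      by (simp_all add: B(1))
    then show ?thesis
      using 3 b ends(2) parity(1)[of "2 * n"] by (simp add: diagonal_def valid_def deg_def tower_gr_def)
  next
    case 2
    have "mm {..<m} f e i z = 0" unfolding mm_def by (rule sum.neutral) (simp add: f0 2)
    then have "mm {..<3} tower_bits f i z \<noteq> 0" using nonzero by simp
    then obtain j where j: "j \<in> {..<3}" "tower_bits i j * f j z \<noteq> 0"
      unfolding mm_def by (metis (no_types, lifting) sum.neutral)
    then have "f j z \<noteq> 0" by auto
    then have "even (fst (gr E z))" "even (snd (gr E z))" using f_valid(2,3)[of j z] j z by auto
    then show ?thesis using 2 b by (simp add: diagonal_def valid_def tower_gr_def)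
  qed
qed

text \<open>
  The bits of the cone define a matrix over \<open>F[U,V]\<close>, and the entries between \<open>Keep\<close> and the rest are
  divisible by \<open>UV\<close>.
\<close>

lemma support:
  assumes b: "b \<in> blks m" and c: "c \<in> blks m" and nonzero: "M b c \<noteq> 0"
  shows "valid (G b - (1, 1) - G c)"
    and "\<And>x y. (b, c) = (Keep x, Copy y) \<or> (b, c) = (Copy x, Keep y) \<or> (b, c) = (Tower x, Keep y)
      \<Longrightarrow> diagonal (G b - (1, 1) - G c)"
proof -
  have 1: "diagonal (G b - (1, 1) - G c)"
    if "(b, c) = (Keep x, Copy y) \<or> (b, c) = (Copy x, Keep y) \<or> (b, c) = (Tower x, Keep y)" for x y
    using that
  proof (elim disjE)
    assume h: "(b, c) = (Keep x, Copy y)"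
    then have "x = y" using nonzero by (auto simp: unit_matrix_def split: if_splits)
    then show ?thesis using h by (simp add: diagonal_def valid_def)
  next
    assume h: "(b, c) = (Copy x, Keep y)"
    then show ?thesis
      using nonzero b c square_bits[OF cc, of x y] B(1) by (simp add: cone_gr_diff del: cone_gr.simps)
  next
    assume h: "(b, c) = (Tower x, Keep y)"
    then show ?thesis
      using nonzero b c theta_diagonal[of x y] by (simp add: cone_gr_diff del: cone_gr.simps)
  qed
  then show "\<And>x y. (b, c) = (Keep x, Copy y) \<or> (b, c) = (Copy x, Keep y) \<or> (b, c) = (Tower x, Keep y)
      \<Longrightarrow> diagonal (G b - (1, 1) - G c)" .
  show "valid (G b - (1, 1) - G c)"
  proof (cases "\<exists>x y. (b, c) = (Keep x, Copy y) \<or> (b, c) = (Copy x, Keep y) \<or> (b, c) = (Tower x, Keep y)")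
    case True
    then show ?thesis using 1 by (auto simp: diagonal_def)
  next
    case False
    have t: "valid (tower_gr N i - (1, 1) - tower_gr N j)" if "tower_bits i j \<noteq> 0" for i j
      using that N_pos by (auto simp: tower_bits_def tower_gr_def valid_def split: if_splits)
    show ?thesis
      using b c False nonzero
      by (elim blks_cases) (simp_all add: cone_gr_diff e_valid f_valid(1) t del: cone_gr.simps)
  qed
qed

lemma D_based: "based_module \<infinity> D"
  by (auto simp: based_module_hmat hmat_def D_simps dest!: keys_mk)

lemma D_square: "x \<in> basis D \<Longrightarrow> z \<in> basis D \<Longrightarrow> mm (basis D) (del D) (del D) x z = 0"
proof -
  assume x: "x \<in> basis D" and z: "z \<in> basis D"
  have "mm (basis D) (del D) (del D) x z
      = mk (G (dec m x) - (2, 2) - G (dec m z)) (mm (basis D) (\<lambda>x y. M (dec m x) (dec m y)) (\<lambda>x y. M (dec m x) (dec m y)) x z)"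
    unfolding D_simps(3)
    by (rule mm_mk) (use x z support(1) in \<open>auto simp: D_simps(1) dec_in prod_eq_iff\<close>)
  also have "mm (basis D) (\<lambda>x y. M (dec m x) (dec m y)) (\<lambda>x y. M (dec m x) (dec m y)) x z
      = mm (blks m) M M (dec m x) (dec m z)"
    unfolding mm_def D_simps(1) by (rule sum_dec[of "\<lambda>b. M (dec m x) b * M b (dec m z)"])
  also have "\<dots> = 0"
    by (rule cone_bits_square) (use x z in \<open>simp_all add: D_simps(1) dec_in tower_bits_square\<close>)
  finally show ?thesis by simp
qed

lemma D_chain_complex: "chain_complex \<infinity> D"
  using D_based D_square by (simp add: chain_complex_iff)

lemma del_enc: "b \<in> blks m \<Longrightarrow> c \<in> blks m \<Longrightarrow> del D (enc m b) (enc m c) = mk (G b - (1, 1) - G c) (M b c)"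
  by (simp add: D_simps dec_enc)

lemma del_diag:
  assumes "x < m" "y < m"
  shows "mk (G (Keep x) - (1, 1) - G (Keep y)) (M (Keep x) (Keep y)) = del E x y"
    "mk (G (Copy x) - (1, 1) - G (Copy y)) (M (Copy x) (Copy y)) = del E x y"
  unfolding cone_gr_diff using bits_del[OF bE, of x y] assms B(1) by (simp_all add: deg_def)

lemma nf_1_off:
  assumes "b \<in> blks m" "c \<in> blks m"
    "(b, c) = (Keep x, Copy y) \<or> (b, c) = (Copy x, Keep y) \<or> (b, c) = (Tower x, Keep y)"
  shows "normal_form (mons 1) (mk (G b - (1, 1) - G c) (M b c)) = 0"
  by (rule nf_mk_diagonal, rule support(2)) (use assms in auto)

text \<open>The map from \<open>T\<close> takes \<open>t_0\<close> to \<open>V^lV x_0\<close> and \<open>t_2\<close> to \<open>U^lU x_2n\<close>, up to corrections.\<close>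

definition lV :: nat where "lV = nat (N + snd (gr E 0) div 2)"
definition lU :: nat where "lU = nat (N + fst (gr E (2 * n)) div 2)"

lemma l_pos: "0 < lV" "0 < lU"
  using bound[of 0] bound[of "2 * n"] unfolding lV_def lU_def by auto

text \<open>
  Modulo one variable only the entries within the three parts and from \<open>Tower\<close> to \<open>Copy\<close> survive.
\<close>

lemma axis_entries:
  assumes ax: "axis xe" and b: "b \<in> blks m" and c: "c \<in> blks m"
    and tc: "\<And>i j. i < 3 \<Longrightarrow> j < m \<Longrightarrow>
      normal_form (range xe) (mk (tower_gr N i - gr E j) (f i j)) = (if i = i0 \<and> j = z then UV_mono (xe l) else 0)"
    and tt: "\<And>i j. normal_form (range xe) (mk (tower_gr N i - (1, 1) - tower_gr N j) (tower_bits i j))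
      = (if i = 1 \<and> j = i1 then UV_mono (xe k) else 0)"
  shows "normal_form (range xe) (del D (enc m b) (enc m c)) =
    cone_axis xe i0 i1 z l k (\<lambda>x y. normal_form (range xe) (del E x y)) b c" (is "_ = ?R b c")
proof -
  note off = nf_axis_nf_1[OF ax nf_1_off[OF b c]]
  show ?thesis
    unfolding del_enc[OF b c]
    using b c
  proof (elim blks_cases)
    fix x y assume h: "x < m" "y < m" "b = Keep x" "c = Keep y"
    show "normal_form (range xe) (mk (G b - (1, 1) - G c) (M b c)) = ?R b c"
      unfolding h(3,4) del_diag[OF h(1,2)] by simp
  next
    fix x y assume h: "x < m" "y < m" "b = Copy x" "c = Copy y"
    show "normal_form (range xe) (mk (G b - (1, 1) - G c) (M b c)) = ?R b c"
      unfolding h(3,4) del_diag[OF h(1,2)] by simp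
  next
    fix x y assume h: "x < 3" "y < m" "b = Tower x" "c = Copy y"
    show "normal_form (range xe) (mk (G b - (1, 1) - G c) (M b c)) = ?R b c"
      unfolding h(3,4) cone_gr_diff using tc[OF h(1,2)] by simp
  next
    fix x y assume h: "x < 3" "y < 3" "b = Tower x" "c = Tower y"
    show "normal_form (range xe) (mk (G b - (1, 1) - G c) (M b c)) = ?R b c"
      unfolding h(3,4) cone_gr_diff using tt by simp
  qed (use off in auto)
qed

lemma axis_V_entries:
  assumes b: "b \<in> blks m" and c: "c \<in> blks m"
  shows "normal_form (range Vax) (del D (enc m b) (enc m c)) =
    cone_axis Vax 0 2 0 lV (nat N) (\<lambda>x y. normal_form (range Vax) (del E x y)) b c"
proof -
  have tc: "normal_form (range Vax) (mk (tower_gr N i - gr E j) (f i j)) = (if i = 0 \<and> j = 0 then UV_mono (Vax lV) else 0)"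
    if i: "i < 3" and j: "j < m" for i j
  proof (cases "f i j = 0")
    case True
    then show ?thesis using f0 by (cases "i = 0 \<and> j = 0"; cases "i = 2 \<and> j = 2 * n") auto
  next
    case False
    then have f1: "f i j = 1" by simp
    show ?thesis
    proof (cases "i = 0 \<and> j = 0")
      case True
      have ev: "even (snd (gr E 0))" using parity(2)[of 0] by simp
      have d: "tower_gr N i - gr E j = (0, - 2 * N - snd (gr E 0))"
        using True ends(1) by (simp add: tower_gr_def prod_eq_iff)
      have "mk (tower_gr N i - gr E j) (f i j) = UV_mono (0, nat (- (- 2 * N - snd (gr E 0)) div 2))"
        unfolding d f1 using ev bound[of 0] by (subst mk_even) auto
      also have "- (- 2 * N - snd (gr E 0)) div 2 = N + snd (gr E 0) div 2" using ev by (auto elim!: evenE)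
      finally show ?thesis using True by (simp add: nf_mono lV_def)
    next
      case c: False
      have v: "valid (tower_gr N i - gr E j)" using f_valid(1)[OF i j False] .
      have "fst (tower_gr N i - gr E j) \<noteq> 0"
      proof (cases "i = 0")
        case True
        then show ?thesis using f_grade(1)[OF j] False c by (auto simp: tower_gr_def)
      next
        case False
        then have "i = 2" using less_3_cases[OF i] f1 f0(3) by auto
        then show ?thesis using f_valid(5)[OF i j] f1 by auto
      qed
      then have "expo (tower_gr N i - gr E j) \<notin> range Vax" using expo_axis[OF v] by simp
      then show ?thesis using c by (auto simp: nf_mk)
    qed
  qed
  have tt: "normal_form (range Vax) (mk (tower_gr N i - (1, 1) - tower_gr N j) (tower_bits i j))
      = (if i = 1 \<and> j = 2 then UV_mono (Vax (nat N)) else 0)" for i j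
    using N_pos by (auto simp: tower_bits_def tower_gr_def mk_even nf_mono image_iff)
  show ?thesis by (rule axis_entries[OF axis_V b c tc tt])
qed

lemma axis_U_entries:
  assumes b: "b \<in> blks m" and c: "c \<in> blks m"
  shows "normal_form (range Uax) (del D (enc m b) (enc m c)) =
    cone_axis Uax 2 0 (2 * n) lU (nat N) (\<lambda>x y. normal_form (range Uax) (del E x y)) b c"
proof -
  have tc: "normal_form (range Uax) (mk (tower_gr N i - gr E j) (f i j)) = (if i = 2 \<and> j = 2 * n then UV_mono (Uax lU) else 0)"
    if i: "i < 3" and j: "j < m" for i j
  proof (cases "f i j = 0")
    case True
    then show ?thesis using f0 by (cases "i = 0 \<and> j = 0"; cases "i = 2 \<and> j = 2 * n") auto
  next
    case False
    then have f1: "f i j = 1" by simp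
    show ?thesis
    proof (cases "i = 2 \<and> j = 2 * n")
      case True
      have ev: "even (fst (gr E (2 * n)))" using parity(1)[of "2 * n"] by simp
      have d: "tower_gr N i - gr E j = (- 2 * N - fst (gr E (2 * n)), 0)"
        using True ends(2) by (simp add: tower_gr_def prod_eq_iff)
      have "mk (tower_gr N i - gr E j) (f i j) = UV_mono (nat (- (- 2 * N - fst (gr E (2 * n))) div 2), 0)"
        unfolding d f1 using ev bound[of "2 * n"] by (subst mk_even) auto
      also have "- (- 2 * N - fst (gr E (2 * n))) div 2 = N + fst (gr E (2 * n)) div 2" using ev by (auto elim!: evenE)
      finally show ?thesis using True by (simp add: nf_mono lU_def)
    next
      case c: False
      have v: "valid (tower_gr N i - gr E j)" using f_valid(1)[OF i j False] .
      have "snd (tower_gr N i - gr E j) \<noteq> 0"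
      proof (cases "i = 2")
        case True
        then show ?thesis using f_grade(2)[OF j] False c by (auto simp: tower_gr_def)
      next
        case False
        then have "i = 0" using less_3_cases[OF i] f1 f0(3) by auto
        then show ?thesis using f_valid(4)[OF i j] f1 by auto
      qed
      then have "expo (tower_gr N i - gr E j) \<notin> range Uax" using expo_axis[OF v] by simp
      then show ?thesis using c by (auto simp: nf_mk)
    qed
  qed
  have tt: "normal_form (range Uax) (mk (tower_gr N i - (1, 1) - tower_gr N j) (tower_bits i j))
      = (if i = 1 \<and> j = 0 then UV_mono (Uax (nat N)) else 0)" for i j
    using N_pos by (auto simp: tower_bits_def tower_gr_def mk_even nf_mono image_iff)
  show ?thesis by (rule axis_entries[OF axis_U b c tc tt])
qed

end

section \<open>Partially realizable complexes have realizable classes\<close>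

lemma chain_map_unit:
  assumes fin: "finite (basis C)" "finite (basis C')" and g: "\<And>x. x \<in> basis C \<Longrightarrow> x \<in> basis C' \<Longrightarrow> gr C x = gr C' x"
    and comm: "\<And>x z. x \<in> basis C \<Longrightarrow> z \<in> basis C' \<Longrightarrow>
      normal_form (mons 1) (mm (basis C) (del C) unit_matrix x z) = normal_form (mons 1) (mm (basis C') unit_matrix (del C') x z)"
  shows "chain_map (mons 1) C C' (matmap (mons 1) (basis C) (basis C') unit_matrix)"
  by (rule chain_map_matmap[OF order_ideal_1 fin _ comm])
    (use g in \<open>auto simp: hmat_def unit_matrix_def split: if_splits\<close>)

text \<open>
  Both for the inclusion of the standard complex into the reduction of the cone and for the
  projection to it, the matrix is the identity on the common basis elements.
\<close>

lemma unit_induced_bij: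
  assumes ax: "axis xe" and fin: "finite (basis C)" "finite (basis C')"
    and f: "chain_map (mons 1) C C' (matmap (mons 1) (basis C) (basis C') unit_matrix)"
    and z: "z \<in> basis C" "z \<in> basis C'"
    and pr: "pairing xe C p s" "s z = 0" "\<forall>x\<in>basis C. s x = 0 \<longrightarrow> x = z"
    and pr': "pairing xe C' p' s'" "s' z = 0" "\<forall>x\<in>basis C'. s' x = 0 \<longrightarrow> x = z"
  shows "bij_betw (induced_map (range xe) (UV_mono (xe 1)) C' (matmap (mons 1) (basis C) (basis C') unit_matrix))
    (hom_mod_tors (range xe) (UV_mono (xe 1)) C) (hom_mod_tors (range xe) (UV_mono (xe 1)) C')"
proof (rule induced_bij[OF f axis_ideal[OF ax] axis_in_1[OF ax] fin])
  show "free_generator (range xe) (UV_mono (xe 1)) C (gen z)"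
    by (rule pairing_free_generator[OF ax pr(1) fin(1) z(1) pr(2,3)])
  show "free_generator (range xe) (UV_mono (xe 1)) C' (gen z)"
    by (rule pairing_free_generator[OF ax pr'(1) fin(2) z(2) pr'(2,3)])
  have "normal_form (range xe) (unit_matrix z y) = gen z y" for y
  proof -
    have "0 \<in> range xe" using axis_0[OF ax] by (metis rangeI)
    then have "normal_form (range xe) 1 = 1" using nf_mono[of "range xe" 0] by (simp add: UV_mono_0)
    then show ?thesis by (auto simp: unit_matrix_def gen_def)
  qed
  note unit = this
  show "(reduce_elt (range xe) \<circ> matmap (mons 1) (basis C) (basis C') unit_matrix) (gen z) = gen z"
  proof (rule ext)
    fix y
    show "(reduce_elt (range xe) \<circ> matmap (mons 1) (basis C) (basis C') unit_matrix) (gen z) y = gen z y"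
    proof (cases "y \<in> basis C'")
      case True
      have "matmap (mons 1) (basis C) (basis C') unit_matrix (gen z) y = normal_form (mons 1) (unit_matrix z y)"
        by (rule matmap_gen[OF fin(1) z(1) True])
      then show ?thesis by (simp only: o_apply reduce_elt_def nf_subset[OF axis_in_1[OF ax]] unit)
    next
      case False
      then show ?thesis using z(2) by (auto simp: reduce_elt_def matmap_def gen_def)
    qed
  qed
qed

definition reduction :: "'b based \<Rightarrow> 'b based" where
  "reduction D = D\<lparr>del := \<lambda>x y. normal_form (mons 1) (del D x y)\<rparr>"

lemma reduction_simps [simp]: "basis (reduction D) = basis D" "gr (reduction D) = gr D"
  "del (reduction D) = (\<lambda>x y. normal_form (mons 1) (del D x y))"
  by (simp_all add: reduction_def)

lemma full_realization_reduction: "chain_complex \<infinity> D \<Longrightarrow> full_realization D (reduction D)"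
  by (simp add: full_realization_def is_reduction_def)

context partial_real
begin

lemma dec_keep [simp]: "x < m \<Longrightarrow> dec m x = Keep x"
  by (simp add: dec_def)

text \<open>
  Stated for all complexes that agree with the cone modulo \<open>UV\<close>, as it is applied to the cone and to
  its reduction.
\<close>

lemma pairing_D:
  assumes X: "basis X = basis D" "\<And>x y. x \<in> basis D \<Longrightarrow> y \<in> basis D \<Longrightarrow> normal_form (mons 1) (del X x y) = normal_form (mons 1) (del D x y)"
  shows "\<exists>p s. pairing Vax X p s \<and> s 0 = 0 \<and> (\<forall>x\<in>basis X. s x = 0 \<longrightarrow> x = 0)"
    and "\<exists>p s. pairing Uax X p s \<and> s (2 * n) = 0 \<and> (\<forall>x\<in>basis X. s x = 0 \<longrightarrow> x = 2 * n)"
proof -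
  have XD: "normal_form (range xe) (del X (enc m b) (enc m c)) = normal_form (range xe) (del D (enc m b) (enc m c))"
    if "axis xe" "b \<in> blks m" "c \<in> blks m" for xe b c
  proof -
    have "normal_form (mons 1) (del X (enc m b) (enc m c)) = normal_form (mons 1) (del D (enc m b) (enc m c))"
      by (rule X(2)) (use enc_less[OF that(2)] enc_less[OF that(3)] D_simps(1) in simp_all)
    from arg_cong[OF this, of "normal_form (range xe)"] show ?thesis
      by (simp add: nf_subset[OF axis_in_1[OF that(1)]])
  qed
  have N: "0 < nat N" using N_pos by simp
  have zV: "std_sV a 0 = 0" "\<forall>x<m. std_sV a x = 0 \<longrightarrow> x = 0" and zU: "std_sU n a (2 * n) = 0" "\<forall>x<m. std_sU n a x = 0 \<longrightarrow> x = 2 * n"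
    using unmatched_V[OF nz] unmatched_U[OF nz] by (auto simp: std_sV_def std_sU_def less_Suc_eq_le)
  have bX: "basis X = {..<2 * m + 3}" using X(1) D_simps(1) by simp
  have V': "pairing Vax X (\<lambda>x. enc m (cone_p 0 2 0 std_pV (dec m x))) (\<lambda>x. cone_s 0 2 0 lV (nat N) (std_sV a) (dec m x))"
    "\<forall>x\<in>basis X. cone_s 0 2 0 lV (nat N) (std_sV a) (dec m x) = 0 \<longrightarrow> x = 0"
    "cone_s 0 2 0 lV (nat N) (std_sV a) (dec m 0) = 0"
    using pairing_cone[OF prV B(1) _ zV _ l_pos(1) N bX, of 0 2] XD[OF axis_V] axis_V_entries by simp_all
  then show "\<exists>p s. pairing Vax X p s \<and> s 0 = 0 \<and> (\<forall>x\<in>basis X. s x = 0 \<longrightarrow> x = 0)" by blast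
  have U': "pairing Uax X (\<lambda>x. enc m (cone_p 2 0 (2 * n) (std_pU n) (dec m x))) (\<lambda>x. cone_s 2 0 (2 * n) lU (nat N) (std_sU n a) (dec m x))"
    "\<forall>x\<in>basis X. cone_s 2 0 (2 * n) lU (nat N) (std_sU n a) (dec m x) = 0 \<longrightarrow> x = 2 * n"
    "cone_s 2 0 (2 * n) lU (nat N) (std_sU n a) (dec m (2 * n)) = 0"
    using pairing_cone[OF prU B(1) _ zU _ l_pos(2) N bX, of 2 0] XD[OF axis_U] axis_U_entries by simp_all
  then show "\<exists>p s. pairing Uax X p s \<and> s (2 * n) = 0 \<and> (\<forall>x\<in>basis X. s x = 0 \<longrightarrow> x = 2 * n)" by blast
qed

lemma D_correct_homology:
  assumes X: "basis X = basis D" "gr X = gr D"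
    "\<And>x y. x \<in> basis D \<Longrightarrow> y \<in> basis D \<Longrightarrow> normal_form (mons 1) (del X x y) = normal_form (mons 1) (del D x y)"
  shows "correct_homology X"
proof -
  obtain p s p' s' where "pairing Vax X p s" "s 0 = 0" "\<forall>x\<in>basis X. s x = 0 \<longrightarrow> x = 0"
    and "pairing Uax X p' s'" "s' (2 * n) = 0" "\<forall>x\<in>basis X. s' x = 0 \<longrightarrow> x = 2 * n"
    using pairing_D[OF X(1,3)] by blast
  then show ?thesis
    using correct_homology_pairing[of X p s 0 p' s' "2 * n"] X(1,2) ends by (simp add: D_simps(1,2))
qed

lemma reduction_chain_complex: "chain_complex 1 (reduction D)"
proof -
  have b: "based_module 1 (reduction D)"
    using D_based hmat_nf[of D D "- (1, 1)" "del D" "mons 1"] by (simp add: based_module_hmat hmat_def)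
  obtain p s p' s' where "pairing Vax (reduction D) p s" "pairing Uax (reduction D) p' s'"
    using pairing_D[of "reduction D"] by auto
  then show ?thesis using pairing_chain_complex_1[OF b] by blast
qed

lemma reduction_knot_like: "knot_like (reduction D)"
  unfolding knot_like_def using reduction_chain_complex D_correct_homology[of "reduction D"] by simp

lemma std_nf: "x < m \<Longrightarrow> y < m \<Longrightarrow> normal_form (mons 1) (del E x y) = std_del a x y"
  using sb by (simp add: std_based_def)

lemma nf_1_D:
  assumes x: "x < 2 * m + 3" and z: "z < 2 * m + 3" and "x < m \<or> z < m"
  shows "normal_form (mons 1) (del D x z) = (if x < m \<and> z < m then std_del a x z else 0)"
proof -
  have b: "dec m x \<in> blks m" "dec m z \<in> blks m" using x z by (auto simp: dec_in)
  have d: "del D x z = mk (G (dec m x) - (1, 1) - G (dec m z)) (M (dec m x) (dec m z))" by (simp add: D_simps)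
  have k: "x < m \<longleftrightarrow> (\<exists>i. dec m x = Keep i)" for x by (auto simp: dec_def)
  show ?thesis
  proof (cases "x < m \<and> z < m")
    case True
    then show ?thesis using del_diag(1)[of x z] std_nf[of x z] unfolding d by simp
  next
    case both: False
    have "normal_form (mons 1) (del D x z) = 0"
    proof (cases "x < m")
      case True
      then have dx: "dec m x = Keep x" and nz': "\<nexists>i. dec m z = Keep i" using both True k by auto
      then consider y where "dec m z = Copy y" | y where "dec m z = Tower y" by (cases "dec m z") auto
      then show ?thesis
      proof cases
        case (1 y)
        then show ?thesis using nf_1_off[OF b, of x y] dx unfolding d by simp
      next
        case (2 y)
        then show ?thesis using dx unfolding d by simp
      qed
    next
      case False
      then have zm: "z < m" using assms(3) by simp
      then have dz: "dec m z = Keep z" by simp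
      have "\<nexists>i. dec m x = Keep i" using False k by auto
      then consider y where "dec m x = Copy y" | y where "dec m x = Tower y" by (cases "dec m x") auto
      then show ?thesis
        using nf_1_off[OF b, of _ z] dz unfolding d by cases auto
    qed
    then show ?thesis unfolding if_not_P[OF both] .
  qed
qed

lemma local_maps:
  shows "local_map (standard_complex n a) (reduction D) (matmap (mons 1) {0..2 * n} (basis D) unit_matrix)"
    "local_map (reduction D) (standard_complex n a) (matmap (mons 1) (basis D) {0..2 * n} unit_matrix)"
proof -
  let ?C = "standard_complex n a" and ?R = "reduction D"
  have fin: "finite (basis ?C)" "finite (basis ?R)" by (simp_all add: D_simps)
  have Bm: "{0..2 * n} = {..<m}" using B by simp
  have g: "gr ?C x = gr ?R x" if "x \<in> basis ?C" for x
    using that lift by (simp add: D_simps std_lift_def)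
  have sd: "std_del a x z = normal_form (mons 1) (std_del a x z)" for x z by (simp add: std_del_1)
  have f: "chain_map (mons 1) ?C ?R (matmap (mons 1) (basis ?C) (basis ?R) unit_matrix)"
  proof (rule chain_map_unit[OF fin g])
    fix x z assume x: "x \<in> basis ?C" and z: "z \<in> basis ?R"
    have x': "x < m" "x < 2 * m + 3" "z < 2 * m + 3" using x z by (auto simp: D_simps)
    have "mm (basis ?C) (del ?C) unit_matrix x z = (if z < m then std_del a x z else 0)"
    proof (cases "z < m")
      case True
      then show ?thesis using mm_unit_right[of "{0..2 * n}" z "std_del a" x] by simp
    next
      case False
      then show ?thesis by (auto simp: mm_def unit_matrix_def intro: sum.neutral)
    qed
    moreover have "mm (basis ?R) unit_matrix (del ?R) x z = normal_form (mons 1) (del D x z)"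
      using mm_unit_left[of "basis ?R" x "del ?R" z] fin(2) x'(2) by (simp add: D_simps)
    ultimately show "normal_form (mons 1) (mm (basis ?C) (del ?C) unit_matrix x z)
        = normal_form (mons 1) (mm (basis ?R) unit_matrix (del ?R) x z)"
      using nf_1_D[OF x'(2,3)] x'(1) by (simp add: std_del_1)
  qed
  have h: "chain_map (mons 1) ?R ?C (matmap (mons 1) (basis ?R) (basis ?C) unit_matrix)"
  proof (rule chain_map_unit[OF fin(2,1)])
    show "gr ?R x = gr ?C x" if "x \<in> basis ?C" for x using g[OF that] by simp
    fix x z assume x: "x \<in> basis ?R" and z: "z \<in> basis ?C"
    have x': "z < m" "x < 2 * m + 3" "z < 2 * m + 3" using x z by (auto simp: D_simps)
    have "mm (basis ?C) unit_matrix (del ?C) x z = (if x < m then std_del a x z else 0)"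
    proof (cases "x < m")
      case True
      then show ?thesis using mm_unit_left[of "{0..2 * n}" x "std_del a" z] by simp
    next
      case False
      then show ?thesis by (auto simp: mm_def unit_matrix_def intro: sum.neutral)
    qed
    moreover have "mm (basis ?R) (del ?R) unit_matrix x z = normal_form (mons 1) (del D x z)"
      using mm_unit_right[of "basis ?R" z "del ?R" x] fin(2) x'(3) by (simp add: D_simps)
    ultimately show "normal_form (mons 1) (mm (basis ?R) (del ?R) unit_matrix x z)
        = normal_form (mons 1) (mm (basis ?C) unit_matrix (del ?C) x z)"
      using nf_1_D[OF x'(2,3)] x'(1) by (simp add: std_del_1)
  qed
  obtain p s p' s' where V: "pairing Vax ?R p s" "s 0 = 0" "\<forall>x\<in>basis ?R. s x = 0 \<longrightarrow> x = 0"
    and U: "pairing Uax ?R p' s'" "s' (2 * n) = 0" "\<forall>x\<in>basis ?R. s' x = 0 \<longrightarrow> x = 2 * n"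
    using pairing_D[of ?R] by auto
  have CV: "pairing Vax ?C std_pV (std_sV a)" "std_sV a 0 = 0" "\<forall>x\<in>basis ?C. std_sV a x = 0 \<longrightarrow> x = 0"
    and CU: "pairing Uax ?C (std_pU n) (std_sU n a)" "std_sU n a (2 * n) = 0" "\<forall>x\<in>basis ?C. std_sU n a x = 0 \<longrightarrow> x = 2 * n"
    using pairing_std_V[OF nz standard_complex_based] pairing_std_U[OF nz standard_complex_based]
      unmatched_V[OF nz] unmatched_U[OF nz] by (auto simp: std_sV_def std_sU_def)
  have mem: "0 \<in> basis ?C" "0 \<in> basis ?R" "2 * n \<in> basis ?C" "2 * n \<in> basis ?R" by (auto simp: D_simps)
  show "local_map ?C ?R (matmap (mons 1) {0..2 * n} (basis D) unit_matrix)"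
    using f unit_induced_bij[OF axis_V fin f mem(1,2) CV V] unit_induced_bij[OF axis_U fin f mem(3,4) CU U]
    by (simp add: local_map_def mons_V_range mons_U_range)
  show "local_map ?R ?C (matmap (mons 1) (basis D) {0..2 * n} unit_matrix)"
    using h unit_induced_bij[OF axis_V fin(2,1) h mem(2,1) V CV] unit_induced_bij[OF axis_U fin(2,1) h mem(4,3) U CU]
    by (simp add: local_map_def mons_V_range mons_U_range)
qed

lemma reduction_in_class: "reduction D \<in> local_class (standard_complex n a)"
  using local_maps reduction_knot_like by (auto simp: local_class_def locally_equivalent_def)

lemma reduction_realizable: "alg_realizable (reduction D)"
  unfolding alg_realizable_def
proof (intro exI conjI)
  show "isomorphic 1 (reduction D) (reduction D)"
    by (rule isomorphic_refl) (simp_all add: D_simps)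
  show "full_realization D (reduction D)" by (rule full_realization_reduction[OF D_chain_complex])
  show "correct_homology D" by (rule D_correct_homology) simp_all
qed

end

lemma partially_realizable_imp_realizable:
  assumes nz: "nonzero_seq n a" and "partially_realizable (standard_complex n a)"
  shows "class_realizable (local_class (standard_complex n a))"
proof -
  obtain E where "partial_realization E (standard_complex n a)"
    using assms by (auto simp: partially_realizable_def)
  then have "partial_real n a E"
    using partial_realization_std_lift(1) nz by (simp add: partial_real_def partial_realization_def)
  then show ?thesis
    unfolding class_realizable_def using partial_real.reduction_in_class partial_real.reduction_realizable by blast
qed

section \<open>Symmetric complexes\<close>

lemma const_mult: "lk (p * q) 0 = lk p 0 * lk q 0"
proof -
  have s: "r = Poly_Mapping.single 0 (lk r 0) + normal_form (- {0}) r" for r :: FUV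
    by (rule poly_mapping_eqI) (simp add: lookup_add lookup_single when_def)
  have z: "lk (normal_form (- {0}) r * t) 0 = 0" for r t
  proof -
    have "0 \<notin> Poly_Mapping.keys (normal_form (- {0}) r * t)"
    proof
      assume "0 \<in> Poly_Mapping.keys (normal_form (- {0}) r * t)"
      then obtain k l where "0 = k + l" "k \<in> Poly_Mapping.keys (normal_form (- {0}) r)"
        using keys_mult[of "normal_form (- {0}) r" t] by auto
      then show False by (cases k; cases l) (auto simp: in_keys_iff zero_prod_def split: if_splits)
    qed
    then show ?thesis by (simp add: in_keys_iff)
  qed
  define p0 p1 q0 q1 where "p0 = Poly_Mapping.single (0 :: nat \<times> nat) (lk p 0)" and "p1 = normal_form (- {0}) p"
    and "q0 = Poly_Mapping.single (0 :: nat \<times> nat) (lk q 0)" and "q1 = normal_form (- {0}) q"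
  have "p = p0 + p1" "q = q0 + q1" using s by (simp_all only: p0_def p1_def q0_def q1_def)
  then have "p * q = p0 * q0 + q1 * p0 + p1 * q" by (simp only: distrib_left distrib_right mult.commute add.assoc add.left_commute)
  moreover have "lk (q1 * p0) 0 = 0" "lk (p1 * q) 0 = 0" unfolding p1_def q1_def by (rule z)+
  moreover have "lk (p0 * q0) 0 = lk p 0 * lk q 0" by (simp add: p0_def q0_def mult_single)
  ultimately show ?thesis by (simp only: lookup_add add_0_right)
qed

text \<open>
  A symmetric standard complex is its own mirror image: the constant terms of the two homotopy
  equivalences between the complex and its conjugate are inverse to each other, as the
  differential has no constant terms.  Hence both maps take one end to the other end with constant
  coefficient, and then all letters agree, by walking along the complexes.
\<close>

lemma symmetric_sequence:
  assumes nz: "nonzero_seq n a" and sym: "symmetric_complex 1 (standard_complex n a)"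
  shows "x < 2 * n \<Longrightarrow> a (Suc x) = - a (2 * n - x)"
proof -
  define C where "C = standard_complex n a"
  have B: "basis C = {0..2 * n}" "basis (conj_complex C) = {0..2 * n}" and fin: "finite (basis C)" "finite (basis (conj_complex C))"
    and sb: "std_based n a C" by (simp_all add: C_def)
  note prU = pairing_std_U[OF nz sb] and prV = pairing_std_V[OF nz sb]
  obtain f g where f: "chain_map (mons 1) C (conj_complex C) f" and g: "chain_map (mons 1) (conj_complex C) C g"
    and id: "homotopic_to_id (mons 1) C (g \<circ> f)"
    using sym by (auto simp: symmetric_complex_def homotopy_equivalent_def C_def)
  define F H where "F = (\<lambda>x. f (gen x))" and "H = (\<lambda>x. g (gen x))"
  note MF = chain_map_matrix(3)[OF f order_ideal_1 fin, folded F_def]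
    and MH = chain_map_matrix(3)[OF g order_ideal_1 fin(2,1), folded H_def]
  have commF: "normal_form (range xe) (mm (basis C) (del C) F x z) = normal_form (range xe) (mm (basis (conj_complex C)) F (del (conj_complex C)) x z)"
    if "x \<in> basis C" "z \<in> basis (conj_complex C)" "axis xe" for x z xe
    using arg_cong[OF MF[OF that(1,2)], of "normal_form (range xe)"]
    by (simp only: nf_subset[OF axis_in_1[OF that(3)]])
  have commH: "normal_form (range xe) (mm (basis (conj_complex C)) (del (conj_complex C)) H x z) = normal_form (range xe) (mm (basis C) H (del C) x z)"
    if "x \<in> basis (conj_complex C)" "z \<in> basis C" "axis xe" for x z xe
    using arg_cong[OF MH[OF that(1,2)], of "normal_form (range xe)"]
    by (simp only: nf_subset[OF axis_in_1[OF that(3)]])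
  note FU = letter_step[OF axis_U prU fin(1) pairing_conj(2)[OF prV] fin(2) commF[OF _ _ axis_U]]
    and FV = letter_step[OF axis_V prV fin(1) pairing_conj(1)[OF prU] fin(2) commF[OF _ _ axis_V]]
    and HU = letter_step[OF axis_U pairing_conj(2)[OF prV] fin(2) prU fin(1) commH[OF _ _ axis_U]]
    and HV = letter_step[OF axis_V pairing_conj(1)[OF prU] fin(2) prV fin(1) commH[OF _ _ axis_V]]
  have const: "lk (std_del a x y) 0 = 0" if "x \<le> 2 * n" "y \<le> 2 * n" for x y
  proof (cases "std_del a x y = 0")
    case False
    then show ?thesis by (cases rule: std_del_nz) (auto simp: lookup_mono edge_def zero_prod_def)
  qed simp
  have "\<exists>y\<le>2 * n. lk (F 0 y) 0 = 1 \<and> lk (H y 0) 0 = 1"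
  proof -
    have z: "0 \<in> basis C" by (simp add: B)
    have g0: "gen 0 \<in> elts (mons 1) C" by (rule gen_elts[OF order_ideal_1 z])
    obtain h where h: "linear_map (mons 1) C C h"
      "\<And>w. w \<in> elts (mons 1) C \<Longrightarrow> (g \<circ> f) w - w = bd (mons 1) C (h w) + h (bd (mons 1) C w)"
      using id by (auto simp: homotopic_to_id_def)
    have c: "lk (bd (mons 1) C w 0) 0 = 0" for w
      using z const by (auto simp: bd_def lookup_sum const_mult B C_def intro!: sum.neutral)
    have "lk (bd (mons 1) C (gen 0) u) 0 = 0" for u
      using const by (auto simp: bd_def lookup_sum const_mult B C_def intro!: sum.neutral)
    moreover have "h (bd (mons 1) C (gen 0)) = matmap (mons 1) (basis C) (basis C) (\<lambda>x. h (gen x)) (bd (mons 1) C (gen 0))"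
      by (rule linear_map_matrix[OF h(1) order_ideal_1 fin(1)]) (simp add: bd_matmap)
    ultimately have d: "lk (h (bd (mons 1) C (gen 0)) 0) 0 = 0"
      by (auto simp: matmap_def lookup_sum const_mult intro!: sum.neutral)
    have "lk (g (f (gen 0)) 0) 0 + lk (gen (0::nat) 0) 0 = 0"
    proof -
      have "lk (((g \<circ> f) (gen 0) - gen 0) 0) 0 = lk ((bd (mons 1) C (h (gen 0)) + h (bd (mons 1) C (gen 0))) 0) 0"
        by (simp only: h(2)[OF g0])
      then show ?thesis by (simp only: elt_minus plus_fun_apply lookup_add o_apply c d add_0)
    qed
    then have "lk (g (f (gen 0)) 0) 0 = 1" by (cases "lk (g (f (gen 0)) 0) 0") (auto simp: gen_def)
    then have "lk (mm (basis (conj_complex C)) F H 0 0) 0 = 1"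
      using chain_map_comp_matrix[OF f g fin z z] by (simp add: F_def H_def split: if_splits)
    then have "(\<Sum>y\<in>{0..2 * n}. lk (F 0 y) 0 * lk (H y 0) 0) \<noteq> 0"
      by (simp add: mm_def lookup_sum const_mult B)
    then obtain y where "y \<in> {0..2 * n}" "lk (F 0 y) 0 * lk (H y 0) 0 \<noteq> 0"
      by (metis (no_types, lifting) sum.neutral)
    then show ?thesis by (intro exI[of _ y]) auto
  qed
  then obtain y where y: "y \<le> 2 * n" "lk (F 0 y) 0 = 1" "lk (H y 0) 0 = 1" by blast
  have "letter_le (std_sV a 0) (std_sU n a y)" "letter_le (std_sU n a y) (std_sV a 0)"
    using FV[of 0 y] HV[of y 0] y by (auto simp: B)
  then have "std_sU n a y = std_sV a 0" by (rule letter_le_antisym[symmetric])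
  then have y2n: "y = 2 * n" using unmatched_U[OF nz, of y] y(1) by (simp add: std_sV_def)
  have match: "\<And>s t. letter_le s t \<Longrightarrow> letter_le t s \<Longrightarrow> s = t" by (rule letter_le_antisym)
  have step: "(lk (F x (2 * n - x)) 0 = 1 \<and> lk (H (2 * n - x) x) 0 = 1) \<and>
      (x < 2 * n \<longrightarrow> a (Suc x) = - a (2 * n - x))" if "x \<le> 2 * n" for x
    using that
  proof (induction x)
    case 0
    have c: "lk (F 0 (2 * n)) 0 = 1" "lk (H (2 * n) 0) 0 = 1" using y y2n by auto
    have "std_sU n a 0 = std_sV a (2 * n)"
      by (rule match) (use FU[of 0 "2 * n"] HU[of "2 * n" 0] c in \<open>auto simp: B\<close>)
    then show ?case using c by (auto simp: std_sU_def std_sV_def split: if_splits)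
  next
    case (Suc x)
    have IH: "lk (F x (2 * n - x)) 0 = 1" "lk (H (2 * n - x) x) 0 = 1" using Suc by auto
    have e: "even (2 * n - x) \<longleftrightarrow> even x" "Suc (2 * n - Suc x) = 2 * n - x" "2 * n - x - 1 = 2 * n - Suc x"
      "2 * n - x \<noteq> 0" "x \<noteq> 2 * n" using Suc.prems by auto
    have U: "std_sU n a v = std_sV a w \<and> lk (F (std_pU n v) (std_pV w)) 0 = 1 \<and> lk (H (std_pV w) (std_pU n v)) 0 = 1"
      if "lk (F v w) 0 = 1" "lk (H w v) 0 = 1" "v \<le> 2 * n" "w \<le> 2 * n" for v w
    proof -
      have "std_sU n a v = std_sV a w"
        by (rule match) (use FU[of v w] HU[of w v] that in \<open>auto simp: B\<close>)
      then show ?thesis using FU[of v w] HU[of w v] that by (simp add: B)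
    qed
    have V: "std_sV a v = std_sU n a w \<and> lk (F (std_pV v) (std_pU n w)) 0 = 1 \<and> lk (H (std_pU n w) (std_pV v)) 0 = 1"
      if "lk (F v w) 0 = 1" "lk (H w v) 0 = 1" "v \<le> 2 * n" "w \<le> 2 * n" for v w
    proof -
      have "std_sV a v = std_sU n a w"
        by (rule match) (use FV[of v w] HV[of w v] that in \<open>auto simp: B\<close>)
      then show ?thesis using FV[of v w] HV[of w v] that by (simp add: B)
    qed
    have next': "lk (F (Suc x) (2 * n - Suc x)) 0 = 1 \<and> lk (H (2 * n - Suc x) (Suc x)) 0 = 1"
    proof (cases "even x")
      case True
      then have "std_pU n x = Suc x" "std_pV (2 * n - x) = 2 * n - Suc x" using e by (auto simp: std_pU_def std_pV_def)
      then show ?thesis using U[OF IH] Suc.prems by simp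
    next
      case False
      then have "2 * n - x \<noteq> 2 * n" using odd_pos[OF False] Suc.prems by linarith
      then have "std_pV x = Suc x" "std_pU n (2 * n - x) = 2 * n - Suc x" using e False odd_pos[OF False] by (auto simp: std_pU_def std_pV_def)
      then show ?thesis using V[OF IH] Suc.prems by simp
    qed
    have "a (Suc (Suc x)) = - a (2 * n - Suc x)" if "Suc x < 2 * n"
    proof (cases "even (Suc x)")
      case True
      then have "std_sU n a (Suc x) = std_sV a (2 * n - Suc x)" using U[of "Suc x" "2 * n - Suc x"] next' that by simp
      then show ?thesis using True that by (simp add: std_sU_def std_sV_def)
    next
      case False
      then have "std_sV a (Suc x) = std_sU n a (2 * n - Suc x)" using V[of "Suc x" "2 * n - Suc x"] next' that by simp
      moreover have "odd (2 * n - Suc x)" "2 * n - Suc x \<noteq> 2 * n" using False that by auto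
      ultimately show ?thesis using False by (simp add: std_sU_def std_sV_def)
    qed
    then show ?case using next' by blast
  qed
  show "x < 2 * n \<Longrightarrow> a (Suc x) = - a (2 * n - x)" using step[of x] by simp
qed

lemma symmetric_edge:
  assumes "\<And>x. x < 2 * n \<Longrightarrow> a (Suc x) = - a (2 * n - x)" and x: "x < 2 * n"
  shows "edge a (2 * n - x) = prod.swap (edge a (Suc x))"
proof -
  have "even (2 * n - x) \<longleftrightarrow> even x" using x by auto
  then show ?thesis using assms(1)[OF x] by (auto simp: edge_def)
qed

lemma symmetric_std_del:
  assumes s: "\<And>x. x < 2 * n \<Longrightarrow> a (Suc x) = - a (2 * n - x)" and x: "x \<le> 2 * n" and y: "y \<le> 2 * n"
  shows "std_del a (2 * n - x) (2 * n - y) = swap_UV (std_del a x y)"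
proof -
  have up: "std_del a (2 * n - v) (2 * n - Suc v) = swap_UV (std_del a v (Suc v)) \<and>
      std_del a (2 * n - Suc v) (2 * n - v) = swap_UV (std_del a (Suc v) v)" if v: "Suc v \<le> 2 * n" for v
  proof -
    have e: "2 * n - v = Suc (2 * n - Suc v)" using v by simp
    have g: "edge a (Suc (2 * n - Suc v)) = prod.swap (edge a (Suc v))" "a (Suc v) = - a (Suc (2 * n - Suc v))"
      using symmetric_edge[OF s, of v] s[of v] v e by simp_all
    show ?thesis unfolding e std_del_simps using g by (simp add: swap_mono)
  qed
  consider "y = Suc x" | "x = Suc y" | "y \<noteq> Suc x" "x \<noteq> Suc y" by blast
  then show ?thesis
  proof cases
    case 3
    then have "2 * n - y \<noteq> Suc (2 * n - x)" "2 * n - x \<noteq> Suc (2 * n - y)" using x y by linarith+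
    then show ?thesis using 3 by (simp add: std_del_simps)
  qed (use up x y in auto)
qed

lemma symmetric_grading:
  assumes nz: "nonzero_seq n a" and s: "\<And>x. x < 2 * n \<Longrightarrow> a (Suc x) = - a (2 * n - x)" and x: "x \<le> 2 * n"
  shows "gr (standard_complex n a) (2 * n - x) = prod.swap (gr (standard_complex n a) x)"
proof -
  define g where "g = gr (standard_complex n a)"
  note G = standard_complex_grading[OF nz nz, folded g_def]
  have "g (2 * n - v) - prod.swap (g v) = g (2 * n) - prod.swap (g 0)" if "v \<le> 2 * n" for v
    using that
  proof (induction v)
    case (Suc v)
    have e: "2 * n - v = Suc (2 * n - Suc v)" using Suc.prems by simp
    have "g (2 * n - v) = g (2 * n - Suc v) + edge_gr a (2 * n - v)"
      using G(1) Suc.prems unfolding e by simp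
    moreover have "g (Suc v) = g v + edge_gr a (Suc v)" using G(1) Suc.prems by simp
    moreover have "edge_gr a (2 * n - v) = - prod.swap (edge_gr a (Suc v))"
    proof -
      have "a (2 * n - v) \<noteq> 0" using nz Suc.prems by simp
      then show ?thesis
        using s[of v] symmetric_edge[OF s, of v] Suc.prems
        by (auto simp: edge_gr_def prod_eq_iff wt_fst_snd)
    qed
    ultimately have "g (2 * n - Suc v) - prod.swap (g (Suc v)) = g (2 * n - v) - prod.swap (g v)"
      by (simp add: prod_eq_iff)
    then show ?case using Suc by simp
  qed simp
  note d = this
  have "fst (g (2 * n)) = snd (g 0)"
    using arg_cong[OF d[of "2 * n"], of fst] G(2,3) by simp
  then have "g (2 * n) = prod.swap (g 0)"
    using G(2,3) by (intro prod_eqI) simp_all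
  then have "g (2 * n - x) = prod.swap (g x)" using d[OF x] by simp
  then show ?thesis by (simp only: g_def)
qed

text \<open>
  Two cones over lifts that agree modulo \<open>UV\<close> are isomorphic by a shear: this change of basis
  adds \<open>(\<partial> + \<partial>')/(UV)\<close> and \<open>(\<Phi> + \<Phi>')/(UV)\<close>, with values in the copy that is kept.  It is its own
  inverse.
\<close>

fun shear ::
    "(nat \<Rightarrow> nat \<Rightarrow> 'r) \<Rightarrow> (nat \<Rightarrow> nat \<Rightarrow> 'r) \<Rightarrow> (nat \<Rightarrow> nat \<Rightarrow> 'r) \<Rightarrow> (nat \<Rightarrow> nat \<Rightarrow> 'r) \<Rightarrow> blk \<Rightarrow> blk \<Rightarrow> 'r::comm_ring_1" where
  "shear e e' f f' (Keep x) (Keep y) = unit_matrix x y"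
| "shear e e' f f' (Copy x) (Copy y) = unit_matrix x y"
| "shear e e' f f' (Tower x) (Tower y) = unit_matrix x y"
| "shear e e' f f' (Copy x) (Keep y) = e x y + e' x y"
| "shear e e' f f' (Tower x) (Keep y) = f x y + f' x y"
| "shear e e' f f' _ _ = 0"

lemma shear_square:
  fixes e f :: "nat \<Rightarrow> nat \<Rightarrow> 'r::comm_ring_1"
  assumes char2: "\<And>c::'r. c + c = 0" and b: "b \<in> blks m" and c: "c \<in> blks m"
  shows "mm (blks m) (shear e e' f f') (shear e e' f f') b c = unit_matrix b c"
proof -
  have char2': "c + (c + d) = d" for c d :: 'r
    using char2[of c] by (simp flip: add.assoc)
  have u: "unit_matrix (Keep i) (Keep j) = unit_matrix i j" "unit_matrix (Copy i) (Copy j) = unit_matrix i j"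
    "unit_matrix (Tower i) (Tower j) = unit_matrix i j" "unit_matrix (Keep i) (Copy j) = 0"
    "unit_matrix (Keep i) (Tower j) = 0" "unit_matrix (Copy i) (Keep j) = 0" "unit_matrix (Copy i) (Tower j) = 0"
    "unit_matrix (Tower i) (Keep j) = 0" "unit_matrix (Tower i) (Copy j) = 0" for i j
    by (simp_all add: unit_matrix_def)
  show ?thesis
    using b c
    by (elim blks_cases)
      (simp_all add: mm_blks sum_unit u char2 char2' add.assoc add.left_commute add.commute)
qed

lemma cone_shear:
  fixes e e' t f f' :: "nat \<Rightarrow> nat \<Rightarrow> 'r::comm_ring_1"
  assumes char2: "\<And>c::'r. c + c = 0" and b: "b \<in> blks m" and c: "c \<in> blks m"
  shows "mm (blks m) (cone_bits m e t f) (shear e e' f f') b c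
    = mm (blks m) (shear e e' f f') (cone_bits m e' t f') b c"
proof -
  have char2': "c + (c + d) = d" for c d :: 'r
    using char2[of c] by (simp flip: add.assoc)
  show ?thesis
    using b c
    by (elim blks_cases)
      (simp_all add: mm_blks sum_unit distrib_left distrib_right sum.distrib char2 char2'
        mm_sum[where F=e and G=e] mm_sum[where F=e and G=e'] mm_sum[where F=e' and G=e']
        mm_sum[where F=f and G=e] mm_sum[where F=f and G=e'] mm_sum[where F=f' and G=e']
        mm_sum[where F=t and G=f] mm_sum[where F=t and G=f'] add.assoc add.left_commute add.commute)
qed

fun flip :: "nat \<Rightarrow> blk \<Rightarrow> blk" where
  "flip m (Keep x) = Keep (m - Suc x)"
| "flip m (Copy x) = Copy (m - Suc x)"
| "flip m (Tower i) = Tower (3 - Suc i)"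

lemma flip_mem: "b \<in> blks m \<Longrightarrow> flip m b \<in> blks m" and flip_flip: "b \<in> blks m \<Longrightarrow> flip m (flip m b) = b"
  by (auto elim!: blks_cases)

lemma sum_flip: "(\<Sum>b\<in>blks m. h (flip m b)) = (\<Sum>b\<in>blks m. h b)"
  by (rule sum.reindex_bij_witness[of _ "flip m" "flip m"]) (auto simp: flip_mem flip_flip)

lemma cone_bits_flip:
  assumes t: "\<And>i j. i < 3 \<Longrightarrow> j < 3 \<Longrightarrow> t (3 - Suc i) (3 - Suc j) = t i j" and b: "b \<in> blks m" and c: "c \<in> blks m"
  shows "cone_bits m e t f (flip m b) (flip m c)
    = cone_bits m (\<lambda>x y. e (m - Suc x) (m - Suc y)) t (\<lambda>i y. f (3 - Suc i) (m - Suc y)) b c"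
proof -
  have ee: "mm {..<m} (\<lambda>x y. h x (m - Suc y)) (\<lambda>x y. k (m - Suc x) (m - Suc y)) x y = mm {..<m} h k x (m - Suc y)"
    for h k :: "nat \<Rightarrow> nat \<Rightarrow> 'a" and x y
    unfolding mm_def using sum.nat_diff_reindex[of "\<lambda>i. h x i * k i (m - Suc y)" m] by simp
  have tf: "mm {..<3} t (\<lambda>i y. f (3 - Suc i) (m - Suc y)) i y = mm {..<3} t f (3 - Suc i) (m - Suc y)" if "i < 3" for i y
  proof -
    have "mm {..<3} t (\<lambda>i y. f (3 - Suc i) (m - Suc y)) i y = (\<Sum>j<3. t (3 - Suc i) (3 - Suc j) * f (3 - Suc j) (m - Suc y))"
      unfolding mm_def by (rule sum.cong) (use t[OF that] in simp_all)
    also have "\<dots> = mm {..<3} t f (3 - Suc i) (m - Suc y)"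
      unfolding mm_def using sum.nat_diff_reindex[of "\<lambda>j. t (3 - Suc i) j * f j (m - Suc y)" 3] by simp
    finally show ?thesis .
  qed
  \<comment> \<open>the form in which the simplifier leaves the indices\<close>
  have t2: "t (2 - i) (2 - j) = t i j" if "i < 3" "j < 3" for i j using t[OF that] by simp
  show ?thesis
    using b c
  proof (elim blks_cases)
    fix x y assume "x < m" "y < m" "b = Keep x" "c = Copy y"
    then show ?thesis by (auto simp: unit_matrix_def)
  next
    fix x y assume "x < m" "y < m" "b = Copy x" "c = Keep y"
    then show ?thesis using ee[where h="\<lambda>x. e (m - Suc x)" and k=e and x=x and y=y] by (simp add: mm_def)
  next
    fix x y assume h: "x < 3" "y < m" "b = Tower x" "c = Keep y"
    then show ?thesis
      using ee[where h="\<lambda>i. f (3 - Suc i)" and k=e and x=x and y=y] tf[OF h(1), of y]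
      by (simp add: mm_def)
  qed (auto simp: t2)
qed

lemma swap_mk: "swap_UV (mk d c) = mk (prod.swap d) c"
proof (rule poly_mapping_eqI)
  fix k
  have "wt (prod.swap k) = d \<longleftrightarrow> wt k = prod.swap d" by (metis swap_wt swap_swap)
  then show "lk (swap_UV (mk d c)) k = lk (mk (prod.swap d) c) k" by (simp add: lookup_mk)
qed

lemma valid_swap [simp]: "valid (prod.swap d) \<longleftrightarrow> valid d"
  by (cases d) (auto simp: valid_def)

lemma diagonal_swap [simp]: "diagonal (prod.swap d) \<longleftrightarrow> diagonal d"
  by (cases d) (auto simp: diagonal_def valid_def)

lemma diagonal_shift: "diagonal d \<Longrightarrow> valid (d + (2, 2))"
  by (auto simp: diagonal_def valid_def)

text \<open>
  Isomorphisms of a complex over \<open>F[U,V]\<close> with its conjugate descend to the reduction.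
\<close>

lemma symmetric_reduction:
  assumes b: "finite (basis D)" and F: "hmat D (conj_complex D) 0 F" and G: "hmat (conj_complex D) D 0 G"
    and comm: "\<And>x z. x \<in> basis D \<Longrightarrow> z \<in> basis D \<Longrightarrow> mm (basis D) (del D) F x z = mm (basis D) F (del (conj_complex D)) x z"
      "\<And>x z. x \<in> basis D \<Longrightarrow> z \<in> basis D \<Longrightarrow> mm (basis D) (del (conj_complex D)) G x z = mm (basis D) G (del D) x z"
    and inv: "\<And>x z. x \<in> basis D \<Longrightarrow> z \<in> basis D \<Longrightarrow> mm (basis D) F G x z = unit_matrix x z"
      "\<And>x z. x \<in> basis D \<Longrightarrow> z \<in> basis D \<Longrightarrow> mm (basis D) G F x z = unit_matrix x z"
  shows "symmetric_complex \<infinity> D" "symmetric_complex 1 (reduction D)"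
proof -
  show "symmetric_complex \<infinity> D"
    unfolding symmetric_complex_def
    by (rule homotopy_equivalent_matrix[OF _ _ _ F G]) (use b comm inv in simp_all)
  have h: "hmat (reduction D) (conj_complex (reduction D)) 0 F" "hmat (conj_complex (reduction D)) (reduction D) 0 G"
    using F G by (simp_all add: hmat_def)
  have d: "normal_form (mons 1) (del (conj_complex (reduction D)) x y) = normal_form (mons 1) (del (conj_complex D) x y)" for x y
    by (simp add: nf_swap)
  show "symmetric_complex 1 (reduction D)"
    unfolding symmetric_complex_def
  proof (rule homotopy_equivalent_matrix[OF order_refl _ _ h])
    fix x z assume "x \<in> basis (reduction D)" "z \<in> basis (conj_complex (reduction D))"
    then have xz: "x \<in> basis D" "z \<in> basis D" by auto
    have "normal_form (mons 1) (mm (basis D) (del (reduction D)) F x z) = normal_form (mons 1) (mm (basis D) (del D) F x z)"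
      by (rule nf_mm_cong) simp_all
    also have "\<dots> = normal_form (mons 1) (mm (basis D) F (del (conj_complex (reduction D))) x z)"
      unfolding comm(1)[OF xz] by (rule nf_mm_cong[OF order_ideal_1]) (simp_all only: d)
    finally show "normal_form (mons 1) (mm (basis (reduction D)) (del (reduction D)) F x z)
        = normal_form (mons 1) (mm (basis (conj_complex (reduction D))) F (del (conj_complex (reduction D))) x z)"
      by (simp only: reduction_simps(1) conj_simps(1))
  next
    fix x z assume "x \<in> basis (conj_complex (reduction D))" "z \<in> basis (reduction D)"
    then have xz: "x \<in> basis D" "z \<in> basis D" by auto
    have "normal_form (mons 1) (mm (basis D) (del (conj_complex (reduction D))) G x z) = normal_form (mons 1) (mm (basis D) (del (conj_complex D)) G x z)"
      by (rule nf_mm_cong[OF order_ideal_1]) (simp_all only: d)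
    also have "\<dots> = normal_form (mons 1) (mm (basis D) G (del (reduction D)) x z)"
      unfolding comm(2)[OF xz] by (rule nf_mm_cong) simp_all
    finally show "normal_form (mons 1) (mm (basis (conj_complex (reduction D))) (del (conj_complex (reduction D))) G x z)
        = normal_form (mons 1) (mm (basis (reduction D)) G (del (reduction D)) x z)"
      by (simp only: reduction_simps(1) conj_simps(1))
  qed (use b inv in simp_all)
qed

context partial_real
begin

text \<open>
  Relabelling by \<open>flip\<close> turns the conjugate of the cone into the cone for the mirror image \<open>e'\<close>, \<open>f'\<close> of
  the data, with bits \<open>?M'\<close>, and the shear \<open>P\<close> is an isomorphism between the two.  That \<open>P\<close> has
  entries in \<open>F[U,V]\<close> is where symmetry of the standard complex enters: \<open>e\<close> and \<open>e'\<close>, and likewise \<open>f\<close>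
  and \<open>f'\<close>, agree on all entries that are not divisible by \<open>UV\<close>.
\<close>

lemma cone_symmetric:
  assumes s: "\<And>x. x < 2 * n \<Longrightarrow> a (Suc x) = - a (2 * n - x)"
  shows "symmetric_complex \<infinity> D" "symmetric_complex 1 (reduction D)"
proof -
  let ?r = "flip m"
  define e' where "e' x y = e (m - Suc x) (m - Suc y)" for x y
  define f' where "f' i y = f (3 - Suc i) (m - Suc y)" for i y
  define P where "P = shear e e' f f'"
  let ?M' = "cone_bits m e' tower_bits f'"
  have char2: "c + c = 0" for c :: bit by simp
  have grE: "gr E (m - Suc x) = prod.swap (gr E x)" if "x < m" for x
    using symmetric_grading[OF nz s, of x] that lift by (simp add: std_lift_def)
  have grE2: "gr E (2 * n - x) = prod.swap (gr E x)" if "x < m" for x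
    using grE[OF that] by simp
  have tg: "tower_gr N (3 - Suc i) = prod.swap (tower_gr N i)" if "i < 3" for i
    using less_3_cases[OF that] by (auto simp: tower_gr_def)
  have Gr: "G (?r b) = prod.swap (G b)" if "b \<in> blks m" for b
    using that grE tg by (elim blks_cases) (auto simp: swap_plus)
  have Mr: "M (?r b) (?r c) = ?M' b c" if "b \<in> blks m" "c \<in> blks m" for b c
  proof -
    have "tower_bits (3 - Suc i) (3 - Suc j) = tower_bits i j" if "i < 3" "j < 3" for i j
      using less_3_cases[OF that(1)] less_3_cases[OF that(2)] by (auto simp: tower_bits_def)
    then show ?thesis using cone_bits_flip[of tower_bits b m c e f] that by (simp add: e'_def[abs_def] f'_def[abs_def])
  qed
  have e_std: "e x y = (if std_del a x y = 0 then 0 else 1)"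
    if xy: "x < m" "y < m" "valid (deg E x y)" "\<not> diagonal (deg E x y)" for x y
  proof -
    have "expo (deg E x y) \<in> mons 1"
      using xy(3,4) by (auto simp: diagonal_def valid_def expo_def)
    then have "normal_form (mons 1) (del E x y) = del E x y"
      using bits_del[OF bE, of x y] xy(1,2) B(1) by (simp add: nf_mk)
    then show ?thesis using std_nf[OF xy(1,2)] by (simp add: bits_def)
  qed
  have eta: "valid (gr E x + (1, 1) - gr E y)" if xy: "x < m" "y < m" and nonzero: "e x y + e' x y \<noteq> 0" for x y
  proof -
    have r: "m - Suc x < m" "m - Suc y < m" by auto
    have dr: "deg E (m - Suc x) (m - Suc y) = prod.swap (deg E x y)"
      by (simp add: deg_def grE2 xy prod_eq_iff)
    have dr2: "deg E (2 * n - x) (2 * n - y) = prod.swap (deg E x y)" using dr by simp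
    have v: "valid (deg E x y)"
    proof (cases "e x y = 0")
      case True
      then have "e (m - Suc x) (m - Suc y) \<noteq> 0" using nonzero by (simp add: e'_def)
      then have "valid (deg E (m - Suc x) (m - Suc y))" using bits_valid[OF bE] r B(1) by auto
      then show ?thesis by (simp add: dr2)
    next
      case False
      then show ?thesis using bits_valid[OF bE] xy B(1) by auto
    qed
    have "diagonal (deg E x y)"
    proof (rule ccontr)
      assume nd: "\<not> diagonal (deg E x y)"
      have "std_del a (m - Suc x) (m - Suc y) = swap_UV (std_del a x y)"
        using symmetric_std_del[OF s, of x y] xy by simp
      then have "e' x y = (if std_del a x y = 0 then 0 else 1)"
        using e_std[OF r] v nd by (simp add: dr2 e'_def swap_eq_iff)
      then show False using e_std[OF xy v nd] nonzero by (simp split: if_splits)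
    qed
    then have "valid (deg E x y + (2, 2))" by (rule diagonal_shift)
    moreover have "deg E x y + (2, 2) = gr E x + (1, 1) - gr E y" by (simp add: deg_def prod_eq_iff)
    ultimately show ?thesis by simp
  qed
  have f_diag: "diagonal (tower_gr N i - gr E y)"
    if iy: "i < 3" "y < m" "f i y \<noteq> 0" "\<not> (i = 0 \<and> y = 0)" "\<not> (i = 2 \<and> y = 2 * n)" for i y
  proof -
    have "i = 0 \<or> i = 2" using less_3_cases[OF iy(1)] iy(3) f0(3) by auto
    then show ?thesis
      using f_valid[OF iy(1-3)] f_grade[OF iy(2)] iy(3-5) by (auto simp: diagonal_def tower_gr_def)
  qed
  have mu: "valid (tower_gr N i + (2, 2) - gr E y)" if iy: "i < 3" "y < m" and nonzero: "f i y + f' i y \<noteq> 0" for i y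
  proof -
    have r: "3 - Suc i < 3" "m - Suc y < m" by auto
    have ends': "\<not> (i = 0 \<and> y = 0)" "\<not> (i = 2 \<and> y = 2 * n)"
    proof -
      have "f i y = 1 \<and> f' i y = 1" if "i = 0 \<and> y = 0 \<or> i = 2 \<and> y = 2 * n"
        using that f0 by (elim disjE) (simp_all add: f'_def)
      then have "\<not> (i = 0 \<and> y = 0 \<or> i = 2 \<and> y = 2 * n)" using nonzero by (metis bit_add_self)
      then show "\<not> (i = 0 \<and> y = 0)" "\<not> (i = 2 \<and> y = 2 * n)" by blast+
    qed
    have "diagonal (tower_gr N i - gr E y)"
    proof (cases "f i y = 0")
      case True
      then have "f (3 - Suc i) (m - Suc y) \<noteq> 0" using nonzero by (simp add: f'_def)
      moreover have "\<not> (3 - Suc i = 0 \<and> m - Suc y = 0)" "\<not> (3 - Suc i = 2 \<and> m - Suc y = 2 * n)"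
        using ends' iy by auto
      ultimately have "diagonal (tower_gr N (3 - Suc i) - gr E (m - Suc y))" by (rule f_diag[OF r])
      moreover have "tower_gr N (3 - Suc i) - gr E (m - Suc y) = prod.swap (tower_gr N i - gr E y)"
        using tg[OF iy(1)] grE2[OF iy(2)] by (simp add: prod_eq_iff)
      ultimately show ?thesis by simp
    next
      case False
      then show ?thesis using f_diag iy ends' by blast
    qed
    then have "valid (tower_gr N i - gr E y + (2, 2))" by (rule diagonal_shift)
    moreover have "tower_gr N i - gr E y + (2, 2) = tower_gr N i + (2, 2) - gr E y" by (simp add: prod_eq_iff)
    ultimately show ?thesis by simp
  qed
  have P_valid: "valid (G b - G c)" if "b \<in> blks m" "c \<in> blks m" "P b c \<noteq> 0" for b c
    using that by (elim blks_cases) (auto simp: P_def eta mu unit_matrix_def split: if_splits)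
  have PP: "mm (blks m) P P b c = unit_matrix b c" if "b \<in> blks m" "c \<in> blks m" for b c
    unfolding P_def using that by (rule shear_square[OF char2])
  have MP: "mm (blks m) M P b c = mm (blks m) P ?M' b c" if "b \<in> blks m" "c \<in> blks m" for b c
    unfolding P_def using that by (rule cone_shear[OF char2])
  have P': "shear e' e f' f b c = P b c" for b c
    unfolding P_def by (cases b; cases c) (simp_all only: shear.simps add.commute)
  have M'P: "mm (blks m) ?M' P b c = mm (blks m) P M b c" if "b \<in> blks m" "c \<in> blks m" for b c
    using cone_shear[OF char2 that, of e' tower_bits f' e f] unfolding P'[abs_def] by (simp add: mm_def P')
  define F where "F x y = mk (G (dec m x) - prod.swap (G (dec m y))) (P (dec m x) (?r (dec m y)))" for x y
  define H where "H x y = mk (prod.swap (G (dec m x)) - G (dec m y)) (P (?r (dec m x)) (dec m y))" for x y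
  have inD: "x \<in> basis D \<Longrightarrow> dec m x \<in> blks m" for x using dec_in[of x m] by (simp add: D_simps)
  have vF: "valid (G b - prod.swap (G c))" if "b \<in> blks m" "c \<in> blks m" "P b (?r c) \<noteq> 0" for b c
    using P_valid[OF that(1) flip_mem[OF that(2)] that(3)] Gr[OF that(2)] by simp
  have vH: "valid (prod.swap (G b) - G c)" if "b \<in> blks m" "c \<in> blks m" "P (?r b) c \<noteq> 0" for b c
    using P_valid[OF flip_mem[OF that(1)] that(2,3)] Gr[OF that(1)] by simp
  have sumD: "mm (basis D) (\<lambda>x y. A (dec m x) (dec m y)) (\<lambda>x y. A' (dec m x) (dec m y)) x z
      = mm (blks m) A A' (dec m x) (dec m z)" for A A' :: "blk \<Rightarrow> blk \<Rightarrow> bit" and x z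
    unfolding mm_def D_simps(1) by (rule sum_dec[of "\<lambda>b. A (dec m x) b * A' b (dec m z)"])
  have fl: "(\<Sum>y\<in>blks m. h (?r y)) = (\<Sum>y\<in>blks m. h y)" for h :: "blk \<Rightarrow> bit" by (rule sum_flip)
  have delc: "del (conj_complex D) x y = mk (prod.swap (G (dec m x) - (1, 1) - G (dec m y))) (M (dec m x) (dec m y))" for x y
    by (simp add: D_simps swap_mk)
  have comm1: "mm (basis D) (del D) F x z = mm (basis D) F (del (conj_complex D)) x z"
    if x: "x \<in> basis D" and z: "z \<in> basis D" for x z
  proof -
    note b = inD[OF x] inD[OF z]
    let ?d = "G (dec m x) - (1, 1) - prod.swap (G (dec m z))"
    have "mm (basis D) (del D) F x z = mk ?d (mm (basis D) (\<lambda>x y. M (dec m x) (dec m y)) (\<lambda>x y. P (dec m x) (?r (dec m y))) x z)"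
      unfolding D_simps(3) F_def[abs_def]
      by (rule mm_mk) (use b inD support(1) vF in \<open>auto simp: prod_eq_iff\<close>)
    also have "mm (basis D) (\<lambda>x y. M (dec m x) (dec m y)) (\<lambda>x y. P (dec m x) (?r (dec m y))) x z
        = mm (blks m) M P (dec m x) (?r (dec m z))"
      using sumD[of M "\<lambda>b c. P b (?r c)"] by (simp add: mm_def)
    also have "\<dots> = mm (blks m) P ?M' (dec m x) (?r (dec m z))"
      by (rule MP[OF b(1) flip_mem[OF b(2)]])
    also have "\<dots> = mm (blks m) (\<lambda>b c. P b (?r c)) M (dec m x) (dec m z)"
      unfolding mm_def
      by (subst fl[symmetric], rule sum.cong[OF refl])
        (simp add: Mr[symmetric] flip_mem flip_flip b)
    also have "\<dots> = mm (basis D) (\<lambda>x y. P (dec m x) (?r (dec m y))) (\<lambda>x y. M (dec m x) (dec m y)) x z"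
      using sumD[of "\<lambda>b c. P b (?r c)" M] by simp
    also have "mk ?d \<dots> = mm (basis D) F (del (conj_complex D)) x z"
      unfolding delc[abs_def] F_def[abs_def]
      by (rule mm_mk[symmetric]) (use b inD support(1) vF in \<open>auto simp: prod_eq_iff\<close>)
    finally show ?thesis .
  qed
  have comm2: "mm (basis D) (del (conj_complex D)) H x z = mm (basis D) H (del D) x z"
    if x: "x \<in> basis D" and z: "z \<in> basis D" for x z
  proof -
    note b = inD[OF x] inD[OF z]
    let ?d = "prod.swap (G (dec m x)) - (1, 1) - G (dec m z)"
    have "mm (basis D) (del (conj_complex D)) H x z = mk ?d (mm (basis D) (\<lambda>x y. M (dec m x) (dec m y)) (\<lambda>x y. P (?r (dec m x)) (dec m y)) x z)"
      unfolding delc[abs_def] H_def[abs_def]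
      by (rule mm_mk) (use b inD support(1) vH in \<open>auto simp: prod_eq_iff\<close>)
    also have "mm (basis D) (\<lambda>x y. M (dec m x) (dec m y)) (\<lambda>x y. P (?r (dec m x)) (dec m y)) x z
        = mm (blks m) M (\<lambda>b. P (?r b)) (dec m x) (dec m z)"
      using sumD[of M "\<lambda>b c. P (?r b) c"] by simp
    also have "\<dots> = mm (blks m) ?M' P (?r (dec m x)) (dec m z)"
      unfolding mm_def
      by (subst fl[symmetric], rule sum.cong[OF refl])
        (simp add: Mr[symmetric] flip_mem flip_flip b)
    also have "\<dots> = mm (blks m) P M (?r (dec m x)) (dec m z)"
      by (rule M'P[OF flip_mem[OF b(1)] b(2)])
    also have "\<dots> = mm (basis D) (\<lambda>x y. P (?r (dec m x)) (dec m y)) (\<lambda>x y. M (dec m x) (dec m y)) x z"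
      using sumD[of "\<lambda>b c. P (?r b) c" M] by (simp add: mm_def)
    also have "mk ?d \<dots> = mm (basis D) H (del D) x z"
      unfolding D_simps(3) H_def[abs_def]
      by (rule mm_mk[symmetric]) (use b inD support(1) vH in \<open>auto simp: prod_eq_iff\<close>)
    finally show ?thesis .
  qed
  have dec_inj: "unit_matrix (dec m x) (dec m z) = (unit_matrix x z :: bit)" for x z
    by (metis enc_dec unit_matrix_def)
  have mk_unit: "mk (h x - h z) (unit_matrix x z) = unit_matrix x z" for h :: "nat \<Rightarrow> int \<times> int" and x z
    by (simp add: unit_matrix_def)
  have inv1: "mm (basis D) F H x z = unit_matrix x z" if x: "x \<in> basis D" and z: "z \<in> basis D" for x z
  proof -
    note b = inD[OF x] inD[OF z]
    have "mm (basis D) F H x z = mk (G (dec m x) - G (dec m z)) (mm (basis D) (\<lambda>x y. P (dec m x) (?r (dec m y))) (\<lambda>x y. P (?r (dec m x)) (dec m y)) x z)"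
      unfolding F_def[abs_def] H_def[abs_def]
      by (rule mm_mk) (use b inD vF vH in auto)
    also have "mm (basis D) (\<lambda>x y. P (dec m x) (?r (dec m y))) (\<lambda>x y. P (?r (dec m x)) (dec m y)) x z
        = (\<Sum>y\<in>blks m. P (dec m x) (?r y) * P (?r y) (dec m z))"
      using sumD[of "\<lambda>b c. P b (?r c)" "\<lambda>b c. P (?r b) c"] by (simp add: mm_def)
    also have "\<dots> = mm (blks m) P P (dec m x) (dec m z)"
      unfolding mm_def using fl[of "\<lambda>y. P (dec m x) y * P y (dec m z)"] .
    finally show ?thesis unfolding PP[OF b] dec_inj using mk_unit[of "\<lambda>x. G (dec m x)"] by simp
  qed
  have inv2: "mm (basis D) H F x z = unit_matrix x z" if x: "x \<in> basis D" and z: "z \<in> basis D" for x z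
  proof -
    note b = inD[OF x] inD[OF z]
    have "mm (basis D) H F x z = mk (prod.swap (G (dec m x)) - prod.swap (G (dec m z))) (mm (basis D) (\<lambda>x y. P (?r (dec m x)) (dec m y)) (\<lambda>x y. P (dec m x) (?r (dec m y))) x z)"
      unfolding F_def[abs_def] H_def[abs_def]
      by (rule mm_mk) (use b inD vF vH in auto)
    also have "mm (basis D) (\<lambda>x y. P (?r (dec m x)) (dec m y)) (\<lambda>x y. P (dec m x) (?r (dec m y))) x z
        = mm (blks m) P P (?r (dec m x)) (?r (dec m z))"
      using sumD[of "\<lambda>b c. P (?r b) c" "\<lambda>b c. P b (?r c)"] by (simp add: mm_def)
    also have "\<dots> = unit_matrix (?r (dec m x)) (?r (dec m z))"
      by (rule PP[OF flip_mem[OF b(1)] flip_mem[OF b(2)]])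
    also have "\<dots> = unit_matrix (dec m x) (dec m z)"
      unfolding unit_matrix_def using flip_flip b by metis
    finally show ?thesis unfolding dec_inj using mk_unit[of "\<lambda>x. prod.swap (G (dec m x))"] by simp
  qed
  have hF: "hmat D (conj_complex D) 0 F"
    unfolding hmat_def F_def by (auto simp: D_simps dest!: keys_mk)
  have hH: "hmat (conj_complex D) D 0 H"
    unfolding hmat_def H_def by (auto simp: D_simps dest!: keys_mk)
  have fin: "finite (basis D)" by (simp add: D_simps)
  show "symmetric_complex \<infinity> D" "symmetric_complex 1 (reduction D)"
    using symmetric_reduction[OF fin hF hH comm1 comm2 inv1 inv2] by blast+
qed

lemma reduction_realizable_sym:
  assumes "symmetric_complex 1 (standard_complex n a)"
  shows "symmetric_complex 1 (reduction D)" "alg_realizable_sym (reduction D)"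
proof -
  note s = cone_symmetric[OF symmetric_sequence[OF nz assms]]
  show "symmetric_complex 1 (reduction D)" by (rule s(2))
  show "alg_realizable_sym (reduction D)"
    unfolding alg_realizable_sym_def
  proof (intro exI conjI)
    show "isomorphic 1 (reduction D) (reduction D)"
      by (rule isomorphic_refl) (simp_all add: D_simps)
    show "full_realization D (reduction D)" by (rule full_realization_reduction[OF D_chain_complex])
    show "symmetric_complex \<infinity> D" by (rule s(1))
    show "correct_homology D" by (rule D_correct_homology) simp_all
  qed
qed

end

section \<open>Deciding realizability of local classes\<close>

theorem theorem1p1:
  fixes n :: nat and a :: "nat \<Rightarrow> int"
  assumes "n \<ge> 1" and "\<forall>i\<in>{1..2 * n}. a i \<noteq> 0"
  shows
    "(class_realizable (local_class (standard_complex n a)) \<longleftrightarrow>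
        partially_realizable (standard_complex n a)) \<and>
     (symmetric_complex 1 (standard_complex n a) \<longrightarrow>
       (class_realizable_sym (local_class (standard_complex n a)) \<longleftrightarrow>
          partially_realizable (standard_complex n a))) \<and>
     (\<forall>k C. (proc_adds ^^ k) (standard_complex n a) C \<longrightarrow> k \<le> n\<^sup>2 + n) \<and>
     (partially_realizable (standard_complex n a) \<longrightarrow>
       (\<forall>s. proc_ends (standard_complex n a) s \<longrightarrow>
          (\<exists>D. s = Success D \<and> partial_realization D (standard_complex n a)))) \<and>
     (\<not> partially_realizable (standard_complex n a) \<longrightarrow>
       (\<forall>s. proc_ends (standard_complex n a) s \<longrightarrow> s = Failure)) \<and>
     ((\<forall>i\<in>{1..2 * n}. \<bar>a i\<bar> \<ge> 2) \<longrightarrow>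
       class_realizable (local_class (standard_complex n a)) \<and>
       (symmetric_complex 1 (standard_complex n a) \<longrightarrow>
          class_realizable_sym (local_class (standard_complex n a))))"
proof -
  note nz = assms(2)
  have plain: "class_realizable (local_class (standard_complex n a)) \<longleftrightarrow> partially_realizable (standard_complex n a)"
    using partially_realizable_imp_realizable[OF nz] realizable_imp_partially_realizable[OF nz]
    unfolding class_realizable_def alg_realizable_def by blast
  have sym: "class_realizable_sym (local_class (standard_complex n a)) \<longleftrightarrow> partially_realizable (standard_complex n a)"
    if s: "symmetric_complex 1 (standard_complex n a)"
  proof
    assume "class_realizable_sym (local_class (standard_complex n a))"
    then show "partially_realizable (standard_complex n a)"
      using realizable_imp_partially_realizable[OF nz]
      unfolding class_realizable_sym_def alg_realizable_sym_def by blast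
  next
    assume "partially_realizable (standard_complex n a)"
    then obtain E where "partial_realization E (standard_complex n a)"
      by (auto simp: partially_realizable_def)
    then have "partial_real n a E"
      using partial_realization_std_lift(1) nz by (simp add: partial_real_def partial_realization_def)
    then show "class_realizable_sym (local_class (standard_complex n a))"
      unfolding class_realizable_sym_def
      using partial_real.reduction_in_class partial_real.reduction_realizable_sym[OF _ s] by blast
  qed
  have bound: "k \<le> n\<^sup>2 + n" if "(proc_adds ^^ k) (standard_complex n a) C" for k C
    using proc_adds_bound[OF nz that] card_arrows(2)[OF nz] le_trans by blast
  show ?thesis
  proof (intro conjI impI allI)
    fix s assume "proc_ends (standard_complex n a) s"
    note p = proc_ends_inv[OF nz this]
    show "partially_realizable (standard_complex n a) \<Longrightarrow>
        \<exists>D. s = Success D \<and> partial_realization D (standard_complex n a)"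
      using p by blast
    show "\<not> partially_realizable (standard_complex n a) \<Longrightarrow> s = Failure"
      using p by (auto simp: partially_realizable_def)
  qed (use plain sym long_partially_realizable[OF nz] in \<open>simp_all add: bound\<close>)
qed

end
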